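(* Suppose the step-size, compactness, ergodicity, kernel-continuity, growth, interior-target and quasi-strong-monotonicity conditions listed in the context all hold, with $1/2<\delta\le 1$. When $\delta=1$, suppose also that $2\zeta\alpha_0>1$. Fix $0\le\beta<\delta-1/2$ and $c>0$. Then there are positive constants $C$ and $K$ such that, for all $k_0\ge K$, $$\mathbb P\Bigl(\|\theta_k-\theta^\star\|\le c\,k^{-\beta}\ \text{ for all } k\ge k_0\,\Bigm|\,\mathcal F_0\Bigr)\ \ge\ 1-C\,U_2(W_0)\,(1+\log k_0)^2\,k_0^{-(2(\delta-\beta)-1)}.$$
   Context: Setting. $\|\cdot\|$ is the Euclidean norm and $\langle\cdot,\cdot\rangle$ the Euclidean inner product. $\Theta\subseteq\mathbb R^d$, and $\Pi_\Theta(x):=\arg\min_{\theta\in\Theta}\|x-\theta\|$ is Euclidean projection. $\mathcal W$ is a Borel subset of a Euclidean space, $F:\Theta\times\mathcal W\to\mathbb R^d$ is jointly Borel measurable, and $\{P_\theta:\theta\in\Theta\}$ is a family of Markov transition kernels on $\mathcal W$ with $(\theta,w)\mapsto P_\theta(w,E)$ Borel measurable for each Borel $E\subseteq\mathcal W$. Write $(P_\theta f)(w):=\int_{\mathcal W}f(y)P_\theta(w,dy)$, $P_\theta^k$ for the $k$-step kernel, and $U_p(w):=1+\|w\|^p$ for $p\in\{1,2\}$. On a probability space, $(\theta_0,W_0)$ is a $\Theta\times\mathcal W$-valued random element, and $$\theta_{k+1}=\Pi_\Theta\bigl(\theta_k+\alpha_kF(\theta_k,W_k)\bigr),\qquad k\ge0.$$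 With $\mathcal F_k:=\sigma(\theta_0,W_0,\dots,\theta_k,W_k)$, the process $\{W_k\}$ is the adaptive Markov chain: $\mathbb P(W_{k+1}\in E\mid\mathcal F_k)=P_{\theta_k}(W_k,E)$ for all Borel $E$ and $k\ge0$. (In)equalities between random quantities hold almost surely. Constants are deterministic; they may depend on the fixed model and result parameters but not on running indices, sample paths, or the realization of $(\theta_0,W_0)$. Conditions. - Step sizes: $\alpha_0>0$, $\delta\in(0,1]$, and $\alpha_k=\alpha_0k^{-\delta}$ for all $k\ge1$ (the step size at $k=0$ is $\alpha_0$). - Compactness: $\Theta$ is nonempty, compact and convex. - Ergodicity: (i) each $P_\theta$ is irreducible and aperiodic (as a general-state-space chain); there are a positive integer $N$, a nonempty Borel set $\mathcal W_0\subseteq\mathcal W$, $\epsilon_0>0$ and a probability measure $\varphi$ on $\mathcal W$ with $P_\theta^N(w,E)\ge\epsilon_0\varphi(E)$ for all $\theta\in\Theta$, $w\in\mathcal W_0$ and Borel $E$; and there are constants $0\le\lambda<1$, $b\ge0$ with $(P_\theta U_2)(w)\le\lambda U_2(w)+b\,\mathbb I_{\mathcal W_0}(w)$ for all $\theta\in\Theta$, $w\in\mathcal W$. (ii) $\mathbb E[U_2(W_0)]<\infty$. Part (i) ensures that each $P_\theta$ has a unique stationary distribution $\nu_\theta$ and $\sup_\theta\nu_\theta(U_2)<\infty$. The mean field is $\bar F(\theta):=\int_{\mathcal W}F(\theta,w)\,\nu_\theta(dw)$. - Kernel continuity: there is $L_P>0$ with $|(P_\theta f)(w)-(P_{\theta'}f)(w)|\le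 L_PU_1(w)\|\theta-\theta'\|$ for all $\theta,\theta'\in\Theta$, $w\in\mathcal W$ and Borel $f:\mathcal W\to\mathbb R$ with $|f|\le U_1$. - Growth: there are $L_F,C_F>0$ with $\|F(\theta,w)-F(\theta',w)\|\le L_F(1+\|w\|)\|\theta-\theta'\|$ and $\sup_{\theta\in\Theta}\|F(\theta,w)\|\le C_F(1+\|w\|)$ for all $\theta,\theta'\in\Theta$, $w\in\mathcal W$. - Interior target: there is $\theta^\star\in\operatorname{int}(\Theta)$ with $\bar F(\theta^\star)=0$. - Quasi-strong monotonicity: there is $\zeta>0$ with $\langle\theta-\theta^\star,\bar F(\theta)\rangle\le-\zeta\|\theta-\theta^\star\|^2$ for all $\theta\in\Theta$. *)

theory Defs
  imports "HOL-Probability.Probability"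
begin

section \<open>Markov kernels on a general state space\<close>

text \<open>
  Only the carrier and the measurable sets of \<open>borel_on S\<close> matter; it serves as the Borel
  sigma-algebra of the subspace \<open>S\<close>.
\<close>

abbreviation borel_on :: "'a::topological_space set \<Rightarrow> 'a measure"
  where "borel_on S \<equiv> restrict_space borel S"

primrec kernel_pow :: "'b measure \<Rightarrow> ('b \<Rightarrow> 'b measure) \<Rightarrow> nat \<Rightarrow> 'b \<Rightarrow> 'b measure" where
  "kernel_pow S Q 0 w = return S w"
| "kernel_pow S Q (Suc n) w = Q w \<bind> kernel_pow S Q n"

text \<open>
  Irreducibility and (a)periodicity follow Meyn and Tweedie, \<^emph>\<open>Markov Chains and Stochastic
  Stability\<close>, Chapters 4 and 5: irreducibility means that some nonzero sigma-finite measure is an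
  irreducibility measure, and a chain is aperiodic if the largest length of a cycle covering the
  state space up to a null set of the maximal irreducibility measure is 1.
\<close>

definition irreducibility_measure ::
    "'b measure \<Rightarrow> ('b \<Rightarrow> 'b measure) \<Rightarrow> 'b measure \<Rightarrow> bool" where
  "irreducibility_measure S Q \<phi> \<longleftrightarrow>
     sigma_finite_measure \<phi> \<and> sets \<phi> = sets S \<and> emeasure \<phi> (space S) \<noteq> 0 \<and>
     (\<forall>w\<in>space S. \<forall>E\<in>sets S. emeasure \<phi> E > 0 \<longrightarrow>
        (\<exists>n\<ge>1. emeasure (kernel_pow S Q n w) E > 0))"

definition irreducible_kernel :: "'b measure \<Rightarrow> ('b \<Rightarrow> 'b measure) \<Rightarrow> bool" where
  "irreducible_kernel S Q \<longleftrightarrow> (\<exists>\<phi>. irreducibility_measure S Q \<phi>)"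

definition maximal_irreducibility_measure ::
    "'b measure \<Rightarrow> ('b \<Rightarrow> 'b measure) \<Rightarrow> 'b measure \<Rightarrow> bool" where
  "maximal_irreducibility_measure S Q \<psi> \<longleftrightarrow>
     irreducibility_measure S Q \<psi> \<and>
     (\<forall>\<phi>. irreducibility_measure S Q \<phi> \<longrightarrow> absolutely_continuous \<psi> \<phi>)"

definition kernel_cycle ::
    "'b measure \<Rightarrow> ('b \<Rightarrow> 'b measure) \<Rightarrow> nat \<Rightarrow> (nat \<Rightarrow> 'b set) \<Rightarrow> bool" where
  "kernel_cycle S Q d D \<longleftrightarrow>
     (\<forall>i<d. D i \<in> sets S) \<and> disjoint_family_on D {..<d} \<and>
     (\<forall>i<d. \<forall>w\<in>D i. measure (Q w) (D (Suc i mod d)) = 1) \<and>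
     (\<exists>\<psi>. maximal_irreducibility_measure S Q \<psi> \<and> space S - (\<Union>i<d. D i) \<in> null_sets \<psi>)"

definition aperiodic_kernel :: "'b measure \<Rightarrow> ('b \<Rightarrow> 'b measure) \<Rightarrow> bool" where
  "aperiodic_kernel S Q \<longleftrightarrow> \<not> (\<exists>d\<ge>2. \<exists>D. kernel_cycle S Q d D)"

definition stationary_distribution ::
    "'b measure \<Rightarrow> ('b \<Rightarrow> 'b measure) \<Rightarrow> 'b measure \<Rightarrow> bool" where
  "stationary_distribution S Q \<nu> \<longleftrightarrow> \<nu> \<in> space (prob_algebra S) \<and> \<nu> \<bind> Q = \<nu>"

text \<open>Meaningful when the stationary distribution exists and is unique.\<close>

definition the_stationary_distribution ::
    "'b measure \<Rightarrow> ('b \<Rightarrow> 'b measure) \<Rightarrow> 'b measure" where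
  "the_stationary_distribution S Q = (THE \<nu>. stationary_distribution S Q \<nu>)"


section \<open>Conditional probability given the history of the process\<close>

definition history ::
    "'c measure \<Rightarrow> (nat \<Rightarrow> 'c \<Rightarrow> 'a::topological_space) \<Rightarrow>
     (nat \<Rightarrow> 'c \<Rightarrow> 'b::topological_space) \<Rightarrow> nat \<Rightarrow> 'c measure" where
  "history M \<theta> W k =
     sigma (space M) (\<Union>i\<le>k. {(\<lambda>\<omega>. (\<theta> i \<omega>, W i \<omega>)) -` B \<inter> space M | B. B \<in> sets borel})"

definition cond_prob_given :: "'c measure \<Rightarrow> 'c measure \<Rightarrow> 'c set \<Rightarrow> 'c \<Rightarrow> real" where
  "cond_prob_given M G A = real_cond_exp M G (indicator A)"


section \<open>Projected stochastic approximation driven by an adaptive Markov chain\<close>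

definition U :: "nat \<Rightarrow> 'b::real_normed_vector \<Rightarrow> real" where
  "U p w = 1 + norm w ^ p"

definition step_size :: "real \<Rightarrow> real \<Rightarrow> nat \<Rightarrow> real" where
  "step_size \<alpha>\<^sub>0 \<delta> k = (if k = 0 then \<alpha>\<^sub>0 else \<alpha>\<^sub>0 * real k powr (- \<delta>))"

definition mean_field ::
    "'b::euclidean_space set \<Rightarrow> ('a \<Rightarrow> 'b \<Rightarrow> 'b measure) \<Rightarrow> ('a \<Rightarrow> 'b \<Rightarrow> 'a) \<Rightarrow>
     'a::euclidean_space \<Rightarrow> 'a" where
  "mean_field \<W> P F \<theta> =
     (\<integral>w. F \<theta> w \<partial>the_stationary_distribution (borel_on \<W>) (P \<theta>))"

text \<open>
  A jointly measurable update map together with a jointly measurable family of Markov kernels.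
\<close>

definition sa_model ::
    "'a::euclidean_space set \<Rightarrow> 'b::euclidean_space set \<Rightarrow> ('a \<Rightarrow> 'b \<Rightarrow> 'a) \<Rightarrow>
     ('a \<Rightarrow> 'b \<Rightarrow> 'b measure) \<Rightarrow> bool" where
  "sa_model \<Theta> \<W> F P \<longleftrightarrow>
     \<W> \<in> sets borel \<and>
     (\<lambda>(\<theta>, w). F \<theta> w) \<in> borel_measurable (borel_on \<Theta> \<Otimes>\<^sub>M borel_on \<W>) \<and>
     (\<lambda>(\<theta>, w). P \<theta> w) \<in> borel_on \<Theta> \<Otimes>\<^sub>M borel_on \<W> \<rightarrow>\<^sub>M prob_algebra (borel_on \<W>)"

definition sa_process ::
    "'c measure \<Rightarrow> 'a::euclidean_space set \<Rightarrow> 'b::euclidean_space set \<Rightarrow> ('a \<Rightarrow> 'b \<Rightarrow> 'a) \<Rightarrow>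
     ('a \<Rightarrow> 'b \<Rightarrow> 'b measure) \<Rightarrow> (nat \<Rightarrow> real) \<Rightarrow> (nat \<Rightarrow> 'c \<Rightarrow> 'a) \<Rightarrow> (nat \<Rightarrow> 'c \<Rightarrow> 'b) \<Rightarrow> bool"
  where
  "sa_process M \<Theta> \<W> F P \<alpha> \<theta> W \<longleftrightarrow>
     prob_space M \<and>
     (\<forall>k. \<theta> k \<in> M \<rightarrow>\<^sub>M borel_on \<Theta>) \<and>
     (\<forall>k. W k \<in> M \<rightarrow>\<^sub>M borel_on \<W>) \<and>
     (\<forall>k. AE \<omega> in M.
        \<theta> (Suc k) \<omega> = closest_point \<Theta> (\<theta> k \<omega> + \<alpha> k *\<^sub>R F (\<theta> k \<omega>) (W k \<omega>))) \<and>
     (\<forall>k. \<forall>E\<in>sets (borel_on \<W>). AE \<omega> in M.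
        cond_prob_given M (history M \<theta> W k) (W (Suc k) -` E \<inter> space M) \<omega> =
        measure (P (\<theta> k \<omega>) (W k \<omega>)) E)"

text \<open>
  The drift inequality is stated with the nonnegative integral because the Bochner integral of a
  non-integrable function is 0.
\<close>

definition ergodic_kernels ::
    "'a::euclidean_space set \<Rightarrow> 'b::euclidean_space set \<Rightarrow> ('a \<Rightarrow> 'b \<Rightarrow> 'b measure) \<Rightarrow> bool" where
  "ergodic_kernels \<Theta> \<W> P \<longleftrightarrow>
     (\<forall>\<theta>\<in>\<Theta>. irreducible_kernel (borel_on \<W>) (P \<theta>) \<and> aperiodic_kernel (borel_on \<W>) (P \<theta>)) \<and>
     (\<exists>N \<W>\<^sub>0 \<epsilon>\<^sub>0 \<phi> \<rho> b.
        N \<ge> 1 \<and> \<W>\<^sub>0 \<in> sets (borel_on \<W>) \<and> \<W>\<^sub>0 \<noteq> {} \<and> \<epsilon>\<^sub>0 > 0 \<and>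
        \<phi> \<in> space (prob_algebra (borel_on \<W>)) \<and> 0 \<le> \<rho> \<and> \<rho> < 1 \<and> 0 \<le> b \<and>
        (\<forall>\<theta>\<in>\<Theta>. \<forall>w\<in>\<W>\<^sub>0. \<forall>E\<in>sets (borel_on \<W>).
           measure (kernel_pow (borel_on \<W>) (P \<theta>) N w) E \<ge> \<epsilon>\<^sub>0 * measure \<phi> E) \<and>
        (\<forall>\<theta>\<in>\<Theta>. \<forall>w\<in>\<W>.
           (\<integral>\<^sup>+y. ennreal (U 2 y) \<partial>P \<theta> w) \<le> ennreal (\<rho> * U 2 w + b * indicator \<W>\<^sub>0 w)))"

definition kernel_continuity ::
    "'a::euclidean_space set \<Rightarrow> 'b::euclidean_space set \<Rightarrow> ('a \<Rightarrow> 'b \<Rightarrow> 'b measure) \<Rightarrow> bool" where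
  "kernel_continuity \<Theta> \<W> P \<longleftrightarrow>
     (\<exists>L>0. \<forall>\<theta>\<in>\<Theta>. \<forall>\<theta>'\<in>\<Theta>. \<forall>w\<in>\<W>. \<forall>f\<in>borel_measurable (borel_on \<W>).
        (\<forall>y\<in>\<W>. \<bar>f y\<bar> \<le> U 1 y) \<longrightarrow>
        \<bar>(\<integral>y. f y \<partial>P \<theta> w) - (\<integral>y. f y \<partial>P \<theta>' w)\<bar> \<le> L * U 1 w * norm (\<theta> - \<theta>'))"

definition growth_condition ::
    "'a::euclidean_space set \<Rightarrow> 'b::euclidean_space set \<Rightarrow> ('a \<Rightarrow> 'b \<Rightarrow> 'a) \<Rightarrow> bool" where
  "growth_condition \<Theta> \<W> F \<longleftrightarrow>
     (\<exists>L>0. \<exists>C>0.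
        (\<forall>\<theta>\<in>\<Theta>. \<forall>\<theta>'\<in>\<Theta>. \<forall>w\<in>\<W>.
           norm (F \<theta> w - F \<theta>' w) \<le> L * (1 + norm w) * norm (\<theta> - \<theta>')) \<and>
        (\<forall>w\<in>\<W>. \<forall>\<theta>\<in>\<Theta>. norm (F \<theta> w) \<le> C * (1 + norm w)))"

definition quasi_strongly_monotone ::
    "'a::euclidean_space set \<Rightarrow> ('a \<Rightarrow> 'a) \<Rightarrow> 'a \<Rightarrow> real \<Rightarrow> bool" where
  "quasi_strongly_monotone \<Theta> G \<theta>\<^sub>s \<zeta> \<longleftrightarrow>
     \<zeta> > 0 \<and> (\<forall>\<theta>\<in>\<Theta>. (\<theta> - \<theta>\<^sub>s) \<bullet> G \<theta> \<le> - \<zeta> * (norm (\<theta> - \<theta>\<^sub>s))\<^sup>2)"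

end

theory Submission
  imports Defs
begin

text \<open>
  Write \<open>x\<^sub>k\<close> for the squared distance of \<open>\<theta>\<^sub>k\<close> to the target.  One step of the recursion gives
  \<open>x\<^bsub>k+1\<^esub> \<le> (1 - 2 \<zeta> \<alpha>\<^sub>k) x\<^sub>k + 2 \<alpha>\<^sub>k \<xi>\<^sub>k + O(\<alpha>\<^sub>k\<^sup>2 U\<^sub>2(W\<^sub>k))\<close>, where \<open>\<xi>\<^sub>k\<close> is the inner product of
  \<open>\<theta>\<^sub>k - \<theta>\<^sub>s\<close> with \<open>F(\<theta>\<^sub>k, W\<^sub>k)\<close> minus the mean field.  The noise \<open>\<xi>\<^sub>k\<close> is not a martingale difference:
  \<open>W\<close> is a Markov chain whose kernel moves with \<open>\<theta>\<close>.  The Poisson equation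
  \<open>u\<^sub>\<theta> - P\<^sub>\<theta> u\<^sub>\<theta> = f\<^sub>\<theta> - \<nu>\<^sub>\<theta>(f\<^sub>\<theta>)\<close> for \<open>f\<^sub>\<theta>(w) = \<langle>\<theta> - \<theta>\<^sub>s, F(\<theta>, w)\<rangle>\<close> turns it into
  \<open>\<xi>\<^sub>k = u(\<theta>\<^sub>k, W\<^sub>k) - (P u)(\<theta>\<^sub>k, W\<^sub>k)\<close>.  Its solution is Lipschitz in \<open>\<theta>\<close> and bounded by a
  multiple of \<open>\<parallel>\<theta> - \<theta>\<^sub>s\<parallel> V\<close> with \<open>V = U\<^sub>2\<^bsup>1/2\<^esup>\<close> (theorem \<open>poisson_solution\<close>).  Hence, for an exponent
  \<open>0 \<le> \<kappa> \<le> 2 \<delta> - 1\<close> and a large constant \<open>C\<close>, the process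
  \<open>Z\<^sub>k = k\<^sup>\<kappa> x\<^sub>k + 2 \<alpha>\<^sub>k k\<^sup>\<kappa> u(\<theta>\<^sub>k, W\<^sub>k) + C \<alpha>\<^sub>k\<^sup>2 k\<^sup>\<kappa> V(W\<^sub>k)\<^sup>2\<close>
  is nonnegative, comparable to \<open>k\<^sup>\<kappa> x\<^sub>k\<close> up to \<open>O(\<alpha>\<^sub>k\<^sup>2 k\<^sup>\<kappa> V\<^sup>2)\<close>, and its conditional mean grows in one
  step by at most a multiple of \<open>\<alpha>\<^sub>k\<^sup>2 k\<^sup>\<kappa>\<close> (lemma \<open>step_bound\<close>): the middle term cancels the noise, and
  the drift of \<open>V\<^sup>2\<close> along the chain absorbs all errors of second order.

  Two exponents finish the proof.  With \<open>\<kappa> = 2 \<delta> - 1\<close> the increments are of order \<open>1/k\<close>, so summation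
  gives \<open>E[x\<^sub>k | F\<^sub>0] = O(k\<^bsup>-(2\<delta>-1)\<^esup> (1 + log k)) U\<^sub>2(W\<^sub>0)\<close>; at \<open>\<delta> = 1\<close> this is where
  \<open>2 \<zeta> \<alpha>\<^sub>0 > 1\<close> makes the contraction beat the growth of \<open>k\<^sup>\<kappa>\<close>.  With
  \<open>\<kappa> = 2 \<beta>\<close> the increments from time \<open>k\<^sub>0\<close> on sum to \<open>O(k\<^sub>0\<^bsup>-(2(\<delta>-\<beta>)-1)\<^esup>)\<close>, and the
  maximal inequality for nonnegative supermartingales bounds the probability that \<open>k\<^bsup>2\<beta>\<^esup> x\<^sub>k\<close> ever exceeds \<open>c\<^sup>2\<close> after \<open>k\<^sub>0\<close> by a multiple of \<open>E[Z\<^bsub>k0\<^esub> | F\<^sub>0]\<close> plus this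
  sum; the first estimate controls \<open>E[Z\<^bsub>k0\<^esub> | F\<^sub>0]\<close> with the same power of \<open>k\<^sub>0\<close>
  and a factor \<open>1 + log k\<^sub>0\<close>.  Conditioning on
  \<open>F\<^sub>0\<close> is expressed throughout by integrating over an arbitrary event of \<open>F\<^sub>0\<close>.

  The Poisson equation is solved with constants that are uniform in \<open>\<theta>\<close>.  Mixing \<open>P\<close> with a small multiple of
  \<open>P\<^sup>N\<close> gives a kernel \<open>K\<close> that is minorised in one step on the small set and keeps the drift towards
  it.  Removing the minorising component leaves a positive operator \<open>R\<close> that contracts the weight
  \<open>V + B\<close>, so its potential \<open>G = \<Sum> R\<^sup>n\<close> converges geometrically.  The stationary distribution is
  \<open>\<phi>G\<close> normalised, \<open>G(f - \<nu>(f))\<close> solves the equation of \<open>K\<close>, and since \<open>I - K\<close> factors through \<open>I - P\<close>,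
  a solution for \<open>P\<close> follows.  Perturbing \<open>R\<close> gives the Lipschitz bounds.
\<close>

section \<open>Weighted function spaces and the transition operator\<close>

text \<open>
  The minorisation condition compares two measures on sets; it is used on functions.
\<close>

lemma measure_le_imp_nn_integral_le:
  assumes sets: "sets \<mu> = sets \<nu>" and fin: "finite_measure \<mu>" "finite_measure \<nu>" and "0 \<le> e"
    and le: "\<And>E. E \<in> sets \<mu> \<Longrightarrow> e * measure \<mu> E \<le> measure \<nu> E"
    and f: "f \<in> borel_measurable \<mu>"
  shows "ennreal e * (\<integral>\<^sup>+x. f x \<partial>\<mu>) \<le> (\<integral>\<^sup>+x. f x \<partial>\<nu>)"
proof -
  have "emeasure (scale_measure (ennreal e) \<mu>) E \<le> emeasure \<nu> E" for E
  proof (cases "E \<in> sets \<mu>")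
    case True
    then show ?thesis
      using le[OF True] \<open>0 \<le> e\<close> fin
      by (simp add: finite_measure.emeasure_eq_measure flip: ennreal_mult)
  next
    case False
    then show ?thesis by (simp add: sets emeasure_notin_sets)
  qed
  moreover have "space \<mu> = space \<nu>" using sets by (rule sets_eq_imp_space_eq)
  ultimately have "(\<integral>\<^sup>+x. f x \<partial>scale_measure (ennreal e) \<mu>) \<le> (\<integral>\<^sup>+x. f x \<partial>\<nu>)"
    using sets by (intro nn_integral_mono_measure) (auto simp: le_measure_iff le_fun_def space_scale_measure)
  then show ?thesis using f by (simp add: nn_integral_scale_measure)
qed

lemma kernel_pow_prob_algebra:
  assumes Q: "Q \<in> S \<rightarrow>\<^sub>M prob_algebra S"
  shows "kernel_pow S Q n \<in> S \<rightarrow>\<^sub>M prob_algebra S"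
proof (induction n)
  case 0
  then show ?case by (simp add: measurable_return_prob_space cong: measurable_cong)
next
  case (Suc n)
  show ?case
    using measurable_bind_prob_space[OF Q Suc] by (simp cong: measurable_cong)
qed

text \<open>
  The data shared by a family of kernels: a weight \<open>V\<close>, a small set \<open>W0\<close>, a minorising probability
  measure \<open>\<phi>\<close> and the constants of the drift condition \<open>P V \<le> \<gamma> V + b 1\<^bsub>W0\<^esub>\<close>.  The kernel itself is
  kept out, so every constant defined here is the same for the whole family.
\<close>

locale drift_setup =
  fixes S :: "'b measure" and V :: "'b \<Rightarrow> real" and W0 :: "'b set" and \<phi> :: "'b measure"
    and \<epsilon> :: real and \<gamma> b :: real
  assumes V_meas[measurable]: "V \<in> borel_measurable S"
    and V_ge1: "\<And>w. w \<in> space S \<Longrightarrow> 1 \<le> V w"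
    and W0_sets[measurable]: "W0 \<in> sets S" and W0_ne: "W0 \<noteq> {}"
    and phi_prob: "\<phi> \<in> space (prob_algebra S)"
    and eps_pos: "0 < \<epsilon>"
    and lam: "0 \<le> \<gamma>" "\<gamma> < 1" and b_nonneg: "0 \<le> b"
begin

text \<open>
  \<open>M0\<close> bounds \<open>P\<^sup>n V / V\<close> for all \<open>n\<close>.  The weight \<open>\<eta>\<close> of \<open>P\<^sup>N\<close> in the mixed kernel is so small that
  the mixture loses only half of the drift: \<open>\<eta> M0 = (1 - \<gamma>) / 2\<close>.  The shift \<open>B\<close> of the weight
  satisfies \<open>\<eta> \<epsilon> B = b\<close>, so the mass \<open>\<eta> \<epsilon>\<close> that is removed on the small set pays for the \<open>b\<close> in the
  drift; \<open>\<rho>\<close> is the resulting contraction factor.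
\<close>

definition M0 :: real where "M0 = 1 + b / (1 - \<gamma>)"
definition \<eta> :: real where "\<eta> = (1 - \<gamma>) / (2 * M0)"
definition B :: real where "B = b / (\<eta> * \<epsilon>)"
definition VB :: "'b \<Rightarrow> real" where "VB w = V w + B"
definition \<rho> :: real where "\<rho> = 1 - (1 - \<gamma>) / (2 * (1 + B))"

definition V_bounded :: "real \<Rightarrow> ('b \<Rightarrow> real) \<Rightarrow> bool" where
  "V_bounded c f \<longleftrightarrow> f \<in> borel_measurable S \<and> (\<forall>w\<in>space S. \<bar>f w\<bar> \<le> c * V w)"

definition in_LV :: "('b \<Rightarrow> real) \<Rightarrow> bool" where "in_LV f \<longleftrightarrow> (\<exists>c. V_bounded c f)"

definition phi :: "('b \<Rightarrow> real) \<Rightarrow> real" where "phi f = (\<integral>y. f y \<partial>\<phi>)"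

lemma M0_ge1: "1 \<le> M0" using lam b_nonneg by (simp add: M0_def)
lemma M0_ge: "\<gamma> + b \<le> M0"
proof -
  have "b * (1 - \<gamma>) \<le> b * 1" using lam b_nonneg by (intro mult_left_mono) auto
  then have "b \<le> b / (1 - \<gamma>)" using lam by (simp add: pos_le_divide_eq)
  then show ?thesis using lam by (simp add: M0_def)
qed
lemma eta_pos: "0 < \<eta>" using M0_ge1 lam by (simp add: \<eta>_def)
lemma eta_le: "\<eta> \<le> 1/2"
proof -
  have "(1 - \<gamma>) \<le> 1 * M0" using M0_ge1 lam by linarith
  then show ?thesis using M0_ge1 by (simp add: \<eta>_def field_simps)
qed
lemma eta_M0: "\<eta> * M0 = (1 - \<gamma>) / 2" using M0_ge1 by (simp add: \<eta>_def)
lemma B_nonneg: "0 \<le> B" using b_nonneg eta_pos eps_pos by (simp add: B_def)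
lemma B_eq: "\<eta> * \<epsilon> * B = b" using eta_pos eps_pos by (simp add: B_def)
lemma rho_less1: "\<rho> < 1" using lam B_nonneg by (simp add: \<rho>_def)
lemma rho_pos: "0 < \<rho>"
proof -
  have "(1 - \<gamma>) / (2 * (1 + B)) \<le> 1/2" using lam B_nonneg by (simp add: divide_simps)
  then show ?thesis unfolding \<rho>_def by linarith
qed

lemma VB_meas[measurable]: "VB \<in> borel_measurable S"
  unfolding VB_def by measurable
lemma VB_ge: "V w \<le> VB w" using B_nonneg by (simp add: VB_def)
lemma VB_le: "w \<in> space S \<Longrightarrow> VB w \<le> (1 + B) * V w"
  using B_nonneg V_ge1[of w] mult_left_mono[of 1 "V w" B] by (simp add: VB_def algebra_simps)
lemma V_pos: "w \<in> space S \<Longrightarrow> 0 < V w" using V_ge1[of w] by simp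
lemma VB_pos: "w \<in> space S \<Longrightarrow> 0 < VB w" using VB_ge[of w] V_pos[of w] by simp

lemma W0_sub: "W0 \<subseteq> space S" using W0_sets by (rule sets.sets_into_space)
lemma S_ne: "space S \<noteq> {}" using W0_ne W0_sub by auto

lemma V_bounded_measurable: "V_bounded c f \<Longrightarrow> f \<in> borel_measurable S"
  by (simp add: V_bounded_def)
lemma V_boundedD: "V_bounded c f \<Longrightarrow> w \<in> space S \<Longrightarrow> \<bar>f w\<bar> \<le> c * V w"
  by (simp add: V_bounded_def)
lemma V_bounded_nonneg: assumes "V_bounded c f" shows "0 \<le> c"
proof -
  obtain w where w: "w \<in> space S" using S_ne by auto
  show ?thesis using V_boundedD[OF assms w] V_pos[OF w]
    by (metis abs_ge_zero order_trans zero_le_mult_iff not_less)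
qed
lemma V_bounded_mono: "V_bounded c f \<Longrightarrow> c \<le> d \<Longrightarrow> V_bounded d f"
  unfolding V_bounded_def using V_pos by (meson less_imp_le mult_right_mono order_trans)
lemma V_bounded_V: "V_bounded 1 V" using V_pos by (force simp: V_bounded_def)
lemma V_bounded_VB: "V_bounded (1 + B) VB" using VB_pos VB_le by (force simp: V_bounded_def)
lemma V_bounded_add: "V_bounded c f \<Longrightarrow> V_bounded d g \<Longrightarrow> V_bounded (c + d) (\<lambda>w. f w + g w)"
  unfolding V_bounded_def by (auto simp: distrib_right intro: order_trans[OF abs_triangle_ineq] add_mono)
lemma V_bounded_scale: assumes "V_bounded c f" shows "V_bounded (\<bar>r\<bar> * c) (\<lambda>w. r * f w)"
  unfolding V_bounded_def
proof (intro conjI ballI)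
  show "(\<lambda>w. r * f w) \<in> borel_measurable S" using V_bounded_measurable[OF assms] by measurable
  fix w assume "w \<in> space S"
  then have "\<bar>r\<bar> * \<bar>f w\<bar> \<le> \<bar>r\<bar> * (c * V w)"
    using V_boundedD[OF assms] by (intro mult_left_mono) auto
  then show "\<bar>r * f w\<bar> \<le> \<bar>r\<bar> * c * V w" by (simp add: abs_mult mult.assoc)
qed
lemma V_bounded_diff: "V_bounded c f \<Longrightarrow> V_bounded d g \<Longrightarrow> V_bounded (c + d) (\<lambda>w. f w - g w)"
  using V_bounded_add[of c f "\<bar>-1\<bar> * d" "\<lambda>w. (-1) * g w"] V_bounded_scale[of d g "-1"]
  by simp
lemma V_bounded_const: "V_bounded \<bar>r\<bar> (\<lambda>_. r)"
  unfolding V_bounded_def using V_ge1 by (auto intro: order_trans[OF _ mult_left_mono[of 1]])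
lemma V_bounded_cong: "(\<And>w. w \<in> space S \<Longrightarrow> f w = g w) \<Longrightarrow> V_bounded c f \<longleftrightarrow> V_bounded c g"
  unfolding V_bounded_def by (simp cong: measurable_cong)
lemma V_bounded_sum: "(\<And>i. i < n \<Longrightarrow> V_bounded (c i) (f i)) \<Longrightarrow> V_bounded (\<Sum>i<n. c i) (\<lambda>w. \<Sum>i<(n::nat). f i w)"
proof (induction n)
  case 0 then show ?case using V_bounded_const[of 0] by simp
next
  case (Suc n) then show ?case by (auto intro!: V_bounded_add)
qed

lemma in_LVI: "V_bounded c f \<Longrightarrow> in_LV f" by (auto simp: in_LV_def)
lemma in_LV_meas: "in_LV f \<Longrightarrow> f \<in> borel_measurable S"
  by (auto simp: in_LV_def V_bounded_def)
lemma in_LV_add: "in_LV f \<Longrightarrow> in_LV g \<Longrightarrow> in_LV (\<lambda>w. f w + g w)"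
  by (auto simp: in_LV_def intro: V_bounded_add)
lemma in_LV_diff: "in_LV f \<Longrightarrow> in_LV g \<Longrightarrow> in_LV (\<lambda>w. f w - g w)"
  by (auto simp: in_LV_def intro: V_bounded_diff)
lemma in_LV_scale: "in_LV f \<Longrightarrow> in_LV (\<lambda>w. r * f w)"
  by (auto simp: in_LV_def intro: V_bounded_scale)
lemma in_LV_const: "in_LV (\<lambda>_. r)" by (auto simp: in_LV_def intro: V_bounded_const)
lemma in_LV_V: "in_LV V" by (auto simp: in_LV_def intro: V_bounded_V)
lemma in_LV_VB: "in_LV VB" by (auto simp: in_LV_def intro: V_bounded_VB)

end

lemma (in drift_setup) integrable_of_in_LV:
  assumes sets: "sets \<mu> = sets S" and V: "(\<integral>\<^sup>+y. ennreal (V y) \<partial>\<mu>) < \<infinity>" and f: "in_LV f"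
  shows "integrable \<mu> f"
proof -
  have sp: "space \<mu> = space S" using sets by (rule sets_eq_imp_space_eq)
  have m: "g \<in> borel_measurable \<mu> \<longleftrightarrow> g \<in> borel_measurable S" for g :: "'b \<Rightarrow> real"
    using sets by (simp cong: measurable_cong_sets)
  have VI: "integrable \<mu> V"
    using V V_pos by (intro integrableI_nonneg) (auto simp: m sp less_imp_le)
  obtain c where c: "V_bounded c f" using f by (auto simp: in_LV_def)
  show ?thesis
  proof (rule Bochner_Integration.integrable_bound)
    show "integrable \<mu> (\<lambda>w. c * V w)" using VI by simp
    show "f \<in> borel_measurable \<mu>" using V_bounded_measurable[OF c] by (simp add: m)
    show "AE x in \<mu>. norm (f x) \<le> norm (c * V x)"
      using V_boundedD[OF c] by (intro AE_I2) (auto simp: sp intro: order_trans[OF _ abs_ge_self])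
  qed
qed

text \<open>
  One kernel of the family.  The drift is stated with the nonnegative integral, because it is what
  makes \<open>V\<close> integrable.
\<close>

locale drift_kernel = drift_setup S V W0 \<phi> \<epsilon> \<gamma> b
  for S :: "'b measure" and V :: "'b \<Rightarrow> real" and W0 :: "'b set" and \<phi> :: "'b measure"
    and \<epsilon> \<gamma> b :: real +
  fixes N :: nat and Q :: "'b \<Rightarrow> 'b measure"
  assumes N_pos: "1 \<le> N"
    and Q_meas[measurable]: "Q \<in> S \<rightarrow>\<^sub>M prob_algebra S"
    and drift: "\<And>w. w \<in> space S \<Longrightarrow>
        (\<integral>\<^sup>+y. ennreal (V y) \<partial>Q w) \<le> ennreal (\<gamma> * V w + b * indicator W0 w)"
    and minor: "\<And>w E. w \<in> W0 \<Longrightarrow> E \<in> sets S \<Longrightarrow>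
        \<epsilon> * measure \<phi> E \<le> measure (kernel_pow S Q N w) E"
begin

definition A :: "('b \<Rightarrow> real) \<Rightarrow> 'b \<Rightarrow> real" where
  "A f w = (\<integral>y. f y \<partial>Q w)"

lemma Q_sets: "w \<in> space S \<Longrightarrow> sets (Q w) = sets S"
  using measurable_space[OF Q_meas] by (auto simp: space_prob_algebra)
lemma Q_space: "w \<in> space S \<Longrightarrow> space (Q w) = space S"
  using Q_sets by (rule sets_eq_imp_space_eq)
lemma Q_prob: "w \<in> space S \<Longrightarrow> prob_space (Q w)"
  using measurable_space[OF Q_meas] by (auto simp: space_prob_algebra)
lemma Q_int: "w \<in> space S \<Longrightarrow> in_LV f \<Longrightarrow> integrable (Q w) f"
  by (intro integrable_of_in_LV Q_sets) (auto intro: le_less_trans[OF drift])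

lemma A_meas: "f \<in> borel_measurable S \<Longrightarrow> A f \<in> borel_measurable S"
  unfolding A_def[abs_def]
  by (rule measurable_compose[OF measurable_prob_algebraD[OF Q_meas] integral_measurable_subprob_algebra])
lemma A_cong: "w \<in> space S \<Longrightarrow> (\<And>y. y \<in> space S \<Longrightarrow> f y = g y) \<Longrightarrow> A f w = A g w"
  unfolding A_def by (intro Bochner_Integration.integral_cong) (auto simp: Q_space)
lemma A_add: "w \<in> space S \<Longrightarrow> in_LV f \<Longrightarrow> in_LV g \<Longrightarrow> A (\<lambda>y. f y + g y) w = A f w + A g w"
  unfolding A_def by (intro Bochner_Integration.integral_add Q_int)
lemma A_diff: "w \<in> space S \<Longrightarrow> in_LV f \<Longrightarrow> in_LV g \<Longrightarrow> A (\<lambda>y. f y - g y) w = A f w - A g w"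
  unfolding A_def by (intro Bochner_Integration.integral_diff Q_int)
lemma A_scale: "A (\<lambda>y. r * f y) w = r * A f w" unfolding A_def by simp
lemma A_const: "w \<in> space S \<Longrightarrow> A (\<lambda>_. r) w = r"
  unfolding A_def using prob_space.prob_space[OF Q_prob, of w] by simp
lemma A_mono: "w \<in> space S \<Longrightarrow> in_LV f \<Longrightarrow> in_LV g \<Longrightarrow> (\<And>y. y \<in> space S \<Longrightarrow> f y \<le> g y) \<Longrightarrow> A f w \<le> A g w"
  unfolding A_def by (intro integral_mono Q_int) (auto simp: Q_space)
lemma A_V: assumes "w \<in> space S" shows "A V w \<le> \<gamma> * V w + b * indicator W0 w"
proof -
  have "ennreal (A V w) = (\<integral>\<^sup>+y. ennreal (V y) \<partial>Q w)"
    unfolding A_def using assms V_pos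
    by (intro nn_integral_eq_integral[symmetric] Q_int in_LV_V AE_I2) (auto simp: Q_space less_imp_le)
  moreover have "0 \<le> \<gamma> * V w + b * indicator W0 w"
    using lam V_pos[OF assms] b_nonneg by (intro add_nonneg_nonneg mult_nonneg_nonneg) auto
  ultimately show ?thesis using drift[OF assms] by (metis ennreal_le_iff)
qed
lemma A_V_le: assumes "w \<in> space S" shows "A V w \<le> \<gamma> * V w + b"
proof -
  have "b * indicator W0 w \<le> b" using b_nonneg by (simp add: indicator_def)
  then show ?thesis using A_V[OF assms] by linarith
qed

lemma A_abs: assumes w: "w \<in> space S" and f: "V_bounded c f" shows "\<bar>A f w\<bar> \<le> c * A V w"
proof -
  have "A f w \<le> A (\<lambda>y. c * V y) w"
    using V_boundedD[OF f] by (intro A_mono w in_LVI[OF f] in_LV_scale in_LV_V) (auto intro: abs_le_D1)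
  moreover have "A (\<lambda>y. -1 * f y) w \<le> A (\<lambda>y. c * V y) w"
    using V_boundedD[OF f] by (intro A_mono w in_LV_scale in_LVI[OF f] in_LV_V) (auto intro: abs_le_D2)
  ultimately show ?thesis unfolding A_scale by simp
qed
lemma V_bounded_A: assumes f: "V_bounded c f" shows "V_bounded (c * M0) (A f)"
  unfolding V_bounded_def
proof (intro conjI ballI)
  show "A f \<in> borel_measurable S" using f by (intro A_meas V_bounded_measurable)
  fix w assume w: "w \<in> space S"
  have "b * 1 \<le> b * V w" using b_nonneg V_ge1[OF w] by (intro mult_left_mono)
  then have "A V w \<le> \<gamma> * V w + b * V w" using A_V_le[OF w] by simp
  also have "\<dots> \<le> M0 * V w" using M0_ge V_pos[OF w] by (simp flip: distrib_right)
  finally show "\<bar>A f w\<bar> \<le> c * M0 * V w"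
    using A_abs[OF w f] V_bounded_nonneg[OF f] by (simp add: mult.assoc) (meson mult_left_mono order_trans)
qed
lemma in_LV_A: "in_LV f \<Longrightarrow> in_LV (A f)" by (auto simp: in_LV_def intro: V_bounded_A)

lemma in_LV_An: "in_LV f \<Longrightarrow> in_LV ((A ^^ n) f)" by (induction n) (auto intro: in_LV_A)

lemma An_V_aux:
  assumes "w \<in> space S"
    shows "(A ^^ n) V w \<le> \<gamma> ^ n * V w + b * (1 - \<gamma> ^ n) / (1 - \<gamma>)"
  using assms
proof (induction n arbitrary: w)
  case 0 then show ?case by simp
next
  case (Suc n)
  have "A ((A ^^ n) V) w \<le> A (\<lambda>w. \<gamma> ^ n * V w + b * (1 - \<gamma> ^ n) / (1 - \<gamma>)) w"
    using Suc by (intro A_mono in_LV_An in_LV_V in_LV_add in_LV_scale in_LV_const) auto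
  also have "\<dots> = \<gamma> ^ n * A V w + b * (1 - \<gamma> ^ n) / (1 - \<gamma>)"
    using Suc.prems by (simp add: A_add A_scale A_const in_LV_scale in_LV_V in_LV_const)
  also have "\<dots> \<le> \<gamma> ^ n * (\<gamma> * V w + b) + b * (1 - \<gamma> ^ n) / (1 - \<gamma>)"
    using A_V_le[OF Suc.prems] lam by (intro add_right_mono mult_left_mono) auto
  also have "\<dots> = \<gamma> ^ Suc n * V w + b * (1 - \<gamma> ^ Suc n) / (1 - \<gamma>)"
    using lam by (simp add: field_simps)
  finally show ?case by simp
qed

lemma An_V:
  assumes w: "w \<in> space S" shows "(A ^^ n) V w \<le> \<gamma> ^ n * V w + b / (1 - \<gamma>)"
proof -
  have "b * (1 - \<gamma> ^ n) / (1 - \<gamma>) \<le> b * 1 / (1 - \<gamma>)"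
    using lam b_nonneg by (intro divide_right_mono mult_left_mono) auto
  then show ?thesis using An_V_aux[OF w, of n] by simp
qed

lemma An_V_le: assumes w: "w \<in> space S" shows "(A ^^ n) V w \<le> M0 * V w"
proof -
  have "\<gamma> ^ n * V w \<le> 1 * V w"
    using lam V_pos[OF w] by (intro mult_right_mono power_le_one) auto
  moreover have "b / (1 - \<gamma>) * 1 \<le> b / (1 - \<gamma>) * V w"
    using lam b_nonneg V_ge1[OF w] by (intro mult_left_mono) auto
  ultimately show ?thesis using An_V[OF w, of n] by (simp add: M0_def algebra_simps)
qed

lemma An_cong: "w \<in> space S \<Longrightarrow> (\<And>y. y \<in> space S \<Longrightarrow> f y = g y) \<Longrightarrow> (A ^^ n) f w = (A ^^ n) g w"
  by (induction n arbitrary: w) (auto intro: A_cong)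
lemma An_add: "w \<in> space S \<Longrightarrow> in_LV f \<Longrightarrow> in_LV g \<Longrightarrow>
    (A ^^ n) (\<lambda>y. f y + g y) w = (A ^^ n) f w + (A ^^ n) g w"
proof (induction n arbitrary: w)
  case (Suc n)
  then have "A ((A ^^ n) (\<lambda>y. f y + g y)) w = A (\<lambda>w. (A ^^ n) f w + (A ^^ n) g w) w"
    by (intro A_cong) auto
  then show ?case using Suc.prems by (simp add: A_add in_LV_An)
qed simp
lemma An_scale: "w \<in> space S \<Longrightarrow> (A ^^ n) (\<lambda>y. r * f y) w = r * (A ^^ n) f w"
proof (induction n arbitrary: w)
  case (Suc n)
  then have "A ((A ^^ n) (\<lambda>y. r * f y)) w = A (\<lambda>w. r * (A ^^ n) f w) w"
    by (intro A_cong) auto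
  then show ?case by (simp add: A_scale)
qed simp
lemma An_const: "w \<in> space S \<Longrightarrow> (A ^^ n) (\<lambda>_. r) w = r"
proof (induction n arbitrary: w)
  case (Suc n)
  then have "A ((A ^^ n) (\<lambda>_. r)) w = A (\<lambda>_. r) w" by (intro A_cong) auto
  then show ?case using Suc.prems by (simp add: A_const)
qed simp
lemma An_mono: "w \<in> space S \<Longrightarrow> in_LV f \<Longrightarrow> in_LV g \<Longrightarrow> (\<And>y. y \<in> space S \<Longrightarrow> f y \<le> g y) \<Longrightarrow>
    (A ^^ n) f w \<le> (A ^^ n) g w"
  by (induction n arbitrary: w) (auto intro!: A_mono in_LV_An)

lemma V_bounded_An: assumes f: "V_bounded c f" shows "V_bounded (c * M0) ((A ^^ n) f)"
  unfolding V_bounded_def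
proof (intro conjI ballI)
  show "(A ^^ n) f \<in> borel_measurable S" using f by (intro in_LV_meas in_LV_An in_LVI)
  fix w assume w: "w \<in> space S"
  have "(A ^^ n) f w \<le> (A ^^ n) (\<lambda>y. c * V y) w"
    using V_boundedD[OF f] by (intro An_mono w in_LVI[OF f] in_LV_scale in_LV_V) (auto intro: abs_le_D1)
  moreover have "(A ^^ n) (\<lambda>y. -1 * f y) w \<le> (A ^^ n) (\<lambda>y. c * V y) w"
    using V_boundedD[OF f] by (intro An_mono w in_LV_scale in_LVI[OF f] in_LV_V) (auto intro: abs_le_D2)
  ultimately have "\<bar>(A ^^ n) f w\<bar> \<le> c * (A ^^ n) V w" unfolding An_scale[OF w] by simp
  also have "\<dots> \<le> c * (M0 * V w)"
    using An_V_le[OF w] V_bounded_nonneg[OF f] by (intro mult_left_mono)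
  finally show "\<bar>(A ^^ n) f w\<bar> \<le> c * M0 * V w" by (simp add: mult.assoc)
qed

lemma kp_meas[measurable]: "kernel_pow S Q n \<in> S \<rightarrow>\<^sub>M prob_algebra S"
  by (rule kernel_pow_prob_algebra[OF Q_meas])

lemma nn_integral_kernel_pow:
  assumes f: "in_LV f" and nonneg: "\<And>y. y \<in> space S \<Longrightarrow> 0 \<le> f y" and w: "w \<in> space S"
  shows "(\<integral>\<^sup>+y. ennreal (f y) \<partial>kernel_pow S Q n w) = ennreal ((A ^^ n) f w)"
  using w
proof (induction n arbitrary: w)
  case 0
  have "f \<in> borel_measurable S" using f by (rule in_LV_meas)
  with 0 show ?case by (simp add: nn_integral_return)
next
  case (Suc n)
  have m: "f \<in> borel_measurable S" using f by (rule in_LV_meas)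
  have nn: "0 \<le> (A ^^ n) f v" if "v \<in> space S" for v
    using An_mono[OF that in_LV_const[of 0] f, of n] nonneg An_const[OF that] by simp
  have "(\<integral>\<^sup>+y. ennreal (f y) \<partial>kernel_pow S Q (Suc n) w)
      = (\<integral>\<^sup>+v. \<integral>\<^sup>+y. ennreal (f y) \<partial>kernel_pow S Q n v \<partial>Q w)"
    unfolding kernel_pow.simps
    by (rule nn_integral_bind[where B = S])
       (use m Q_sets[OF Suc.prems] in \<open>auto intro!: measurable_prob_algebraD kp_meas cong: measurable_cong_sets\<close>)
  also have "\<dots> = (\<integral>\<^sup>+v. ennreal ((A ^^ n) f v) \<partial>Q w)"
    using Suc.IH by (intro nn_integral_cong) (simp add: Q_space[OF Suc.prems])
  also have "\<dots> = ennreal (A ((A ^^ n) f) w)"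
    unfolding A_def[of "(A ^^ n) f"] using Suc.prems nn f
    by (intro nn_integral_eq_integral Q_int in_LV_An AE_I2) (auto simp: Q_space)
  finally show ?case by simp
qed

lemma phi_sets: "sets \<phi> = sets S" and phi_space: "space \<phi> = space S" and prob_space_phi: "prob_space \<phi>"
  using phi_prob by (auto simp: space_prob_algebra dest: sets_eq_imp_space_eq)

lemma minor_nn:
  assumes f: "in_LV f" and nonneg: "\<And>y. y \<in> space S \<Longrightarrow> 0 \<le> f y" and w: "w \<in> W0"
  shows "ennreal \<epsilon> * (\<integral>\<^sup>+y. ennreal (f y) \<partial>\<phi>) \<le> ennreal ((A ^^ N) f w)"
proof -
  have ws: "w \<in> space S" using w W0_sub by auto
  have k: "prob_space (kernel_pow S Q N w)" "sets (kernel_pow S Q N w) = sets S"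
    using measurable_space[OF kp_meas ws] by (auto simp: space_prob_algebra)
  have "ennreal \<epsilon> * (\<integral>\<^sup>+y. ennreal (f y) \<partial>\<phi>) \<le> (\<integral>\<^sup>+y. ennreal (f y) \<partial>kernel_pow S Q N w)"
    using prob_space_phi k(1) eps_pos minor[OF w] in_LV_meas[OF f]
    by (intro measure_le_imp_nn_integral_le)
       (auto simp: phi_sets k(2) prob_space_def less_imp_le cong: measurable_cong_sets)
  then show ?thesis by (simp add: nn_integral_kernel_pow[OF f nonneg ws])
qed

text \<open>
  The minorisation at any point of the nonempty small set transfers integrability of \<open>V\<close> from
  \<open>P\<^sup>N(w, \<cdot>)\<close> to \<open>\<phi>\<close>.
\<close>

lemma phi_V_fin: "(\<integral>\<^sup>+y. ennreal (V y) \<partial>\<phi>) < \<infinity>"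
proof -
  obtain w where w: "w \<in> W0" using W0_ne by auto
  have "ennreal \<epsilon> * (\<integral>\<^sup>+y. ennreal (V y) \<partial>\<phi>) < \<infinity>"
    using V_pos by (intro le_less_trans[OF minor_nn[OF in_LV_V _ w]]) (auto simp: less_imp_le)
  then show ?thesis using eps_pos by (auto simp: ennreal_mult_less_top)
qed

lemma phi_int: "in_LV f \<Longrightarrow> integrable \<phi> f"
  using phi_V_fin by (intro integrable_of_in_LV phi_sets)
lemma phi_add: "in_LV f \<Longrightarrow> in_LV g \<Longrightarrow> phi (\<lambda>y. f y + g y) = phi f + phi g"
  unfolding phi_def by (intro Bochner_Integration.integral_add phi_int)
lemma phi_diff: "in_LV f \<Longrightarrow> in_LV g \<Longrightarrow> phi (\<lambda>y. f y - g y) = phi f - phi g"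
  unfolding phi_def by (intro Bochner_Integration.integral_diff phi_int)
lemma phi_scale: "phi (\<lambda>y. r * f y) = r * phi f" unfolding phi_def by simp
lemma phi_const: "phi (\<lambda>_. r) = r"
  unfolding phi_def using prob_space.prob_space[OF prob_space_phi] by simp
lemma phi_mono: "in_LV f \<Longrightarrow> in_LV g \<Longrightarrow> (\<And>y. y \<in> space S \<Longrightarrow> f y \<le> g y) \<Longrightarrow> phi f \<le> phi g"
  unfolding phi_def by (intro integral_mono phi_int) (auto simp: phi_space)
lemma phi_cong: "(\<And>y. y \<in> space S \<Longrightarrow> f y = g y) \<Longrightarrow> phi f = phi g"
  unfolding phi_def by (intro Bochner_Integration.integral_cong) (auto simp: phi_space)
lemma phi_abs: assumes f: "V_bounded c f" shows "\<bar>phi f\<bar> \<le> c * phi V"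
proof -
  have "phi f \<le> phi (\<lambda>y. c * V y)"
    using V_boundedD[OF f] by (intro phi_mono in_LVI[OF f] in_LV_scale in_LV_V) (auto intro: abs_le_D1)
  moreover have "phi (\<lambda>y. -1 * f y) \<le> phi (\<lambda>y. c * V y)"
    using V_boundedD[OF f] by (intro phi_mono in_LV_scale in_LVI[OF f] in_LV_V) (auto intro: abs_le_D2)
  ultimately show ?thesis unfolding phi_scale by simp
qed
lemma phi_V_pos: "1 \<le> phi V"
  using phi_mono[OF in_LV_const[of 1] in_LV_V] V_ge1 by (simp add: phi_const)

lemma minor_fun:
  assumes f: "in_LV f" and nonneg: "\<And>y. y \<in> space S \<Longrightarrow> 0 \<le> f y" and w: "w \<in> W0"
  shows "\<epsilon> * phi f \<le> (A ^^ N) f w"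
proof -
  have ws: "w \<in> space S" using w W0_sub by auto
  have nn: "0 \<le> (A ^^ N) f w"
    using An_mono[OF ws in_LV_const[of 0] f, of N] nonneg An_const[OF ws] by simp
  have ph: "0 \<le> phi f" using phi_mono[OF in_LV_const[of 0] f] nonneg by (simp add: phi_const)
  have "(\<integral>\<^sup>+y. ennreal (f y) \<partial>\<phi>) = ennreal (phi f)"
    unfolding phi_def using nonneg f by (intro nn_integral_eq_integral phi_int AE_I2) (auto simp: phi_space)
  then show ?thesis
    using minor_nn[OF f nonneg w] nn eps_pos ph by (simp flip: ennreal_mult)
qed

end

section \<open>The residual operator and its potential\<close>

context drift_setup
begin

definition VB_bounded :: "real \<Rightarrow> ('b \<Rightarrow> real) \<Rightarrow> bool" where
  "VB_bounded c f \<longleftrightarrow> f \<in> borel_measurable S \<and> (\<forall>w\<in>space S. \<bar>f w\<bar> \<le> c * VB w)"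

lemma VB_boundedD: "VB_bounded c f \<Longrightarrow> w \<in> space S \<Longrightarrow> \<bar>f w\<bar> \<le> c * VB w"
  by (simp add: VB_bounded_def)
lemma VB_bounded_nonneg: assumes "VB_bounded c f" shows "0 \<le> c"
proof -
  obtain w where w: "w \<in> space S" using S_ne by auto
  show ?thesis using VB_boundedD[OF assms w] VB_pos[OF w]
    by (metis abs_ge_zero order_trans zero_le_mult_iff not_less)
qed
lemma VB_bounded_of_V_bounded: assumes "V_bounded c f" shows "VB_bounded c f"
  using assms mult_left_mono[OF VB_ge V_bounded_nonneg[OF assms]]
  by (auto simp: V_bounded_def VB_bounded_def intro: order_trans)
lemma V_bounded_of_VB_bounded: assumes "VB_bounded c f" shows "V_bounded (c * (1 + B)) f"
  using assms mult_left_mono[OF VB_le VB_bounded_nonneg[OF assms]]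
  by (auto simp: V_bounded_def VB_bounded_def mult.assoc intro: order_trans)
lemma in_LV_of_VB_bounded: "VB_bounded c f \<Longrightarrow> in_LV f"
  by (blast intro: in_LVI V_bounded_of_VB_bounded)

definition mean_const :: real where "mean_const = (1 + B) / (1 - \<rho>) * phi V"
definition residual_const :: real where "residual_const = (1 + mean_const) * (1 + B) / (1 - \<rho>)"
definition poisson_const :: "nat \<Rightarrow> real" where "poisson_const N = residual_const * (1 + real N * M0)"

end

context drift_kernel
begin

text \<open>
  \<open>K\<close> mixes the one-step and the \<open>N\<close>-step kernel and thereby turns an \<open>N\<close>-step minorisation into a
  one-step one.  \<open>R\<close> is what remains of \<open>K\<close> after the minorising component is taken off, and \<open>G\<close> is
  the potential of \<open>R\<close>.
\<close>

definition K :: "('b \<Rightarrow> real) \<Rightarrow> 'b \<Rightarrow> real" where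
  "K f w = (1 - \<eta>) * A f w + \<eta> * (A ^^ N) f w"
definition R :: "('b \<Rightarrow> real) \<Rightarrow> 'b \<Rightarrow> real" where
  "R f w = K f w - \<eta> * \<epsilon> * indicator W0 w * phi f"
definition G :: "('b \<Rightarrow> real) \<Rightarrow> 'b \<Rightarrow> real" where
  "G f w = (\<Sum>n. (R ^^ n) f w)"

lemma in_LV_K: "in_LV f \<Longrightarrow> in_LV (K f)"
  unfolding K_def[abs_def] by (intro in_LV_add in_LV_scale in_LV_A in_LV_An)
lemma in_LV_ind: "E \<in> sets S \<Longrightarrow> in_LV (indicator E)"
  unfolding in_LV_def V_bounded_def using V_ge1
  by (intro exI[of _ 1]) (auto simp: indicator_def intro: order_trans[OF zero_le_one])
lemma in_LV_R: "in_LV f \<Longrightarrow> in_LV (R f)"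
  unfolding R_def[abs_def] using in_LV_scale[OF in_LV_ind[OF W0_sets], of "\<eta> * \<epsilon> * phi f"]
  by (intro in_LV_diff in_LV_K) (auto simp: in_LV_def V_bounded_def mult.assoc mult.commute[of "phi f"])
lemma in_LV_Rn: "in_LV f \<Longrightarrow> in_LV ((R ^^ n) f)" by (induction n) (auto intro: in_LV_R)

lemma R_cong: "w \<in> space S \<Longrightarrow> (\<And>y. y \<in> space S \<Longrightarrow> f y = g y) \<Longrightarrow> R f w = R g w"
  unfolding R_def K_def using A_cong[of w f g] An_cong[of w f g N] phi_cong[of f g] by simp
lemma R_add: "w \<in> space S \<Longrightarrow> in_LV f \<Longrightarrow> in_LV g \<Longrightarrow> R (\<lambda>y. f y + g y) w = R f w + R g w"
  unfolding R_def K_def by (simp add: A_add An_add phi_add algebra_simps)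
lemma R_scale: "w \<in> space S \<Longrightarrow> R (\<lambda>y. r * f y) w = r * R f w"
  unfolding R_def K_def by (simp add: A_scale An_scale phi_scale algebra_simps)
lemma R_diff: assumes "w \<in> space S" "in_LV f" "in_LV g"
  shows "R (\<lambda>y. f y - g y) w = R f w - R g w"
  using R_add[OF assms(1,2) in_LV_scale[OF assms(3), of "-1"]] R_scale[OF assms(1), of "-1" g] by simp
lemma R_nonneg: assumes w: "w \<in> space S" and f: "in_LV f" "\<And>y. y \<in> space S \<Longrightarrow> 0 \<le> f y"
  shows "0 \<le> R f w"
proof -
  have 1: "0 \<le> A f w" using A_mono[OF w in_LV_const[of 0] f(1)] f(2) A_const[OF w] by simp
  have 2: "0 \<le> (A ^^ N) f w" using An_mono[OF w in_LV_const[of 0] f(1), of N] f(2) An_const[OF w] by simp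
  have 3: "\<epsilon> * indicator W0 w * phi f \<le> (A ^^ N) f w"
    using minor_fun[OF f] 2 by (auto simp: indicator_def)
  have "\<eta> * (\<epsilon> * indicator W0 w * phi f) \<le> \<eta> * (A ^^ N) f w"
    using 3 eta_pos by (intro mult_left_mono) auto
  moreover have "0 \<le> (1 - \<eta>) * A f w" using 1 eta_le by simp
  ultimately show ?thesis by (simp add: R_def K_def mult.assoc)
qed
lemma R_mono: assumes w: "w \<in> space S" and f: "in_LV f" "in_LV g" "\<And>y. y \<in> space S \<Longrightarrow> f y \<le> g y"
  shows "R f w \<le> R g w"
  using R_nonneg[OF w in_LV_diff[OF f(2,1)]] R_diff[OF w f(2,1)] f(3) by simp

text \<open>
  The central contraction.  Off the small set the drift of \<open>V\<close> suffices; on the small set the excess \<open>b\<close> of the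
  drift is cancelled exactly by \<open>\<eta> \<epsilon> B\<close>, the loss of the constant \<open>B\<close> under the subtraction.
\<close>

lemma R_VB: assumes w: "w \<in> space S" shows "R VB w \<le> \<rho> * VB w"
proof -
  let ?i = "indicator W0 w :: real"
  have phiVB: "phi VB = phi V + B" unfolding VB_def[abs_def]
    by (simp add: phi_add phi_const in_LV_V in_LV_const)
  have A: "A VB w = A V w + B" "(A ^^ N) VB w = (A ^^ N) V w + B"
    unfolding VB_def[abs_def] using w by (simp_all add: A_add An_add A_const An_const in_LV_V in_LV_const)
  have "R VB w = (1 - \<eta>) * A V w + \<eta> * (A ^^ N) V w + B - \<eta> * \<epsilon> * ?i * phi V - \<eta> * \<epsilon> * B * ?i"
    unfolding R_def K_def A phiVB by (simp add: algebra_simps)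
  also have "\<dots> \<le> (1 - \<eta>) * (\<gamma> * V w + b * ?i) + \<eta> * (M0 * V w) + B - 0 - b * ?i"
    using A_V[OF w] An_V_le[OF w, of N] eta_pos eta_le eps_pos phi_V_pos
    unfolding B_eq by (intro diff_mono add_mono mult_left_mono order_refl mult_nonneg_nonneg) auto
  also have "\<dots> \<le> \<gamma> * V w + (\<eta> * M0) * V w + B"
    using eta_pos lam b_nonneg V_pos[OF w] by (simp add: algebra_simps)
  also have "\<dots> = VB w - (1 - \<gamma>) / 2 * V w" unfolding eta_M0 VB_def by (simp add: field_simps)
  also have "\<dots> \<le> VB w - (1 - \<gamma>) / 2 * (VB w / (1 + B))"
    using lam VB_le[OF w] B_nonneg by (intro diff_left_mono mult_left_mono) (auto simp: field_simps)
  also have "\<dots> = \<rho> * VB w" unfolding \<rho>_def by (simp add: field_simps)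
  finally show ?thesis .
qed

lemma VB_bounded_R: assumes f: "VB_bounded c f" shows "VB_bounded (c * \<rho>) (R f)"
  unfolding VB_bounded_def
proof (intro conjI ballI)
  have L: "in_LV f" using f by (rule in_LV_of_VB_bounded)
  show "R f \<in> borel_measurable S" using L by (intro in_LV_meas in_LV_R)
  fix w assume w: "w \<in> space S"
  have "R f w \<le> R (\<lambda>y. c * VB y) w"
    using VB_boundedD[OF f] by (intro R_mono w L in_LV_scale in_LV_VB) (auto intro: abs_le_D1)
  moreover have "R (\<lambda>y. -1 * f y) w \<le> R (\<lambda>y. c * VB y) w"
    using VB_boundedD[OF f] by (intro R_mono w in_LV_scale L in_LV_VB) (auto intro: abs_le_D2)
  ultimately have "\<bar>R f w\<bar> \<le> c * R VB w" unfolding R_scale[OF w] by simp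
  also have "\<dots> \<le> c * (\<rho> * VB w)"
    using R_VB[OF w] VB_bounded_nonneg[OF f] by (intro mult_left_mono)
  finally show "\<bar>R f w\<bar> \<le> c * \<rho> * VB w" by (simp add: mult.assoc)
qed
lemma VB_bounded_Rn: "VB_bounded c f \<Longrightarrow> VB_bounded (c * \<rho> ^ n) ((R ^^ n) f)"
  by (induction n) (auto dest: VB_bounded_R simp: mult_ac)

lemma Rn_abs: assumes f: "VB_bounded c f" and w: "w \<in> space S"
  shows "norm ((R ^^ n) f w) \<le> c * VB w * \<rho> ^ n"
  using VB_boundedD[OF VB_bounded_Rn[OF f] w, of n] by (simp add: mult_ac)
lemma geo_summable: "summable (\<lambda>n. a * \<rho> ^ n)"
  using rho_pos rho_less1 by (intro summable_mult summable_geometric) auto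
lemma geo_suminf: "(\<Sum>n. a * \<rho> ^ n) = a / (1 - \<rho>)"
  using rho_pos rho_less1 by (simp add: suminf_mult suminf_geometric summable_geometric)

lemma Rn_summable_norm: assumes f: "in_LV f" and w: "w \<in> space S"
  shows "summable (\<lambda>n. norm ((R ^^ n) f w))"
proof -
  obtain c where "VB_bounded c f" using f by (auto simp: in_LV_def dest: VB_bounded_of_V_bounded)
  from Rn_abs[OF this w] show ?thesis
    by (intro summable_comparison_test'[OF geo_summable[of "c * VB w"]]) auto
qed
lemma Rn_summable: assumes f: "in_LV f" and w: "w \<in> space S" shows "summable (\<lambda>n. (R ^^ n) f w)"
  using Rn_summable_norm[OF assms] by (rule summable_norm_cancel)

lemma VB_bounded_G: assumes f: "VB_bounded c f" shows "VB_bounded (c / (1 - \<rho>)) (G f)"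
  unfolding VB_bounded_def
proof (intro conjI ballI)
  have L: "in_LV f" using f by (rule in_LV_of_VB_bounded)
  have "(R ^^ n) f \<in> borel_measurable S" for n using L by (intro in_LV_meas in_LV_Rn)
  then show "G f \<in> borel_measurable S" unfolding G_def[abs_def] by (rule borel_measurable_suminf)
  fix w assume w: "w \<in> space S"
  have "\<bar>G f w\<bar> \<le> (\<Sum>n. norm ((R ^^ n) f w))"
    unfolding G_def using summable_norm[OF Rn_summable_norm[OF L w]] by simp
  also have "\<dots> \<le> (\<Sum>n. c * VB w * \<rho> ^ n)"
    using Rn_abs[OF f w] by (intro suminf_le Rn_summable_norm[OF L w] geo_summable) auto
  also have "\<dots> = c / (1 - \<rho>) * VB w" unfolding geo_suminf by simp
  finally show "\<bar>G f w\<bar> \<le> c / (1 - \<rho>) * VB w" .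
qed
lemma in_LV_G: "in_LV f \<Longrightarrow> in_LV (G f)"
  by (metis in_LV_def VB_bounded_of_V_bounded VB_bounded_G V_bounded_of_VB_bounded)

lemma Rn_cong: "w \<in> space S \<Longrightarrow> (\<And>y. y \<in> space S \<Longrightarrow> f y = g y) \<Longrightarrow> (R ^^ n) f w = (R ^^ n) g w"
  by (induction n arbitrary: w) (auto intro: R_cong)
lemma G_cong: "w \<in> space S \<Longrightarrow> (\<And>y. y \<in> space S \<Longrightarrow> f y = g y) \<Longrightarrow> G f w = G g w"
  unfolding G_def by (simp cong: Rn_cong)
lemma Rn_add: "w \<in> space S \<Longrightarrow> in_LV f \<Longrightarrow> in_LV g \<Longrightarrow>
    (R ^^ n) (\<lambda>y. f y + g y) w = (R ^^ n) f w + (R ^^ n) g w"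
proof (induction n arbitrary: w)
  case (Suc n)
  then have "R ((R ^^ n) (\<lambda>y. f y + g y)) w = R (\<lambda>w. (R ^^ n) f w + (R ^^ n) g w) w"
    by (intro R_cong) auto
  then show ?case using Suc.prems by (simp add: R_add in_LV_Rn)
qed simp
lemma Rn_scale: "w \<in> space S \<Longrightarrow> (R ^^ n) (\<lambda>y. r * f y) w = r * (R ^^ n) f w"
proof (induction n arbitrary: w)
  case (Suc n)
  then have "R ((R ^^ n) (\<lambda>y. r * f y)) w = R (\<lambda>w. r * (R ^^ n) f w) w"
    by (intro R_cong) auto
  then show ?case using Suc.prems by (simp add: R_scale)
qed simp
lemma G_add: "w \<in> space S \<Longrightarrow> in_LV f \<Longrightarrow> in_LV g \<Longrightarrow> G (\<lambda>y. f y + g y) w = G f w + G g w"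
  unfolding G_def by (simp add: Rn_add suminf_add[symmetric] Rn_summable)
lemma G_scale: "w \<in> space S \<Longrightarrow> in_LV f \<Longrightarrow> G (\<lambda>y. r * f y) w = r * G f w"
  unfolding G_def by (simp add: Rn_scale suminf_mult Rn_summable)
lemma G_diff: assumes "w \<in> space S" "in_LV f" "in_LV g"
  shows "G (\<lambda>y. f y - g y) w = G f w - G g w"
  using G_add[OF assms(1,2) in_LV_scale[OF assms(3), of "-1"]] G_scale[OF assms(1,3), of "-1"] by simp

text \<open>
  All operators respect dominated pointwise limits.  For \<open>G\<close> this makes the set function
  \<open>E \<mapsto> \<phi>(G 1\<^sub>E)\<close> countably additive, and for \<open>R\<close> it allows summation under the operator.
\<close>

lemma integral_V_bounded_tendsto:
  assumes sets: "sets \<mu> = sets S" and V: "(\<integral>\<^sup>+y. ennreal (V y) \<partial>\<mu>) < \<infinity>"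
    and f: "\<And>i. V_bounded c (f i)" and g: "V_bounded d g" and lim: "\<And>y. y \<in> space S \<Longrightarrow> (\<lambda>i. f i y) \<longlonglongrightarrow> g y"
  shows "(\<lambda>i. \<integral>y. f i y \<partial>\<mu>) \<longlonglongrightarrow> (\<integral>y. g y \<partial>\<mu>)"
proof (rule integral_dominated_convergence[where w = "\<lambda>y. c * V y"])
  have sp: "space \<mu> = space S" using sets by (rule sets_eq_imp_space_eq)
  show "g \<in> borel_measurable \<mu>" "\<And>i. f i \<in> borel_measurable \<mu>"
    using V_bounded_measurable[OF f] V_bounded_measurable[OF g] sets by (auto cong: measurable_cong_sets)
  show "integrable \<mu> (\<lambda>y. c * V y)" using integrable_of_in_LV[OF sets V in_LV_V] by simp
  show "AE y in \<mu>. (\<lambda>i. f i y) \<longlonglongrightarrow> g y" using lim by (auto simp: sp)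
  show "AE y in \<mu>. norm (f i y) \<le> c * V y" for i using V_boundedD[OF f] by (auto simp: sp)
qed

lemma V_bounded_limit:
  assumes f: "\<And>i. V_bounded c (f i)" and lim: "\<And>y. y \<in> space S \<Longrightarrow> (\<lambda>i. f i y) \<longlonglongrightarrow> g y"
  shows "V_bounded c g"
  unfolding V_bounded_def
proof (intro conjI ballI)
  show "g \<in> borel_measurable S"
    using V_bounded_measurable[OF f] lim by (rule borel_measurable_LIMSEQ_real[rotated])
  fix w assume w: "w \<in> space S"
  show "\<bar>g w\<bar> \<le> c * V w"
    using tendsto_rabs[OF lim[OF w]] V_boundedD[OF f w] by (intro LIMSEQ_le_const2) auto
qed

lemma A_tendsto:
  assumes w: "w \<in> space S" and f: "\<And>i. V_bounded c (f i)"
    and lim: "\<And>y. y \<in> space S \<Longrightarrow> (\<lambda>i. f i y) \<longlonglongrightarrow> g y"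
  shows "(\<lambda>i. A (f i) w) \<longlonglongrightarrow> A g w"
  unfolding A_def using drift[OF w] w
  by (intro integral_V_bounded_tendsto[OF _ _ f V_bounded_limit[OF f lim] lim] Q_sets) (auto intro: le_less_trans)

lemma phi_tendsto:
  assumes f: "\<And>i. V_bounded c (f i)" and lim: "\<And>y. y \<in> space S \<Longrightarrow> (\<lambda>i. f i y) \<longlonglongrightarrow> g y"
  shows "(\<lambda>i. phi (f i)) \<longlonglongrightarrow> phi g"
  unfolding phi_def by (intro integral_V_bounded_tendsto[OF phi_sets phi_V_fin f V_bounded_limit[OF f lim] lim])

lemma An_tendsto:
  assumes f: "\<And>i. V_bounded c (f i)" and lim: "\<And>y. y \<in> space S \<Longrightarrow> (\<lambda>i. f i y) \<longlonglongrightarrow> g y"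
    and w: "w \<in> space S"
  shows "(\<lambda>i. (A ^^ n) (f i) w) \<longlonglongrightarrow> (A ^^ n) g w"
  using w
proof (induction n arbitrary: w)
  case (Suc n)
  then show ?case using V_bounded_An[OF f, of n] by (auto intro!: A_tendsto)
qed (simp add: lim)

lemma R_tendsto:
  assumes f: "\<And>i. V_bounded c (f i)" and lim: "\<And>y. y \<in> space S \<Longrightarrow> (\<lambda>i. f i y) \<longlonglongrightarrow> g y"
    and w: "w \<in> space S"
  shows "(\<lambda>i. R (f i) w) \<longlonglongrightarrow> R g w"
  unfolding R_def K_def
    by (intro tendsto_intros A_tendsto[OF w f lim] An_tendsto[OF f lim w] phi_tendsto[OF f lim])

lemma Rn_tendsto:
  assumes f: "\<And>i. V_bounded c (f i)" and lim: "\<And>y. y \<in> space S \<Longrightarrow> (\<lambda>i. f i y) \<longlonglongrightarrow> g y"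
    and w: "w \<in> space S"
  shows "(\<lambda>i. (R ^^ n) (f i) w) \<longlonglongrightarrow> (R ^^ n) g w"
  using w
proof (induction n arbitrary: w)
  case (Suc n)
  have "V_bounded (c * \<rho> ^ n * (1 + B)) ((R ^^ n) (f i))" for i
    by (intro V_bounded_of_VB_bounded VB_bounded_Rn VB_bounded_of_V_bounded f)
  then show ?case using Suc by (auto intro!: R_tendsto)
qed (simp add: lim)

lemma G_tendsto:
  assumes f: "\<And>i. V_bounded c (f i)" and lim: "\<And>y. y \<in> space S \<Longrightarrow> (\<lambda>i. f i y) \<longlonglongrightarrow> g y"
    and w: "w \<in> space S"
  shows "(\<lambda>i. G (f i) w) \<longlonglongrightarrow> G g w"
  unfolding G_def
proof (rule tannerys_theorem[THEN conjunct2, THEN conjunct2])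
  show "\<forall>\<^sub>F (n, i) in at_top \<times>\<^sub>F at_top. norm ((R ^^ n) (f i) w) \<le> c * VB w * \<rho> ^ n"
    using Rn_abs[OF VB_bounded_of_V_bounded[OF f] w] by (intro always_eventually) auto
qed (use Rn_tendsto[OF f lim w] geo_summable in auto)

lemma R_sum: "w \<in> space S \<Longrightarrow> (\<And>i. i < n \<Longrightarrow> in_LV (f i)) \<Longrightarrow> R (\<lambda>y. \<Sum>i<(n::nat). f i y) w = (\<Sum>i<n. R (f i) w)"
proof (induction n)
  case 0 show ?case using R_scale[OF 0(1), of 0 "\<lambda>_. 0"] by simp
next
  case (Suc n)
  have "in_LV (\<lambda>y. \<Sum>i<n. f i y)" using Suc.prems(2)
    by (induction n) (auto intro!: in_LV_add in_LV_const)
  then show ?case using Suc by (simp add: R_add)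
qed

lemma G_fix: assumes f: "in_LV f" and w: "w \<in> space S" shows "G f w = f w + R (G f) w"
proof -
  obtain c where c: "VB_bounded c f" using f by (auto simp: in_LV_def dest: VB_bounded_of_V_bounded)
  (* Partial sums satisfy T (n + 1) = f + R (T n); both sides converge. *)
  define T where "T n y = (\<Sum>i<n. (R ^^ i) f y)" for n :: nat and y
  have Tm: "V_bounded (c / (1 - \<rho>) * (1 + B)) (T n)" for n
  proof (rule V_bounded_of_VB_bounded, unfold VB_bounded_def, intro conjI ballI)
    show "T n \<in> borel_measurable S"
      unfolding T_def[abs_def] using in_LV_meas[OF in_LV_Rn[OF f]] by (intro borel_measurable_sum) auto
    fix y assume y: "y \<in> space S"
    have "\<bar>T n y\<bar> \<le> (\<Sum>i<n. c * VB y * \<rho> ^ i)"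
      unfolding T_def using Rn_abs[OF c y] by (intro order_trans[OF sum_abs] sum_mono) auto
    also have "\<dots> \<le> (\<Sum>i. c * VB y * \<rho> ^ i)"
      using rho_pos VB_pos[OF y] VB_bounded_nonneg[OF c] by (intro sum_le_suminf geo_summable) auto
    finally show "\<bar>T n y\<bar> \<le> c / (1 - \<rho>) * VB y" unfolding geo_suminf by simp
  qed
  have lim: "(\<lambda>n. T n y) \<longlonglongrightarrow> G f y" if "y \<in> space S" for y
    unfolding T_def G_def using Rn_summable[OF f that] by (rule summable_LIMSEQ)
  have "T (Suc n) w = f w + R (T n) w" for n
    unfolding T_def[abs_def] using w f
    by (simp add: R_sum in_LV_Rn sum.lessThan_Suc_shift del: sum.lessThan_Suc)
  then have "(\<lambda>n. T (Suc n) w) \<longlonglongrightarrow> f w + R (G f) w"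
    using R_tendsto[OF Tm lim w] by (auto intro!: tendsto_intros)
  with LIMSEQ_Suc[OF lim[OF w]] show ?thesis by (rule LIMSEQ_unique)
qed

lemma G_inverse: assumes d: "in_LV d" and w: "w \<in> space S" shows "G (\<lambda>y. d y - R d y) w = d w"
proof -
  have *: "(R ^^ n) (\<lambda>y. d y - R d y) w = (R ^^ n) d w - (R ^^ Suc n) d w" for n
    using Rn_add[OF w d in_LV_scale[OF in_LV_R[OF d], of "-1"], of n] Rn_scale[OF w, of n "-1" "R d"]
    by (simp add: funpow_swap1)
  obtain c where c: "VB_bounded c d" using d by (auto simp: in_LV_def dest: VB_bounded_of_V_bounded)
  have "(\<lambda>n. (R ^^ n) d w) \<longlonglongrightarrow> 0"
    using summable_LIMSEQ_zero[OF Rn_summable[OF d w]] .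
  from telescope_sums'[OF this] have "(\<lambda>n. (R ^^ n) d w - (R ^^ Suc n) d w) sums (d w)" by simp
  then show ?thesis unfolding G_def * by (rule sums_unique[symmetric])
qed

text \<open>
  \<open>G\<close> inverts \<open>I - R\<close>, so a small residual \<open>d - R d\<close> forces a small \<open>d\<close>.  This is the a priori
  estimate behind the perturbation bounds.
\<close>

lemma G_stability:
  assumes d: "in_LV d" and le: "\<And>w. w \<in> space S \<Longrightarrow> \<bar>d w - R d w\<bar> \<le> a * VB w" and w: "w \<in> space S"
  shows "\<bar>d w\<bar> \<le> a / (1 - \<rho>) * VB w"
proof -
  have "VB_bounded a (\<lambda>y. d y - R d y)"
    unfolding VB_bounded_def using le in_LV_meas[OF in_LV_diff[OF d in_LV_R[OF d]]] by auto
  from VB_boundedD[OF VB_bounded_G[OF this] w] show ?thesis by (simp add: G_inverse[OF d w])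
qed

end

section \<open>The Poisson equation and the stationary distribution\<close>

context drift_kernel
begin

text \<open>
  A stationary \<open>\<nu>\<close> satisfies \<open>\<nu> (I - R) = \<nu>(s) \<phi>\<close> with \<open>s = \<eta> \<epsilon> 1\<^bsub>W0\<^esub>\<close>, hence \<open>\<nu>\<close> is \<open>\<phi>G\<close> up to
  normalisation.  The centred potential is annihilated by \<open>\<phi>\<close>, so it solves the Poisson equation of
  \<open>K\<close> as well as that of \<open>R\<close>.  The last definition passes to the original kernel by
  \<open>I - K = (I - P) ((1 - \<eta>) I + \<eta> (I + P + \<dots> + P\<^bsup>N-1\<^esup>))\<close>.
\<close>

definition stat_mean :: "('b \<Rightarrow> real) \<Rightarrow> real" where
  "stat_mean f = phi (G f) / phi (G (\<lambda>_. 1))"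
definition residual_sol :: "('b \<Rightarrow> real) \<Rightarrow> 'b \<Rightarrow> real" where
  "residual_sol f = G (\<lambda>y. f y - stat_mean f)"
definition poisson_sol :: "('b \<Rightarrow> real) \<Rightarrow> 'b \<Rightarrow> real" where
  "poisson_sol f w = (1 - \<eta>) * residual_sol f w + \<eta> * (\<Sum>i<N. (A ^^ i) (residual_sol f) w)"

lemma G_nonneg: assumes w: "w \<in> space S" and f: "in_LV f" "\<And>y. y \<in> space S \<Longrightarrow> 0 \<le> f y"
  shows "0 \<le> G f w"
proof -
  have "0 \<le> (R ^^ n) f y" if "y \<in> space S" for n y
    using that by (induction n arbitrary: y) (auto simp: f intro!: R_nonneg in_LV_Rn)
  then show ?thesis unfolding G_def using w f by (intro suminf_nonneg Rn_summable) auto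
qed
lemma G1_ge1: assumes w: "w \<in> space S" shows "1 \<le> G (\<lambda>_. 1) w"
  using G_fix[OF in_LV_const w, of 1] R_nonneg[OF w in_LV_G[OF in_LV_const], of 1] G_nonneg[OF _ in_LV_const, of _ 1]
  by simp
lemma phi_G1: "1 \<le> phi (G (\<lambda>_. 1))"
  using phi_mono[OF in_LV_const in_LV_G[OF in_LV_const], of 1 1] G1_ge1 by (simp add: phi_const)

lemma stat_mean_abs: assumes f: "V_bounded c f" shows "\<bar>stat_mean f\<bar> \<le> c * mean_const"
proof -
  have "\<bar>phi (G f)\<bar> \<le> c / (1 - \<rho>) * (1 + B) * phi V"
    by (intro phi_abs V_bounded_of_VB_bounded VB_bounded_G VB_bounded_of_V_bounded f)
  also have "\<dots> = c * mean_const" by (simp add: mean_const_def)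
  finally have "\<bar>phi (G f)\<bar> \<le> c * mean_const" .
  moreover have "\<bar>stat_mean f\<bar> \<le> \<bar>phi (G f)\<bar> / 1"
    unfolding stat_mean_def abs_divide using phi_G1 by (intro divide_left_mono) auto
  ultimately show ?thesis by simp
qed

lemma stat_mean_add: "in_LV f \<Longrightarrow> in_LV g \<Longrightarrow> stat_mean (\<lambda>y. f y + g y) = stat_mean f + stat_mean g"
  unfolding stat_mean_def using phi_cong[of "G (\<lambda>y. f y + g y)" "\<lambda>y. G f y + G g y"]
  by (simp add: G_add phi_add in_LV_G add_divide_distrib)
lemma stat_mean_scale: "in_LV f \<Longrightarrow> stat_mean (\<lambda>y. r * f y) = r * stat_mean f"
  unfolding stat_mean_def using phi_cong[of "G (\<lambda>y. r * f y)" "\<lambda>y. r * G f y"]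
  by (simp add: G_scale phi_scale)
lemma stat_mean_diff: assumes "in_LV f" "in_LV g"
  shows "stat_mean (\<lambda>y. f y - g y) = stat_mean f - stat_mean g"
  using stat_mean_add[OF assms(1) in_LV_scale[OF assms(2), of "-1"]] stat_mean_scale[OF assms(2), of "-1"]
  by simp
lemma stat_mean_const: "stat_mean (\<lambda>_. r) = r"
  using stat_mean_scale[OF in_LV_const, of r 1] phi_G1 by (simp add: stat_mean_def)
lemma stat_mean_nonneg: assumes f: "in_LV f" "\<And>y. y \<in> space S \<Longrightarrow> 0 \<le> f y"
  shows "0 \<le> stat_mean f"
  using phi_mono[OF in_LV_const[of 0] in_LV_G[OF f(1)]] G_nonneg[OF _ f] phi_G1
  by (simp add: stat_mean_def phi_const)
lemma stat_mean_cong: "(\<And>y. y \<in> space S \<Longrightarrow> f y = g y) \<Longrightarrow> stat_mean f = stat_mean g"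
  unfolding stat_mean_def using phi_cong[of "G f" "G g"] G_cong[of _ f g] by simp
lemma stat_mean_tendsto:
  assumes f: "\<And>i. V_bounded c (f i)" and lim: "\<And>y. y \<in> space S \<Longrightarrow> (\<lambda>i. f i y) \<longlonglongrightarrow> g y"
  shows "(\<lambda>i. stat_mean (f i)) \<longlonglongrightarrow> stat_mean g"
  unfolding stat_mean_def using phi_G1
  by (intro tendsto_intros phi_tendsto[OF V_bounded_of_VB_bounded[OF VB_bounded_G[OF VB_bounded_of_V_bounded[OF f]]]] G_tendsto[OF f lim]) auto

lemma in_LV_center: "in_LV f \<Longrightarrow> in_LV (\<lambda>y. f y - stat_mean f)"
  by (intro in_LV_diff in_LV_const)
lemma in_LV_residual_sol: "in_LV f \<Longrightarrow> in_LV (residual_sol f)"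
  unfolding residual_sol_def by (intro in_LV_G in_LV_center)
lemma phi_residual_sol: assumes f: "in_LV f" shows "phi (residual_sol f) = 0"
proof -
  have "phi (residual_sol f) = phi (\<lambda>w. G f w - stat_mean f * G (\<lambda>_. 1) w)"
    unfolding residual_sol_def using f G_scale[OF _ in_LV_const[of 1], of _ "stat_mean f"]
    by (intro phi_cong) (simp add: G_diff in_LV_const)
  also have "\<dots> = phi (G f) - stat_mean f * phi (G (\<lambda>_. 1))"
    using f by (simp add: phi_diff phi_scale in_LV_G in_LV_scale in_LV_const)
  finally show ?thesis using phi_G1 by (simp add: stat_mean_def)
qed

lemma in_LV_sum: "(\<And>i. i < n \<Longrightarrow> in_LV (f i)) \<Longrightarrow> in_LV (\<lambda>w. \<Sum>i<(n::nat). f i w)"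
  by (induction n) (auto intro!: in_LV_add in_LV_const)
lemma A_sum: "w \<in> space S \<Longrightarrow> (\<And>i. i < n \<Longrightarrow> in_LV (f i)) \<Longrightarrow> A (\<lambda>y. \<Sum>i<(n::nat). f i y) w = (\<Sum>i<n. A (f i) w)"
  by (induction n) (simp_all add: A_const A_add in_LV_sum)

lemma in_LV_poisson_sol: "in_LV f \<Longrightarrow> in_LV (poisson_sol f)"
  unfolding poisson_sol_def[abs_def] by (intro in_LV_add in_LV_scale in_LV_sum in_LV_An in_LV_residual_sol)

lemma V_bounded_residual_sol: assumes f: "V_bounded c f"
  shows "V_bounded (c * residual_const) (residual_sol f)"
proof -
  have "V_bounded (c + \<bar>stat_mean f\<bar>) (\<lambda>y. f y - stat_mean f)"
    using V_bounded_diff[OF f V_bounded_const] .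
  then have "V_bounded (c * (1 + mean_const)) (\<lambda>y. f y - stat_mean f)"
    by (rule V_bounded_mono) (use stat_mean_abs[OF f] in \<open>simp add: algebra_simps\<close>)
  then have "V_bounded (c * (1 + mean_const) / (1 - \<rho>) * (1 + B)) (residual_sol f)"
    unfolding residual_sol_def by (intro V_bounded_of_VB_bounded VB_bounded_G VB_bounded_of_V_bounded)
  then show ?thesis by (simp add: residual_const_def mult_ac)
qed

lemma V_bounded_poisson_sol: assumes f: "V_bounded c f"
  shows "V_bounded (c * poisson_const N) (poisson_sol f)"
proof -
  have h: "V_bounded (c * residual_const) (residual_sol f)" using f by (rule V_bounded_residual_sol)
  have "V_bounded (\<bar>1 - \<eta>\<bar> * (c * residual_const) + \<bar>\<eta>\<bar> * (\<Sum>i<N. c * residual_const * M0)) (poisson_sol f)"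
    unfolding poisson_sol_def[abs_def] by (intro V_bounded_add V_bounded_scale V_bounded_sum V_bounded_An h)
  moreover have "\<bar>1 - \<eta>\<bar> * (c * residual_const) + \<bar>\<eta>\<bar> * (\<Sum>i<N. c * residual_const * M0) \<le> 1 * (c * residual_const) + 1 * (\<Sum>i<N. c * residual_const * M0)"
    using eta_pos eta_le M0_ge1 V_bounded_nonneg[OF h] by (intro add_mono mult_right_mono sum_nonneg) auto
  moreover have "1 * (c * residual_const) + 1 * (\<Sum>i<N. c * residual_const * M0) = c * poisson_const N"
    by (simp add: poisson_const_def algebra_simps)
  ultimately show ?thesis by (elim V_bounded_mono[OF _ order_trans[OF _ eq_refl]])
qed

lemma poisson_sol_eq: assumes f: "in_LV f" and w: "w \<in> space S"
  shows "poisson_sol f w - A (poisson_sol f) w = f w - stat_mean f"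
proof -
  let ?h = "residual_sol f"
  have h: "in_LV ?h" using f by (rule in_LV_residual_sol)
  have tel: "(\<Sum>i<N. A ((A ^^ i) ?h) w) = (\<Sum>i<N. (A ^^ i) ?h w) - (?h w - (A ^^ N) ?h w)"
    using sum_lessThan_telescope'[of "\<lambda>i. (A ^^ i) ?h w" N] by (simp add: sum_subtractf)
  have "A (poisson_sol f) w = (1 - \<eta>) * A ?h w + \<eta> * (\<Sum>i<N. A ((A ^^ i) ?h) w)"
    unfolding poisson_sol_def[abs_def] using w h
    by (simp add: A_add A_scale A_sum in_LV_scale in_LV_sum in_LV_An)
  then have "poisson_sol f w - A (poisson_sol f) w = ?h w - K ?h w"
    unfolding tel K_def poisson_sol_def[of f w] by (simp add: algebra_simps)
  also have "\<dots> = ?h w - R ?h w" using phi_residual_sol[OF f] by (simp add: R_def)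
  also have "\<dots> = f w - stat_mean f" using G_fix[OF in_LV_center[OF f] w] by (simp add: residual_sol_def)
  finally show ?thesis .
qed

text \<open>
  Only one constant makes the Poisson equation solvable: for two solutions the difference \<open>d\<close> has
  \<open>d - P d\<close> constant, so \<open>P\<^sup>n d\<close> is affine in \<open>n\<close>, while the drift keeps it bounded.
\<close>

lemma stat_mean_unique:
  assumes g: "in_LV g" and f: "in_LV f" and eq: "\<And>w. w \<in> space S \<Longrightarrow> g w - A g w = f w - r"
  shows "r = stat_mean f"
proof -
  define d where "d w = g w - poisson_sol f w" for w
  define k where "k = stat_mean f - r"
  have d: "in_LV d" unfolding d_def[abs_def] using g in_LV_poisson_sol[OF f] by (rule in_LV_diff)
  have step: "A d w = d w - k" if w: "w \<in> space S" for w
    unfolding d_def[abs_def] using eq[OF w] poisson_sol_eq[OF f w] w g in_LV_poisson_sol[OF f]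
      by (simp add: A_diff k_def)
  have iter: "(A ^^ n) d w = d w - real n * k" if "w \<in> space S" for n w
    using that
  proof (induction n arbitrary: w)
    case (Suc n)
    have "A ((A ^^ n) d) w = A (\<lambda>y. d y - real n * k) w" using Suc by (intro A_cong) auto
    then show ?case using Suc.prems d by (simp add: A_diff A_const in_LV_const step algebra_simps)
  qed simp
  obtain w where w: "w \<in> space S" using S_ne by auto
  obtain c where c: "V_bounded c d" using d by (auto simp: in_LV_def)
  have bound: "real n * \<bar>k\<bar> \<le> c * M0 * V w + \<bar>d w\<bar>" for n
  proof -
    have "real n * \<bar>k\<bar> = \<bar>d w - (A ^^ n) d w\<bar>" by (simp add: iter[OF w] abs_mult)
    then show ?thesis using V_boundedD[OF V_bounded_An[OF c, of n] w] by linarith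
  qed
  have "k = 0"
  proof (rule ccontr)
    assume "k \<noteq> 0"
    then obtain n where "(c * M0 * V w + \<bar>d w\<bar>) < real n * \<bar>k\<bar>"
      using ex_less_of_nat_mult[of "\<bar>k\<bar>"] by auto
    with bound[of n] show False by simp
  qed
  then show ?thesis by (simp add: k_def)
qed

text \<open>
  Invariance of the mean: \<open>f\<close> itself solves the Poisson equation with right-hand side \<open>f - P f\<close>.
\<close>

lemma stat_mean_A: assumes f: "in_LV f" shows "stat_mean (A f) = stat_mean f"
proof -
  have "0 = stat_mean (\<lambda>w. f w - A f w)"
    using f by (intro stat_mean_unique[OF f]) (auto intro: in_LV_diff in_LV_A)
  then show ?thesis using f by (simp add: stat_mean_diff in_LV_A)
qed

definition stat :: "'b measure" where
  "stat = measure_of (space S) (sets S) (\<lambda>E. ennreal (stat_mean (indicator E)))"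

lemma sets_stat[simp, measurable_cong]: "sets stat = sets S" and space_stat: "space stat = space S"
  by (auto simp: stat_def)

lemma V_bounded_ind: "E \<in> sets S \<Longrightarrow> V_bounded 1 (indicator E)"
  unfolding V_bounded_def using V_ge1 by (auto simp: indicator_def intro: order_trans[OF zero_le_one])

lemma emeasure_stat: assumes E: "E \<in> sets S" shows "emeasure stat E = ennreal (stat_mean (indicator E))"
proof (rule emeasure_measure_of[OF stat_def _ _ _ E[folded sets_stat]])
  show "sets S \<subseteq> Pow (space S)" by (rule sets.space_closed)
  show "positive (sets stat) (\<lambda>E. ennreal (stat_mean (indicator E)))"
    using stat_mean_cong[of "indicator {}" "\<lambda>_. 0"] by (simp add: positive_def stat_mean_const)
  have nonneg: "0 \<le> stat_mean (indicator E)" if "E \<in> sets S" for E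
    using that by (intro stat_mean_nonneg in_LV_ind) auto
  show "countably_additive (sets stat) (\<lambda>E. ennreal (stat_mean (indicator E)))"
  proof (rule countably_additiveI)
    fix X :: "nat \<Rightarrow> 'b set" assume "range X \<subseteq> sets stat" and dis: "disjoint_family X"
    then have X: "X i \<in> sets S" for i by auto
    have part: "indicator (\<Union>i<n. X i) = (\<lambda>y. \<Sum>i<n. indicator (X i) y :: real)" for n
      using indicator_UN_disjoint[of "{..<n}" X] dis
      by (auto simp: disjoint_family_on_def fun_eq_iff)
    have sums: "stat_mean (indicator (\<Union>i<n. X i)) = (\<Sum>i<n. stat_mean (indicator (X i)))" for n
      unfolding part using X
      by (induction n) (simp_all add: stat_mean_const[of 0] stat_mean_add in_LV_ind in_LV_sum)
    have "(\<lambda>n. stat_mean (indicator (\<Union>i<n. X i))) \<longlonglongrightarrow> stat_mean (indicator (\<Union>i. X i))"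
    proof (rule stat_mean_tendsto)
      show "V_bounded 1 (indicator (\<Union>i<n. X i))" for n using X
        by (intro V_bounded_ind sets.finite_UN) auto
      show "(\<lambda>n. indicator (\<Union>i<n. X i) y :: real) \<longlonglongrightarrow> indicator (\<Union>i. X i) y" for y
        by (rule LIMSEQ_indicator_UN)
    qed
    then have "(\<lambda>i. stat_mean (indicator (X i))) sums stat_mean (indicator (\<Union>i. X i))"
      unfolding sums sums_def .
    then show "(\<Sum>i. ennreal (stat_mean (indicator (X i)))) = ennreal (stat_mean (indicator (\<Union>i. X i)))"
      using nonneg[OF X] by (simp add: sums_iff suminf_ennreal2)
  qed
qed

lemma prob_space_stat: "prob_space stat"
proof
  have "emeasure stat (space S) = ennreal (stat_mean (indicator (space S)))" by (simp add: emeasure_stat)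
  also have "stat_mean (indicator (space S)) = stat_mean (\<lambda>_. 1)" by (rule stat_mean_cong) simp
  finally show "emeasure stat (space stat) = 1" by (simp add: stat_mean_const space_stat)
qed

lemma nn_integral_stat:
  assumes "f \<in> borel_measurable S" "\<And>y. 0 \<le> f y" "in_LV f"
  shows "(\<integral>\<^sup>+y. ennreal (f y) \<partial>stat) = ennreal (stat_mean f)"
  using assms
proof (induction rule: borel_measurable_induct_real)
  case (set E)
  then show ?case by (simp add: emeasure_stat ennreal_indicator)
next
  case (mult u c)
  show ?case
  proof (cases "c = 0")
    case False
    have "in_LV u" using in_LV_scale[OF mult.prems, of "1 / c"] False by simp
    with mult show ?thesis
      by (simp add: ennreal_mult' nn_integral_cmult stat_mean_scale cong: measurable_cong_sets)
  qed (simp add: stat_mean_const[of 0])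
next
  case (add u v)
  have dom: "in_LV g"
    if g: "g \<in> borel_measurable S" "\<And>y. 0 \<le> g y" "\<And>y. g y \<le> v y + u y" for g
  proof -
    obtain c where c: "V_bounded c (\<lambda>y. v y + u y)" using add.prems by (auto simp: in_LV_def)
    have "V_bounded c g" unfolding V_bounded_def
      using g V_boundedD[OF c] by (auto intro: order_trans)
         (smt (verit) V_boundedD c)
    then show ?thesis by (rule in_LVI)
  qed
  have "in_LV u" "in_LV v" using add by (auto intro!: dom)
  with add show ?case
    by (simp add: nn_integral_add stat_mean_add stat_mean_nonneg ennreal_plus)
next
  case (seq U)
  have U: "\<And>i. U i \<in> borel_measurable S" "\<And>i y. 0 \<le> U i y" "incseq U"
    "\<And>y. y \<in> space S \<Longrightarrow> (\<lambda>i. U i y) \<longlonglongrightarrow> f y" by fact+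
  obtain c where c: "V_bounded c f" using seq.prems by (auto simp: in_LV_def)
  have Ule: "U i y \<le> f y" if "y \<in> space S" for i y
    using U(3) U(4)[OF that] by (intro incseq_le) (auto simp: incseq_def le_fun_def)
  have Ubd: "V_bounded c (U i)" for i
    unfolding V_bounded_def using U(1) U(2)[of i] Ule V_boundedD[OF c]
      by (auto) (smt (verit) Ule V_boundedD c)
  have "(\<lambda>i. \<integral>\<^sup>+y. ennreal (U i y) \<partial>stat) \<longlonglongrightarrow> (\<integral>\<^sup>+y. ennreal (f y) \<partial>stat)"
  proof -
    let ?ind = "\<lambda>g y. ennreal (g y) * indicator (space S) y"
    have "(\<lambda>i. \<integral>\<^sup>+y. ?ind (U i) y \<partial>stat) \<longlonglongrightarrow> (\<integral>\<^sup>+y. ?ind f y \<partial>stat)"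
    proof (rule nn_integral_LIMSEQ)
      show "incseq (\<lambda>i. ?ind (U i))"
        using U(3) by (auto simp: incseq_def le_fun_def intro!: mult_right_mono ennreal_leI)
      show "?ind (U i) \<in> borel_measurable stat" for i using U(1)[of i] by measurable
      show "(\<lambda>i. ?ind (U i) y) \<longlonglongrightarrow> ?ind f y" for y
        using U(4)[of y] by (cases "y \<in> space S") (auto intro: tendsto_ennrealI)
    qed
    then show ?thesis by (simp add: nn_integral_set_ennreal space_stat[symmetric] cong: nn_integral_cong)
  qed
  moreover have "(\<lambda>i. ennreal (stat_mean (U i))) \<longlonglongrightarrow> ennreal (stat_mean f)"
    using U by (intro tendsto_ennrealI stat_mean_tendsto[OF Ubd]) auto
  moreover have "(\<integral>\<^sup>+y. ennreal (U i y) \<partial>stat) = ennreal (stat_mean (U i))" for i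
    using seq.IH[OF in_LVI[OF Ubd]] .
  ultimately show ?case using LIMSEQ_unique by simp
qed

lemma emeasure_Q: assumes w: "w \<in> space S" and E: "E \<in> sets S"
  shows "emeasure (Q w) E = ennreal (A (indicator E) w)"
proof -
  interpret prob_space "Q w" by (rule Q_prob[OF w])
  show ?thesis using E w by (simp add: A_def emeasure_eq_measure Q_space sets.Int_space_eq2 Q_sets)
qed

lemma stat_stationary: "stationary_distribution S Q stat"
  unfolding stationary_distribution_def
proof
  show sp: "stat \<in> space (prob_algebra S)"
    using prob_space_stat by (simp add: space_prob_algebra)
  have Qs: "Q \<in> stat \<rightarrow>\<^sub>M subprob_algebra S"
    using measurable_prob_algebraD[OF Q_meas] by (simp cong: measurable_cong_sets)
  have ne: "space stat \<noteq> {}" using S_ne by (simp add: space_stat)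
  show "stat \<bind> Q = stat"
  proof (rule measure_eqI)
    show sb: "sets (stat \<bind> Q) = sets stat"
      using sets_bind[of stat Q S] ne Q_sets by (simp add: space_stat)
    fix E assume "E \<in> sets (stat \<bind> Q)"
    then have E: "E \<in> sets S" by (simp add: sb)
    have "emeasure (stat \<bind> Q) E = (\<integral>\<^sup>+w. emeasure (Q w) E \<partial>stat)"
      by (rule emeasure_bind[OF ne Qs E])
    also have "\<dots> = (\<integral>\<^sup>+w. ennreal (max 0 (A (indicator E) w)) \<partial>stat)"
      using E A_mono[OF _ in_LV_const[of 0] in_LV_ind[OF E]]
      by (intro nn_integral_cong) (simp add: emeasure_Q space_stat ennreal_max_0)
    also have "\<dots> = ennreal (stat_mean (\<lambda>w. max 0 (A (indicator E) w)))"
    proof (rule nn_integral_stat)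
      have "in_LV (A (indicator E))" using E by (intro in_LV_A in_LV_ind)
      then show "in_LV (\<lambda>w. max 0 (A (indicator E) w))" unfolding in_LV_def V_bounded_def
        by (auto simp: max_def) (smt (verit))
      then show "(\<lambda>w. max 0 (A (indicator E) w)) \<in> borel_measurable S" by (rule in_LV_meas)
    qed auto
    also have "stat_mean (\<lambda>w. max 0 (A (indicator E) w)) = stat_mean (A (indicator E))"
      using A_mono[OF _ in_LV_const[of 0] in_LV_ind[OF E]] by (intro stat_mean_cong) (simp add: A_const)
    also have "\<dots> = stat_mean (indicator E)" using E by (intro stat_mean_A in_LV_ind)
    also have "ennreal (stat_mean (indicator E)) = emeasure stat E" by (simp add: emeasure_stat E)
    finally show "emeasure (stat \<bind> Q) E = emeasure stat E" .
  qed
qed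

context
  fixes \<nu> assumes nu: "stationary_distribution S Q \<nu>"
begin

lemma nu_sets: "sets \<nu> = sets S" and nu_space: "space \<nu> = space S" and nu_prob: "prob_space \<nu>"
  using nu by (auto simp: stationary_distribution_def space_prob_algebra dest: sets_eq_imp_space_eq)

lemma nu_invariant:
  assumes f: "in_LV f" "\<And>y. y \<in> space S \<Longrightarrow> 0 \<le> f y"
  shows "(\<integral>\<^sup>+w. ennreal (A f w) \<partial>\<nu>) = (\<integral>\<^sup>+w. ennreal (f w) \<partial>\<nu>)"
proof -
  have "(\<integral>\<^sup>+w. ennreal (f w) \<partial>\<nu>) = (\<integral>\<^sup>+w. ennreal (f w) \<partial>(\<nu> \<bind> Q))"
    using nu by (simp add: stationary_distribution_def)
  also have "\<dots> = (\<integral>\<^sup>+w. \<integral>\<^sup>+y. ennreal (f y) \<partial>Q w \<partial>\<nu>)"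
    using in_LV_meas[OF f(1)] measurable_prob_algebraD[OF Q_meas] nu_sets
    by (intro nn_integral_bind[where B = S]) (auto cong: measurable_cong_sets)
  also have "\<dots> = (\<integral>\<^sup>+w. ennreal (A f w) \<partial>\<nu>)"
    unfolding A_def using f
    by (intro nn_integral_cong nn_integral_eq_integral Q_int AE_I2) (auto simp: nu_space Q_space)
  finally show ?thesis by simp
qed

text \<open>
  A stationary distribution integrates \<open>V\<close>: integrate the drift inequality for the truncation
  \<open>min m V\<close>, where invariance may be used, and let \<open>m\<close> tend to infinity by Fatou's lemma.
\<close>

lemma nu_V_fin: "(\<integral>\<^sup>+w. ennreal (V w) \<partial>\<nu>) < \<infinity>"
proof -
  interpret nu: prob_space \<nu> by (rule nu_prob)
  have mc: "g \<in> borel_measurable \<nu> \<longleftrightarrow> g \<in> borel_measurable S" for g :: "'b \<Rightarrow> real"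
    using nu_sets by (simp cong: measurable_cong_sets)
  (* The truncated drift defect u - v + b is nonnegative and tends to (1 - gamma) V. *)
  define u where "u m w = min (real m) (V w)" for m :: nat and w
  define v where "v m w = min (real m) (\<gamma> * V w + b)" for m :: nat and w
  have uL: "in_LV (u m)" for m
    unfolding in_LV_def V_bounded_def u_def using V_pos by (intro exI[of _ 1]) (auto simp: less_imp_le)
  have unn: "0 \<le> u m w" if "w \<in> space S" for m w using V_pos[OF that] by (simp add: u_def less_imp_le)
  have Auv: "A (u m) w \<le> v m w" if w: "w \<in> space S" for m w
  proof -
    have "A (u m) w \<le> A (\<lambda>_. real m) w" "A (u m) w \<le> A V w"
      using w by (auto intro!: A_mono uL in_LV_const in_LV_V simp: u_def)
    then show ?thesis using A_V_le[OF w] by (simp add: v_def A_const[OF w])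
  qed
  have Ann: "0 \<le> A (u m) w" if w: "w \<in> space S" for m w
    using A_mono[OF w in_LV_const[of 0] uL] unn A_const[OF w] by simp
  have um[measurable]: "u m \<in> borel_measurable \<nu>" for m using in_LV_meas[OF uL] by (simp add: mc)
  have vm[measurable]: "v m \<in> borel_measurable \<nu>" for m unfolding mc v_def[abs_def] by measurable
  have Am[measurable]: "A (u m) \<in> borel_measurable \<nu>" for m using in_LV_meas[OF in_LV_A[OF uL]]
    by (simp add: mc)
  have ui: "integrable \<nu> (u m)" for m
    using unn V_pos by (intro nu.integrable_const_bound[of _ "real m"] AE_I2) (auto simp: nu_space u_def abs_le_iff less_imp_le min_def)
  have vi: "integrable \<nu> (v m)" for m
    using V_pos lam b_nonneg
    by (intro nu.integrable_const_bound[of _ "real m"] AE_I2) (auto simp: nu_space v_def less_imp_le)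
  have Ai: "integrable \<nu> (A (u m))" for m
    using Ann Auv by (intro Bochner_Integration.integrable_bound[OF vi[of m]] AE_I2) (auto simp: nu_space intro: order_trans[OF _ abs_ge_self])
  have "(\<integral>w. A (u m) w \<partial>\<nu>) = (\<integral>w. u m w \<partial>\<nu>)" for m
    using nu_invariant[OF uL unn] Ann unn ui Ai by (subst (1 2) integral_eq_nn_integral) (auto simp: nu_space)
  moreover have "(\<integral>w. A (u m) w \<partial>\<nu>) \<le> (\<integral>w. v m w \<partial>\<nu>)" for m
    using Auv by (intro integral_mono Ai vi) (auto simp: nu_space)
  ultimately have le: "(\<integral>w. u m w - v m w + b \<partial>\<nu>) \<le> b" for m
    using ui vi by (simp add: nu.prob_space)
  have nn: "0 \<le> u m w - v m w + b" if w: "w \<in> space S" for m w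
  proof -
    have "\<gamma> * V w \<le> 1 * V w" using lam V_pos[OF w] by (intro mult_right_mono) auto
    then show ?thesis using b_nonneg by (auto simp: u_def v_def min_def)
  qed
  have fin: "(\<integral>\<^sup>+w. ennreal (u m w - v m w + b) \<partial>\<nu>) \<le> ennreal b" for m
    using le[of m] nn ui vi by (subst nn_integral_eq_integral) (auto simp: nu_space intro: ennreal_leI)
  have "(\<integral>\<^sup>+w. ennreal ((1 - \<gamma>) * V w) \<partial>\<nu>) = (\<integral>\<^sup>+w. liminf (\<lambda>m. ennreal (u m w - v m w + b)) \<partial>\<nu>)"
  proof (rule nn_integral_cong)
    fix w assume "w \<in> space \<nu>"
    obtain k where k: "V w \<le> real k" "\<gamma> * V w + b \<le> real k"
      using real_arch_simple[of "max (V w) (\<gamma> * V w + b)"] by auto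
    have "\<forall>\<^sub>F m in sequentially. ennreal (u m w - v m w + b) = ennreal ((1 - \<gamma>) * V w)"
      using eventually_ge_at_top[of k]
    proof eventually_elim
      case (elim m)
      then have "u m w = V w" "v m w = \<gamma> * V w + b" using k by (auto simp: u_def v_def)
      then show ?case by (simp add: algebra_simps)
    qed
    then have "(\<lambda>m. ennreal (u m w - v m w + b)) \<longlonglongrightarrow> ennreal ((1 - \<gamma>) * V w)"
      by (rule tendsto_eventually)
    then show "ennreal ((1 - \<gamma>) * V w) = liminf (\<lambda>m. ennreal (u m w - v m w + b))"
      by (simp add: lim_imp_Liminf)
  qed
  also have "\<dots> \<le> liminf (\<lambda>m. \<integral>\<^sup>+w. ennreal (u m w - v m w + b) \<partial>\<nu>)"
    by (rule nn_integral_liminf) measurable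
  also have "\<dots> \<le> ennreal b"
    using fin by (intro Liminf_le) (auto intro: always_eventually)
  finally have "ennreal (1 - \<gamma>) * (\<integral>\<^sup>+w. ennreal (V w) \<partial>\<nu>) \<le> ennreal b"
    using lam mc[of V] V_meas by (subst (asm) ennreal_mult') (auto simp: nn_integral_cmult)
  then have "ennreal (1 - \<gamma>) * (\<integral>\<^sup>+w. ennreal (V w) \<partial>\<nu>) < \<infinity>"
    by (auto intro: le_less_trans)
  then show ?thesis using lam by (auto simp: ennreal_mult_less_top)
qed

lemma nu_integrable: "in_LV f \<Longrightarrow> integrable \<nu> f"
  using nu_sets nu_V_fin by (rule integrable_of_in_LV)

text \<open>
  Integrate the Poisson equation: the left-hand side vanishes by invariance.
\<close>

lemma nu_integral: assumes f: "in_LV f" shows "(\<integral>w. f w \<partial>\<nu>) = stat_mean f"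
proof -
  interpret nu: prob_space \<nu> by (rule nu_prob)
  have inv0: "(\<integral>w. A g w \<partial>\<nu>) = (\<integral>w. g w \<partial>\<nu>)"
    if g: "in_LV g" "\<And>y. y \<in> space S \<Longrightarrow> 0 \<le> g y" for g
  proof -
    have "0 \<le> A g w" if "w \<in> space S" for w
      using A_mono[OF that in_LV_const[of 0] g(1)] g(2) A_const[OF that] by simp
    then show ?thesis using nu_invariant[OF g] nu_integrable[OF g(1)] nu_integrable[OF in_LV_A[OF g(1)]] g(2)
      by (subst (1 2) integral_eq_nn_integral) (auto simp: nu_space)
  qed
  have inv: "(\<integral>w. A g w \<partial>\<nu>) = (\<integral>w. g w \<partial>\<nu>)"
    if g: "in_LV g" for g
  proof -
    obtain c where c: "V_bounded c g" using g by (auto simp: in_LV_def)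
    have cV: "in_LV (\<lambda>y. c * V y)" by (intro in_LV_scale in_LV_V)
    have "(\<integral>w. A (\<lambda>y. g y + c * V y) w \<partial>\<nu>) = (\<integral>w. g w + c * V w \<partial>\<nu>)"
      using V_boundedD[OF c] by (intro inv0 in_LV_add g cV) (smt (verit))
    moreover have "(\<integral>w. A (\<lambda>y. g y + c * V y) w \<partial>\<nu>) = (\<integral>w. A g w + A (\<lambda>y. c * V y) w \<partial>\<nu>)"
      using g cV by (intro Bochner_Integration.integral_cong) (auto simp: nu_space A_add)
    moreover have "(\<integral>w. A (\<lambda>y. c * V y) w \<partial>\<nu>) = (\<integral>w. c * V w \<partial>\<nu>)"
      using V_pos V_bounded_nonneg[OF c] by (intro inv0 cV) (auto simp: less_imp_le)
    ultimately show ?thesis using g cV by (simp add: nu_integrable in_LV_A in_LV_V)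
  qed
  have "(\<integral>w. poisson_sol f w - A (poisson_sol f) w \<partial>\<nu>) = 0"
    using inv[OF in_LV_poisson_sol[OF f]] by (simp add: nu_integrable in_LV_A in_LV_poisson_sol f)
  moreover have "(\<integral>w. poisson_sol f w - A (poisson_sol f) w \<partial>\<nu>) = (\<integral>w. f w - stat_mean f \<partial>\<nu>)"
    using f by (intro Bochner_Integration.integral_cong) (auto simp: nu_space poisson_sol_eq)
  ultimately show ?thesis using nu_integrable[OF f] by (simp add: nu.prob_space)
qed

lemma nu_eq_stat: "\<nu> = stat"
proof (rule measure_eqI)
  interpret nu: prob_space \<nu> by (rule nu_prob)
  show "sets \<nu> = sets stat" by (simp add: nu_sets)
  fix E assume "E \<in> sets \<nu>"
  then have E: "E \<in> sets S" by (simp add: nu_sets)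
  have "E \<inter> space \<nu> = E" using sets.sets_into_space[OF E] by (auto simp: nu_space)
  then have "measure \<nu> E = (\<integral>w. indicator E w \<partial>\<nu>)" by simp
  also have "\<dots> = stat_mean (indicator E)" using E by (intro nu_integral in_LV_ind)
  finally show "emeasure \<nu> E = emeasure stat E"
    using E by (simp add: emeasure_stat nu.emeasure_eq_measure)
qed

end

lemma the_stationary: "the_stationary_distribution S Q = stat"
  unfolding the_stationary_distribution_def using stat_stationary nu_eq_stat by (rule the_equality)

lemma stat_integrable: "in_LV f \<Longrightarrow> integrable stat f"
  using stat_stationary by (rule nu_integrable)
lemma stat_integral: "in_LV f \<Longrightarrow> (\<integral>w. f w \<partial>stat) = stat_mean f"
  using stat_stationary by (rule nu_integral)

end

section \<open>Lipschitz dependence on the kernel\<close>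

context drift_setup
begin

text \<open>
  Lipschitz constants, uniform over the family, for \<open>K\<close>, for the centred potential and for the
  Poisson solution.
\<close>

definition mixture_lip :: "nat \<Rightarrow> real" where "mixture_lip N = 1 + real N * M0 ^ N"
definition residual_lip :: "nat \<Rightarrow> real" where
  "residual_lip N = (1 + mean_const * (1 + poisson_const N) + residual_const * mixture_lip N) / (1 - \<rho>) * (1 + B)"
definition poisson_lip :: "nat \<Rightarrow> real" where
  "poisson_lip N = residual_lip N + (\<Sum>i<N. M0 * residual_lip N + residual_const * (real i * M0 ^ i))"

end

context drift_kernel
begin

lemma mean_const_nonneg: "0 \<le> mean_const"
  using B_nonneg rho_less1 phi_V_pos by (simp add: mean_const_def)
lemma residual_const_nonneg: "0 \<le> residual_const"
  using B_nonneg rho_less1 mean_const_nonneg by (simp add: residual_const_def)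
lemma poisson_const_nonneg: "0 \<le> poisson_const N"
  using residual_const_nonneg M0_ge1 by (simp add: poisson_const_def)
lemma mixture_lip_nonneg: "0 \<le> mixture_lip N"
  using M0_ge1 by (simp add: mixture_lip_def)
lemma residual_lip_nonneg: "0 \<le> residual_lip N"
  using mean_const_nonneg residual_const_nonneg poisson_const_nonneg mixture_lip_nonneg rho_less1 B_nonneg
  by (simp add: residual_lip_def)
lemma poisson_lip_nonneg: "0 \<le> poisson_lip N"
  unfolding poisson_lip_def using residual_lip_nonneg residual_const_nonneg M0_ge1
  by (intro add_nonneg_nonneg sum_nonneg mult_nonneg_nonneg) auto

end

text \<open>
  Two kernels of the family whose difference has norm at most \<open>D\<close> as an operator on the
  weighted space.
\<close>

locale drift_kernel_pair = drift_setup S V W0 \<phi> \<epsilon> \<gamma> b +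
  P1: drift_kernel S V W0 \<phi> \<epsilon> \<gamma> b N Q1 + P2: drift_kernel S V W0 \<phi> \<epsilon> \<gamma> b N Q2
  for S :: "'b measure" and V :: "'b \<Rightarrow> real" and W0 :: "'b set" and \<phi> :: "'b measure"
    and \<epsilon> \<gamma> b :: real and N :: nat and Q1 Q2 :: "'b \<Rightarrow> 'b measure" +
  fixes D :: real
  assumes D_nonneg: "0 \<le> D"
    and close: "\<And>f w. V_bounded 1 f \<Longrightarrow> w \<in> space S \<Longrightarrow> \<bar>P1.A f w - P2.A f w\<bar> \<le> D * V w"
begin

lemma V_bounded_A_diff: assumes f: "V_bounded c f" shows "V_bounded (c * D) (\<lambda>w. P1.A f w - P2.A f w)"
  unfolding V_bounded_def
proof (intro conjI ballI)
  have L: "in_LV f" using f by (rule in_LVI)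
  show "(\<lambda>w. P1.A f w - P2.A f w) \<in> borel_measurable S"
    using in_LV_meas[OF P1.in_LV_A[OF L]] in_LV_meas[OF P2.in_LV_A[OF L]] by measurable
  fix w assume w: "w \<in> space S"
  show "\<bar>P1.A f w - P2.A f w\<bar> \<le> c * D * V w"
  proof (cases "c = 0")
    case True
    then have "f y = 0" if "y \<in> space S" for y using V_boundedD[OF f that] by simp
    then show ?thesis using P1.A_cong[OF w, of f "\<lambda>_. 0"] P2.A_cong[OF w, of f "\<lambda>_. 0"] P1.A_const[OF w] P2.A_const[OF w] True
      by simp
  next
    case False
    then have c: "0 < c" using V_bounded_nonneg[OF f] by simp
    have "V_bounded 1 (\<lambda>y. 1 / c * f y)" using V_bounded_scale[OF f, of "1 / c"] c by simp
    from close[OF this w] have "1 / c * \<bar>P1.A f w - P2.A f w\<bar> \<le> D * V w"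
      unfolding P1.A_scale P2.A_scale using c
        by (simp flip: right_diff_distrib add: abs_mult abs_divide diff_divide_distrib[symmetric])
    then show ?thesis using c by (simp add: field_simps)
  qed
qed

lemma V_bounded_An_diff:
  assumes f: "V_bounded c f"
    shows "V_bounded (c * D * (real n * M0 ^ n)) (\<lambda>w. (P1.A ^^ n) f w - (P2.A ^^ n) f w)"
proof (induction n)
  case 0 then show ?case using V_bounded_const[of 0] by simp
next
  case (Suc n)
  have L: "in_LV f" using f by (rule in_LVI)
  let ?d = "\<lambda>w. (P1.A ^^ n) f w - (P2.A ^^ n) f w"
  have "V_bounded (c * M0 * D + c * D * (real n * M0 ^ n) * M0)
      (\<lambda>w. (P1.A ((P1.A ^^ n) f) w - P2.A ((P1.A ^^ n) f) w) + P2.A ?d w)"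
    by (intro V_bounded_add V_bounded_A_diff P1.V_bounded_An f P2.V_bounded_A Suc)
  then have "V_bounded (c * M0 * D + c * D * (real n * M0 ^ n) * M0) (\<lambda>w. (P1.A ^^ Suc n) f w - (P2.A ^^ Suc n) f w)"
    by (rule V_bounded_cong[THEN iffD1, rotated]) (simp add: P2.A_diff P1.in_LV_An P2.in_LV_An L)
  moreover have "c * M0 * D + c * D * (real n * M0 ^ n) * M0 \<le> c * D * (real (Suc n) * M0 ^ Suc n)"
  proof -
    have "1 \<le> M0 ^ n" using M0_ge1 by (rule one_le_power)
    then have "(c * D * M0) * 1 \<le> (c * D * M0) * M0 ^ n"
      using V_bounded_nonneg[OF f] D_nonneg M0_ge1 by (intro mult_left_mono) auto
    then show ?thesis by (simp add: algebra_simps)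
  qed
  ultimately show ?case by (rule V_bounded_mono)
qed

lemma V_bounded_K_diff: assumes f: "V_bounded c f"
  shows "V_bounded (c * D * mixture_lip N) (\<lambda>w. P1.K f w - P2.K f w)"
proof -
  have cD: "0 \<le> c * D" using V_bounded_nonneg[OF f] D_nonneg by simp
  have "V_bounded (\<bar>1 - \<eta>\<bar> * (c * D) + \<bar>\<eta>\<bar> * (c * D * (real N * M0 ^ N)))
    (\<lambda>w. (1 - \<eta>) * (P1.A f w - P2.A f w) + \<eta> * ((P1.A ^^ N) f w - (P2.A ^^ N) f w))"
    by (intro V_bounded_add V_bounded_scale V_bounded_A_diff V_bounded_An_diff f)
  then have "V_bounded (\<bar>1 - \<eta>\<bar> * (c * D) + \<bar>\<eta>\<bar> * (c * D * (real N * M0 ^ N))) (\<lambda>w. P1.K f w - P2.K f w)"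
    by (rule V_bounded_cong[THEN iffD1, rotated]) (simp add: P1.K_def P2.K_def algebra_simps)
  moreover have "\<bar>1 - \<eta>\<bar> * (c * D) + \<bar>\<eta>\<bar> * (c * D * (real N * M0 ^ N)) \<le> 1 * (c * D) + 1 * (c * D * (real N * M0 ^ N))"
    using eta_pos eta_le M0_ge1 cD by (intro add_mono mult_right_mono) auto
  moreover have "1 * (c * D) + 1 * (c * D * (real N * M0 ^ N)) = c * D * mixture_lip N"
    by (simp add: mixture_lip_def algebra_simps)
  ultimately show ?thesis by (elim V_bounded_mono[OF _ order_trans[OF _ eq_refl]])
qed

text \<open>
  The Poisson solution of the second kernel solves an equation for the first kernel whose right-hand
  side is off by the difference of the kernels; uniqueness of the constant then compares the means.
\<close>

lemma stat_mean_diff_le: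
  assumes f1: "in_LV f1" and f2: "V_bounded c f2" and e: "V_bounded e (\<lambda>w. f1 w - f2 w)"
  shows "\<bar>P1.stat_mean f1 - P2.stat_mean f2\<bar> \<le> mean_const * (1 + poisson_const N) * (e + c * D)"
proof -
  let ?g = "P2.poisson_sol f2"
  let ?t = "\<lambda>w. P1.A ?g w - P2.A ?g w"
  have L2: "in_LV f2" using f2 by (rule in_LVI)
  have g: "V_bounded (c * poisson_const N) ?g" using f2 by (rule P2.V_bounded_poisson_sol)
  have t: "V_bounded (c * poisson_const N * D) ?t" using g by (rule V_bounded_A_diff)
  have "P2.stat_mean f2 = P1.stat_mean (\<lambda>w. f2 w - ?t w)"
    using P2.poisson_sol_eq[OF L2]
    by (intro P1.stat_mean_unique[OF in_LVI[OF g]] in_LV_diff[OF L2 in_LVI[OF t]]) (simp add: algebra_simps)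
  then have "P1.stat_mean f1 - P2.stat_mean f2 = P1.stat_mean (\<lambda>w. f1 w - f2 w) + P1.stat_mean ?t"
    using f1 L2 in_LVI[OF t] by (simp add: P1.stat_mean_diff[of f1] P1.stat_mean_diff[of f2])
  then have "\<bar>P1.stat_mean f1 - P2.stat_mean f2\<bar> \<le> e * mean_const + c * poisson_const N * D * mean_const"
    using P1.stat_mean_abs[OF e] P1.stat_mean_abs[OF t] by linarith
  also have "\<dots> \<le> mean_const * (1 + poisson_const N) * (e + c * D)"
    using P1.mean_const_nonneg P1.poisson_const_nonneg V_bounded_nonneg[OF e] V_bounded_nonneg[OF f2] D_nonneg
    by (simp add: algebra_simps)
  finally show ?thesis .
qed

text \<open>
  The difference \<open>d\<close> of the two centred potentials has residual \<open>d - R d\<close> made up of the change of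
  the function, of its mean, and of the kernel; stability of \<open>R\<close> bounds \<open>d\<close>.
\<close>

lemma V_bounded_residual_sol_diff:
  assumes f1: "in_LV f1" and f2: "V_bounded c f2" and e: "V_bounded e (\<lambda>w. f1 w - f2 w)"
  shows "V_bounded (residual_lip N * (e + c * D)) (\<lambda>w. P1.residual_sol f1 w - P2.residual_sol f2 w)"
proof -
  let ?h1 = "P1.residual_sol f1" and ?h2 = "P2.residual_sol f2"
  let ?d = "\<lambda>w. ?h1 w - ?h2 w"
  define X where "X = (1 + mean_const * (1 + poisson_const N) + residual_const * mixture_lip N) * (e + c * D)"
  have L2: "in_LV f2" using f2 by (rule in_LVI)
  have h2: "V_bounded (c * residual_const) ?h2" using f2 by (rule P2.V_bounded_residual_sol)
  have d: "in_LV ?d" using f1 L2 by (intro in_LV_diff P1.in_LV_residual_sol P2.in_LV_residual_sol)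
  have cD: "0 \<le> c * D" using V_bounded_nonneg[OF f2] D_nonneg by simp
  have "\<bar>?d w - P1.R ?d w\<bar> \<le> X * VB w" if w: "w \<in> space S" for w
  proof -
    have e1: "P1.R ?h1 w = ?h1 w - (f1 w - P1.stat_mean f1)"
      using P1.G_fix[OF P1.in_LV_center[OF f1] w] by (simp add: P1.residual_sol_def)
    have e2: "P2.R ?h2 w = ?h2 w - (f2 w - P2.stat_mean f2)"
      using P2.G_fix[OF P2.in_LV_center[OF L2] w] by (simp add: P2.residual_sol_def)
    have "?d w - P1.R ?d w = (f1 w - f2 w) - (P1.stat_mean f1 - P2.stat_mean f2) + (P1.R ?h2 w - P2.R ?h2 w)"
      using w f1 L2 by (simp add: P1.R_diff P1.in_LV_residual_sol P2.in_LV_residual_sol e1 e2)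
    also have "P1.R ?h2 w - P2.R ?h2 w = P1.K ?h2 w - P2.K ?h2 w"
      by (simp add: P1.R_def P2.R_def)
    finally have "\<bar>?d w - P1.R ?d w\<bar> \<le> e * V w + mean_const * (1 + poisson_const N) * (e + c * D) + c * residual_const * D * mixture_lip N * V w"
      using V_boundedD[OF e w] stat_mean_diff_le[OF f1 f2 e] V_boundedD[OF V_bounded_K_diff[OF h2] w]
      by linarith
    also have "\<dots> \<le> (e + c * D) * V w + (mean_const * (1 + poisson_const N) * (e + c * D)) * V w + (residual_const * mixture_lip N * (e + c * D)) * V w"
    proof (intro add_mono)
      show "e * V w \<le> (e + c * D) * V w" using cD V_pos[OF w] by (intro mult_right_mono) auto
      show "mean_const * (1 + poisson_const N) * (e + c * D) \<le> mean_const * (1 + poisson_const N) * (e + c * D) * V w"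
        using mult_left_mono[OF V_ge1[OF w], of "mean_const * (1 + poisson_const N) * (e + c * D)"]
          P1.mean_const_nonneg P1.poisson_const_nonneg cD V_bounded_nonneg[OF e] by simp
      have "(residual_const * mixture_lip N) * (c * D) \<le> (residual_const * mixture_lip N) * (e + c * D)"
        using P1.residual_const_nonneg P1.mixture_lip_nonneg V_bounded_nonneg[OF e]
        by (intro mult_left_mono) auto
      then show "c * residual_const * D * mixture_lip N * V w \<le> residual_const * mixture_lip N * (e + c * D) * V w"
        using V_pos[OF w] by (intro mult_right_mono) (auto simp: mult_ac)
    qed
    also have "\<dots> = X * V w" by (simp add: X_def algebra_simps)
    also have "\<dots> \<le> X * VB w"
      unfolding X_def using P1.mean_const_nonneg P1.poisson_const_nonneg P1.residual_const_nonneg P1.mixture_lip_nonneg V_bounded_nonneg[OF e] cD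
      by (intro mult_left_mono VB_ge) simp
    finally show ?thesis .
  qed
  then have "VB_bounded (X / (1 - \<rho>)) ?d"
    unfolding VB_bounded_def using P1.G_stability[OF d] in_LV_meas[OF d] by blast
  then have "V_bounded (X / (1 - \<rho>) * (1 + B)) ?d" by (rule V_bounded_of_VB_bounded)
  then show ?thesis by (simp add: X_def residual_lip_def mult_ac)
qed

lemma V_bounded_poisson_sol_diff:
  assumes f1: "in_LV f1" and f2: "V_bounded c f2" and e: "V_bounded e (\<lambda>w. f1 w - f2 w)"
  shows "V_bounded (poisson_lip N * (e + c * D)) (\<lambda>w. P1.poisson_sol f1 w - P2.poisson_sol f2 w)"
proof -
  let ?h1 = "P1.residual_sol f1" and ?h2 = "P2.residual_sol f2"
  define s where "s = e + c * D"
  have L2: "in_LV f2" using f2 by (rule in_LVI)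
  have h2: "V_bounded (c * residual_const) ?h2" using f2 by (rule P2.V_bounded_residual_sol)
  have h1L: "in_LV ?h1" and h2L: "in_LV ?h2"
    using f1 L2 by (auto intro: P1.in_LV_residual_sol P2.in_LV_residual_sol)
  have cD: "0 \<le> c * D" using V_bounded_nonneg[OF f2] D_nonneg by simp
  have s: "0 \<le> s" "c * D \<le> s" using cD V_bounded_nonneg[OF e] by (auto simp: s_def)
  have d: "V_bounded (residual_lip N * s) (\<lambda>w. ?h1 w - ?h2 w)"
    unfolding s_def by (rule V_bounded_residual_sol_diff[OF f1 f2 e])
  have it: "V_bounded ((M0 * residual_lip N + residual_const * (real i * M0 ^ i)) * s) (\<lambda>w. (P1.A ^^ i) ?h1 w - (P2.A ^^ i) ?h2 w)" for i
  proof -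
    have "V_bounded (residual_lip N * s * M0 + c * residual_const * D * (real i * M0 ^ i))
       (\<lambda>w. (P1.A ^^ i) (\<lambda>w. ?h1 w - ?h2 w) w + ((P1.A ^^ i) ?h2 w - (P2.A ^^ i) ?h2 w))"
      by (intro V_bounded_add P1.V_bounded_An d V_bounded_An_diff h2)
    then have "V_bounded (residual_lip N * s * M0 + c * residual_const * D * (real i * M0 ^ i)) (\<lambda>w. (P1.A ^^ i) ?h1 w - (P2.A ^^ i) ?h2 w)"
    proof (rule V_bounded_cong[THEN iffD1, rotated])
      fix w assume w: "w \<in> space S"
      have "(P1.A ^^ i) (\<lambda>w. ?h1 w + (-1) * ?h2 w) w = (P1.A ^^ i) ?h1 w + (-1) * (P1.A ^^ i) ?h2 w"
        using w h1L h2L by (simp only: P1.An_add in_LV_scale P1.An_scale)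
      then show "(P1.A ^^ i) (\<lambda>w. ?h1 w - ?h2 w) w + ((P1.A ^^ i) ?h2 w - (P2.A ^^ i) ?h2 w)
          = (P1.A ^^ i) ?h1 w - (P2.A ^^ i) ?h2 w" by simp
    qed
    moreover
    have "(residual_const * (real i * M0 ^ i)) * (c * D) \<le> (residual_const * (real i * M0 ^ i)) * s"
      using s P1.residual_const_nonneg M0_ge1 by (intro mult_left_mono mult_nonneg_nonneg) auto
    then have "residual_lip N * s * M0 + c * residual_const * D * (real i * M0 ^ i) \<le> (M0 * residual_lip N + residual_const * (real i * M0 ^ i)) * s"
      by (simp add: algebra_simps)
    ultimately show ?thesis by (rule V_bounded_mono)
  qed
  have "V_bounded (\<bar>1 - \<eta>\<bar> * (residual_lip N * s) + \<bar>\<eta>\<bar> * (\<Sum>i<N. (M0 * residual_lip N + residual_const * (real i * M0 ^ i)) * s))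
     (\<lambda>w. (1 - \<eta>) * (?h1 w - ?h2 w) + \<eta> * (\<Sum>i<N. (P1.A ^^ i) ?h1 w - (P2.A ^^ i) ?h2 w))"
    by (intro V_bounded_add V_bounded_scale V_bounded_sum d it)
  then have "V_bounded (\<bar>1 - \<eta>\<bar> * (residual_lip N * s) + \<bar>\<eta>\<bar> * (\<Sum>i<N. (M0 * residual_lip N + residual_const * (real i * M0 ^ i)) * s))
     (\<lambda>w. P1.poisson_sol f1 w - P2.poisson_sol f2 w)"
    by (rule V_bounded_cong[THEN iffD1, rotated])
       (simp add: P1.poisson_sol_def P2.poisson_sol_def sum_subtractf algebra_simps)
  moreover have "\<bar>1 - \<eta>\<bar> * (residual_lip N * s) + \<bar>\<eta>\<bar> * (\<Sum>i<N. (M0 * residual_lip N + residual_const * (real i * M0 ^ i)) * s)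
      \<le> 1 * (residual_lip N * s) + 1 * (\<Sum>i<N. (M0 * residual_lip N + residual_const * (real i * M0 ^ i)) * s)"
    using eta_pos eta_le M0_ge1 s P1.residual_lip_nonneg P1.residual_const_nonneg
    by (intro add_mono mult_right_mono sum_nonneg mult_nonneg_nonneg add_nonneg_nonneg) auto
  moreover have "1 * (residual_lip N * s) + 1 * (\<Sum>i<N. (M0 * residual_lip N + residual_const * (real i * M0 ^ i)) * s) = poisson_lip N * (e + c * D)"
    by (simp add: poisson_lip_def s_def[symmetric] distrib_right sum_distrib_right)
  ultimately show ?thesis by (elim V_bounded_mono[OF _ order_trans[OF _ eq_refl]])
qed

end

section \<open>Joint measurability in the parameter and the state\<close>

lemma lebesgue_integral_kernel_measurable:
  fixes f :: "'a \<Rightarrow> 'b \<Rightarrow> real"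
  assumes f: "(\<lambda>(x, y). f x y) \<in> borel_measurable (M \<Otimes>\<^sub>M N)"
    and L: "L \<in> M \<rightarrow>\<^sub>M subprob_algebra N"
  shows "(\<lambda>x. \<integral>y. f x y \<partial>L x) \<in> borel_measurable M"
proof -
  have "(\<lambda>x. distr (L x) (M \<Otimes>\<^sub>M N) (\<lambda>y. (x, y))) \<in> M \<rightarrow>\<^sub>M subprob_algebra (M \<Otimes>\<^sub>M N)"
    using L by (intro measurable_distr2[where M = N]) auto
  from measurable_compose[OF this integral_measurable_subprob_algebra[OF f]]
  have "(\<lambda>x. integral\<^sup>L (distr (L x) (M \<Otimes>\<^sub>M N) (\<lambda>y. (x, y))) (\<lambda>(x, y). f x y)) \<in> borel_measurable M" .
  then show ?thesis
  proof (rule measurable_cong[THEN iffD1, rotated])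
    fix x assume x: "x \<in> space M"
    have s: "sets (L x) = sets N" using sets_kernel[OF L x] .
    have "(\<lambda>y. (x, y)) \<in> L x \<rightarrow>\<^sub>M M \<Otimes>\<^sub>M N"
      using x by (simp add: measurable_cong_sets[OF s refl])
    then show "integral\<^sup>L (distr (L x) (M \<Otimes>\<^sub>M N) (\<lambda>y. (x, y))) (\<lambda>(x, y). f x y) = (\<integral>y. f x y \<partial>L x)"
      using f by (subst integral_distr) auto
  qed
qed

text \<open>
  A kernel family that is jointly measurable in the parameter and the state.  Each operator of the
  construction integrates a jointly measurable function against a jointly measurable kernel, so it
  preserves joint measurability.
\<close>

locale drift_family = drift_setup S V W0 \<phi> \<epsilon> \<gamma> b
  for S :: "'b measure" and V :: "'b \<Rightarrow> real" and W0 :: "'b set" and \<phi> :: "'b measure"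
    and \<epsilon> \<gamma> b :: real +
  fixes N :: nat and T :: "'a measure" and P :: "'a \<Rightarrow> 'b \<Rightarrow> 'b measure"
  assumes joint[measurable]: "(\<lambda>(t, w). P t w) \<in> T \<Otimes>\<^sub>M S \<rightarrow>\<^sub>M prob_algebra S"
    and kern: "\<And>t. t \<in> space T \<Longrightarrow> drift_kernel S V W0 \<phi> \<epsilon> \<gamma> b N (P t)"
begin

abbreviation "fA t \<equiv> drift_kernel.A (P t)"
abbreviation "fK t \<equiv> drift_kernel.K \<gamma> b N (P t)"
abbreviation "fR t \<equiv> drift_kernel.R W0 \<phi> \<epsilon> \<gamma> b N (P t)"
abbreviation "fG t \<equiv> drift_kernel.G W0 \<phi> \<epsilon> \<gamma> b N (P t)"
abbreviation "fstat_mean t \<equiv> drift_kernel.stat_mean W0 \<phi> \<epsilon> \<gamma> b N (P t)"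
abbreviation "fresidual_sol t \<equiv> drift_kernel.residual_sol W0 \<phi> \<epsilon> \<gamma> b N (P t)"
abbreviation "fpoisson_sol t \<equiv> drift_kernel.poisson_sol W0 \<phi> \<epsilon> \<gamma> b N (P t)"

definition jointly_meas :: "('a \<Rightarrow> 'b \<Rightarrow> real) \<Rightarrow> bool" where
  "jointly_meas f \<longleftrightarrow> (\<lambda>(t, w). f t w) \<in> borel_measurable (T \<Otimes>\<^sub>M S)"

lemma jointly_measD: "jointly_meas f \<Longrightarrow> (\<lambda>x. f (fst x) (snd x)) \<in> borel_measurable (T \<Otimes>\<^sub>M S)"
  by (simp add: jointly_meas_def case_prod_beta')
lemma jointly_measI: "(\<lambda>x. f (fst x) (snd x)) \<in> borel_measurable (T \<Otimes>\<^sub>M S) \<Longrightarrow> jointly_meas f"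
  by (simp add: jointly_meas_def case_prod_beta')
lemma jointly_meas_cong: "(\<And>t w. t \<in> space T \<Longrightarrow> w \<in> space S \<Longrightarrow> f t w = g t w) \<Longrightarrow> jointly_meas g \<Longrightarrow> jointly_meas f"
  unfolding jointly_meas_def
    by (subst measurable_cong[where g = "\<lambda>(t, w). g t w"]) (auto simp: space_pair_measure)

lemma jointly_meas_A: assumes f: "jointly_meas f" shows "jointly_meas (\<lambda>t. fA t (f t))"
proof -
  have "(\<lambda>x. \<integral>y. f (fst x) y \<partial>P (fst x) (snd x)) \<in> borel_measurable (T \<Otimes>\<^sub>M S)"
  proof (rule lebesgue_integral_kernel_measurable)
    show "(\<lambda>(x, y). f (fst x) y) \<in> borel_measurable ((T \<Otimes>\<^sub>M S) \<Otimes>\<^sub>M S)"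
      using measurable_compose[of "\<lambda>(x, y). (fst x, y)" "(T \<Otimes>\<^sub>M S) \<Otimes>\<^sub>M S" "T \<Otimes>\<^sub>M S", OF _ jointly_measD[OF f]]
      by (simp add: case_prod_beta')
    show "(\<lambda>x. P (fst x) (snd x)) \<in> T \<Otimes>\<^sub>M S \<rightarrow>\<^sub>M subprob_algebra S"
      using measurable_prob_algebraD[OF joint] by (simp add: case_prod_beta')
  qed
  then have "jointly_meas (\<lambda>t w. \<integral>y. f t y \<partial>P t w)" by (rule jointly_measI)
  then show ?thesis by (rule jointly_meas_cong[rotated]) (simp add: drift_kernel.A_def[OF kern])
qed

lemma jointly_meas_An: "jointly_meas f \<Longrightarrow> jointly_meas (\<lambda>t. (fA t ^^ n) (f t))"
  by (induction n) (auto intro: jointly_meas_A)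

lemma phi_joint: assumes f: "jointly_meas f" shows "(\<lambda>t. phi (f t)) \<in> borel_measurable T"
  unfolding phi_def
proof (rule lebesgue_integral_kernel_measurable)
  show "(\<lambda>(t, w). f t w) \<in> borel_measurable (T \<Otimes>\<^sub>M S)"
    using f by (simp add: jointly_meas_def)
  show "(\<lambda>_. \<phi>) \<in> T \<rightarrow>\<^sub>M subprob_algebra S"
    using phi_prob by (intro measurable_const) (auto simp: space_prob_algebra space_subprob_algebra prob_space_imp_subprob_space)
qed

lemma jointly_meas_R: assumes f: "jointly_meas f" shows "jointly_meas (\<lambda>t. fR t (f t))"
proof -
  note [measurable] = jointly_measD[OF jointly_meas_A[OF f]] jointly_measD[OF jointly_meas_An[OF f]] phi_joint[OF f]
  have "jointly_meas (\<lambda>t w. (1 - \<eta>) * fA t (f t) w + \<eta> * (fA t ^^ N) (f t) w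
      - \<eta> * \<epsilon> * indicator W0 w * phi (f t))"
    by (rule jointly_measI) measurable
  then show ?thesis
    by (rule jointly_meas_cong[rotated]) (simp add: drift_kernel.R_def[OF kern] drift_kernel.K_def[OF kern])
qed

lemma jointly_meas_Rn: "jointly_meas f \<Longrightarrow> jointly_meas (\<lambda>t. (fR t ^^ n) (f t))"
  by (induction n) (auto intro: jointly_meas_R)

lemma jointly_meas_G: assumes f: "jointly_meas f" shows "jointly_meas (\<lambda>t. fG t (f t))"
proof -
  note [measurable] = jointly_measD[OF jointly_meas_Rn[OF f]]
  have "jointly_meas (\<lambda>t w. \<Sum>n. (fR t ^^ n) (f t) w)"
    by (rule jointly_measI) measurable
  then show ?thesis by (rule jointly_meas_cong[rotated]) (simp add: drift_kernel.G_def[OF kern])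
qed

lemma stat_mean_joint: assumes f: "jointly_meas f"
  shows "(\<lambda>t. fstat_mean t (f t)) \<in> borel_measurable T"
proof -
  have one: "jointly_meas (\<lambda>_ _. 1)" by (simp add: jointly_meas_def)
  note [measurable] = phi_joint[OF jointly_meas_G[OF f]] phi_joint[OF jointly_meas_G[OF one]]
  have "(\<lambda>t. phi (fG t (f t)) / phi (fG t (\<lambda>_. 1))) \<in> borel_measurable T" by measurable
  then show ?thesis
    by (rule measurable_cong[THEN iffD1, rotated]) (simp add: drift_kernel.stat_mean_def[OF kern])
qed

lemma jointly_meas_residual_sol: assumes f: "jointly_meas f"
  shows "jointly_meas (\<lambda>t. fresidual_sol t (f t))"
proof -
  note [measurable] = jointly_measD[OF f] stat_mean_joint[OF f]
  have "jointly_meas (\<lambda>t w. f t w - fstat_mean t (f t))" by (rule jointly_measI) measurable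
  from jointly_meas_G[OF this] show ?thesis
    by (rule jointly_meas_cong[rotated]) (simp add: drift_kernel.residual_sol_def[OF kern])
qed

lemma jointly_meas_poisson_sol: assumes f: "jointly_meas f"
  shows "jointly_meas (\<lambda>t. fpoisson_sol t (f t))"
proof -
  note [measurable] = jointly_measD[OF jointly_meas_residual_sol[OF f]] jointly_measD[OF jointly_meas_An[OF jointly_meas_residual_sol[OF f]]]
  have "jointly_meas (\<lambda>t w. (1 - \<eta>) * fresidual_sol t (f t) w + \<eta> * (\<Sum>i<N. (fA t ^^ i) (fresidual_sol t (f t)) w))"
    by (rule jointly_measI) measurable
  then show ?thesis by (rule jointly_meas_cong[rotated]) (simp add: drift_kernel.poisson_sol_def[OF kern])
qed

end

section \<open>Conditional laws and the history of the process\<close>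

text \<open>
  From conditional probabilities of events \<open>{X \<in> E}\<close> to integrals of functions of the past and of \<open>X\<close>:
  the joint law of past and present and the past law composed with \<open>\<kappa>\<close> agree on rectangles.
\<close>

lemma nn_integral_conditional_law:
  fixes X :: "'c \<Rightarrow> 'b"
  assumes M: "prob_space M" and sub: "subalgebra M F"
    and X: "X \<in> M \<rightarrow>\<^sub>M S" and \<kappa>: "\<kappa> \<in> F \<rightarrow>\<^sub>M prob_algebra S"
    and law: "\<And>E. E \<in> sets S \<Longrightarrow>
        AE \<omega> in M. real_cond_exp M F (indicator (X -` E \<inter> space M)) \<omega> = measure (\<kappa> \<omega>) E"
    and H: "H \<in> borel_measurable (F \<Otimes>\<^sub>M S)"
  shows "(\<integral>\<^sup>+\<omega>. H (\<omega>, X \<omega>) \<partial>M) = (\<integral>\<^sup>+\<omega>. \<integral>\<^sup>+y. H (\<omega>, y) \<partial>\<kappa> \<omega> \<partial>M)"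
proof -
  interpret prob_space M by (rule M)
  interpret finite_measure_subalgebra M F by standard (rule sub)
  have spF: "space F = space M" and setsF: "sets F \<subseteq> sets M"
    using sub by (auto simp: subalgebra_def)
  have idF: "(\<lambda>\<omega>. \<omega>) \<in> M \<rightarrow>\<^sub>M F"
    using setsF by (auto simp: measurable_def spF)
  note X[measurable]
  have \<kappa>M: "\<kappa> \<in> M \<rightarrow>\<^sub>M prob_algebra S"
    using measurable_compose[OF idF \<kappa>] .
  have \<kappa>_sets: "sets (\<kappa> \<omega>) = sets S" and \<kappa>_prob: "prob_space (\<kappa> \<omega>)"
    if "\<omega> \<in> space M" for \<omega>
    using measurable_space[OF \<kappa>M that] by (auto simp: space_prob_algebra)
  have \<kappa>_space: "space (\<kappa> \<omega>) = space S" if "\<omega> \<in> space M" for \<omega>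
    using \<kappa>_sets[OF that] by (rule sets_eq_imp_space_eq)
  define L where "L = (\<lambda>\<omega>. distr (\<kappa> \<omega>) (F \<Otimes>\<^sub>M S) (\<lambda>y. (\<omega>, y)))"
  have L: "L \<in> M \<rightarrow>\<^sub>M subprob_algebra (F \<Otimes>\<^sub>M S)"
    unfolding L_def
  proof (rule measurable_distr2)
    show "(\<lambda>(\<omega>, y). (\<omega>, y)) \<in> M \<Otimes>\<^sub>M S \<rightarrow>\<^sub>M F \<Otimes>\<^sub>M S"
      unfolding case_prod_beta'
      by (intro measurable_Pair measurable_compose[OF measurable_fst idF]) measurable
  qed (rule measurable_prob_algebraD[OF \<kappa>M])
  have pm: "(\<lambda>y. (\<omega>, y)) \<in> \<kappa> \<omega> \<rightarrow>\<^sub>M F \<Otimes>\<^sub>M S"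
    if "\<omega> \<in> space M" for \<omega>
    using that by (simp add: measurable_cong_sets[OF \<kappa>_sets[OF that] refl] spF)
  have XM: "(\<lambda>\<omega>. (\<omega>, X \<omega>)) \<in> M \<rightarrow>\<^sub>M F \<Otimes>\<^sub>M S"
    by (intro measurable_Pair idF X)
  have ne: "space M \<noteq> {}" by (rule not_empty)
  have rect: "emeasure (distr M (F \<Otimes>\<^sub>M S) (\<lambda>\<omega>. (\<omega>, X \<omega>))) (C \<times> E) = emeasure (M \<bind> L) (C \<times> E)"
    if C: "C \<in> sets F" and E: "E \<in> sets S" for C E
  proof -
    let ?XE = "X -` E \<inter> space M"
    have XE: "?XE \<in> sets M" using E by measurable
    have XEi: "integrable M (indicator ?XE :: _ \<Rightarrow> real)"
      using XE by (rule integrable_real_indicator) (simp add: less_top[symmetric])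
    have CM: "C \<in> sets M" using C setsF by auto
    have \<kappa>E: "(\<lambda>\<omega>. measure (\<kappa> \<omega>) E) \<in> borel_measurable M"
      using measurable_compose[OF \<kappa>M[THEN measurable_prob_algebraD] measurable_measure_subprob_algebra[OF E]] .
    have "emeasure (distr M (F \<Otimes>\<^sub>M S) (\<lambda>\<omega>. (\<omega>, X \<omega>))) (C \<times> E) = emeasure M (C \<inter> ?XE)"
      using C E sets.sets_into_space[OF CM]
      by (subst emeasure_distr[OF XM]) (auto intro!: arg_cong[where f = "emeasure M"])
    also have "\<dots> = ennreal (\<integral>\<omega>\<in>C. indicator ?XE \<omega> \<partial>M)"
      using CM XE by (simp add: set_lebesgue_integral_def emeasure_eq_measure flip: indicator_inter_arith)
    also have "(\<integral>\<omega>\<in>C. indicator ?XE \<omega> \<partial>M) = (\<integral>\<omega>\<in>C. real_cond_exp M F (indicator ?XE) \<omega> \<partial>M)"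
      by (rule real_cond_exp_intA[OF XEi C])
    also have "\<dots> = (\<integral>\<omega>\<in>C. measure (\<kappa> \<omega>) E \<partial>M)"
      unfolding set_lebesgue_integral_def
    proof (rule integral_cong_AE)
      show "(\<lambda>\<omega>. indicator C \<omega> *\<^sub>R real_cond_exp M F (indicator ?XE) \<omega>) \<in> borel_measurable M"
        using CM by measurable
      show "(\<lambda>\<omega>. indicator C \<omega> *\<^sub>R measure (\<kappa> \<omega>) E) \<in> borel_measurable M"
        using CM \<kappa>E by measurable
      show "AE \<omega> in M. indicator C \<omega> *\<^sub>R real_cond_exp M F (indicator ?XE) \<omega>
          = indicator C \<omega> *\<^sub>R measure (\<kappa> \<omega>) E"
        using law[OF E] by eventually_elim (rule arg_cong)
    qed
    also have "ennreal \<dots> = (\<integral>\<^sup>+\<omega>. ennreal (indicator C \<omega> * measure (\<kappa> \<omega>) E) \<partial>M)"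
      unfolding set_lebesgue_integral_def real_scaleR_def
    proof (rule nn_integral_eq_integral[symmetric])
      show "integrable M (\<lambda>\<omega>. indicator C \<omega> * measure (\<kappa> \<omega>) E)"
      proof (rule integrable_const_bound[of _ 1])
        show "(\<lambda>\<omega>. indicator C \<omega> * measure (\<kappa> \<omega>) E) \<in> borel_measurable M"
          using CM \<kappa>E by measurable
        show "AE \<omega> in M. norm (indicator C \<omega> * measure (\<kappa> \<omega>) E) \<le> 1"
          using prob_space.prob_le_1[OF \<kappa>_prob] by (intro AE_I2) (simp add: indicator_def)
      qed
      show "AE \<omega> in M. 0 \<le> indicator C \<omega> * measure (\<kappa> \<omega>) E" by simp
    qed
    also have "\<dots> = (\<integral>\<^sup>+\<omega>. emeasure (L \<omega>) (C \<times> E) \<partial>M)"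
    proof (rule nn_integral_cong)
      fix \<omega> assume w: "\<omega> \<in> space M"
      interpret k: prob_space "\<kappa> \<omega>" by (rule \<kappa>_prob[OF w])
      have "emeasure (L \<omega>) (C \<times> E) = emeasure (\<kappa> \<omega>) ((\<lambda>y. (\<omega>, y)) -` (C \<times> E) \<inter> space (\<kappa> \<omega>))"
        unfolding L_def using C E pm[OF w] by (subst emeasure_distr) auto
      also have "(\<lambda>y. (\<omega>, y)) -` (C \<times> E) \<inter> space (\<kappa> \<omega>) = (if \<omega> \<in> C then E else {})"
        using sets.sets_into_space[OF E] \<kappa>_space[OF w] by auto
      finally show "ennreal (indicator C \<omega> * measure (\<kappa> \<omega>) E) = emeasure (L \<omega>) (C \<times> E)"
        by (auto simp: k.emeasure_eq_measure)
    qed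
    also have "\<dots> = emeasure (M \<bind> L) (C \<times> E)"
      using C E by (intro emeasure_bind[OF ne L, symmetric]) auto
    finally show ?thesis .
  qed
  have eq: "distr M (F \<Otimes>\<^sub>M S) (\<lambda>\<omega>. (\<omega>, X \<omega>)) = M \<bind> L"
  proof (rule measure_eqI_generator_eq[where E = "{C \<times> E | C E. C \<in> sets F \<and> E \<in> sets S}"
        and \<Omega> = "space F \<times> space S" and A = "\<lambda>_. space F \<times> space S"])
    show "Int_stable {C \<times> E | C E. C \<in> sets F \<and> E \<in> sets S}"
      by (rule Int_stable_pair_measure_generator)
    show "{C \<times> E | C E. C \<in> sets F \<and> E \<in> sets S} \<subseteq> Pow (space F \<times> space S)"
      using sets.space_closed[of F] sets.space_closed[of S] by auto
    have s1: "sets (F \<Otimes>\<^sub>M S) = sigma_sets (space F \<times> space S) {C \<times> E | C E. C \<in> sets F \<and> E \<in> sets S}"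
      by (rule sets_pair_measure)
    then show "sets (distr M (F \<Otimes>\<^sub>M S) (\<lambda>\<omega>. (\<omega>, X \<omega>))) = sigma_sets (space F \<times> space S) {C \<times> E | C E. C \<in> sets F \<and> E \<in> sets S}"
      by simp
    have "sets (M \<bind> L) = sets (F \<Otimes>\<^sub>M S)"
      using ne sets_kernel[OF L] by (intro sets_bind) auto
    with s1 show "sets (M \<bind> L) = sigma_sets (space F \<times> space S) {C \<times> E | C E. C \<in> sets F \<and> E \<in> sets S}"
      by simp
    show "emeasure (distr M (F \<Otimes>\<^sub>M S) (\<lambda>\<omega>. (\<omega>, X \<omega>))) Y = emeasure (M \<bind> L) Y"
      if "Y \<in> {C \<times> E | C E. C \<in> sets F \<and> E \<in> sets S}" for Y
      using that rect by auto
    show "emeasure (distr M (F \<Otimes>\<^sub>M S) (\<lambda>\<omega>. (\<omega>, X \<omega>))) (space F \<times> space S) \<noteq> \<infinity>"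
      using finite_measure.emeasure_finite[OF finite_measure_distr[OF XM]] by auto
  qed auto
  have "(\<integral>\<^sup>+\<omega>. H (\<omega>, X \<omega>) \<partial>M) = (\<integral>\<^sup>+x. H x \<partial>(M \<bind> L))"
    unfolding eq[symmetric] using H by (intro nn_integral_distr[symmetric] XM) auto
  also have "\<dots> = (\<integral>\<^sup>+\<omega>. \<integral>\<^sup>+x. H x \<partial>L \<omega> \<partial>M)"
    by (rule nn_integral_bind[OF H L])
  also have "\<dots> = (\<integral>\<^sup>+\<omega>. \<integral>\<^sup>+y. H (\<omega>, y) \<partial>\<kappa> \<omega> \<partial>M)"
    unfolding L_def using pm H by (intro nn_integral_cong nn_integral_distr) auto
  finally show ?thesis .
qed

lemma space_history[simp]: "space (history M \<theta> W k) = space M"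
  unfolding history_def by (rule space_measure_of) auto

lemma history_pair_measurable:
  fixes \<theta> :: "nat \<Rightarrow> 'c \<Rightarrow> 'a::topological_space" and W :: "nat \<Rightarrow> 'c \<Rightarrow> 'b::topological_space"
  assumes "i \<le> k"
  shows "(\<lambda>\<omega>. (\<theta> i \<omega>, W i \<omega>)) \<in> history M \<theta> W k \<rightarrow>\<^sub>M borel"
proof (rule measurableI)
  fix Y :: "('a \<times> 'b) set" assume "Y \<in> sets borel"
  with assms show "(\<lambda>\<omega>. (\<theta> i \<omega>, W i \<omega>)) -` Y \<inter> space (history M \<theta> W k) \<in> sets (history M \<theta> W k)"
    unfolding space_history unfolding history_def by (intro in_measure_of) auto
qed auto

lemma history_measurable:
  fixes \<theta> :: "nat \<Rightarrow> 'c \<Rightarrow> 'a::euclidean_space" and W :: "nat \<Rightarrow> 'c \<Rightarrow> 'b::euclidean_space"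
  assumes "i \<le> k"
  shows "\<theta> i \<in> history M \<theta> W k \<rightarrow>\<^sub>M borel" "W i \<in> history M \<theta> W k \<rightarrow>\<^sub>M borel"
proof -
  have f: "fst \<in> borel_measurable (borel :: ('a \<times> 'b) measure)" "snd \<in> borel_measurable (borel :: ('a \<times> 'b) measure)"
    by (intro borel_measurable_continuous_onI continuous_on_fst continuous_on_snd continuous_on_id)+
  show "\<theta> i \<in> history M \<theta> W k \<rightarrow>\<^sub>M borel" "W i \<in> history M \<theta> W k \<rightarrow>\<^sub>M borel"
    using measurable_compose[OF history_pair_measurable[OF assms] f(1), of \<theta> W M]
      measurable_compose[OF history_pair_measurable[OF assms] f(2), of \<theta> W M] by simp_all
qed

lemma history_mono:
  assumes "i \<le> k" shows "sets (history M \<theta> W i) \<subseteq> sets (history M \<theta> W k)"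
proof -
  have s: "sets (history M \<theta> W k) = sigma_sets (space M)
      (\<Union>i\<le>k. {(\<lambda>\<omega>. (\<theta> i \<omega>, W i \<omega>)) -` B \<inter> space M | B. B \<in> sets borel})" for k
    unfolding history_def by (rule sets_measure_of) blast
  show ?thesis unfolding s by (rule sigma_sets_mono', rule UN_mono) (use assms in auto)
qed

lemma subalgebra_history:
  fixes \<theta> :: "nat \<Rightarrow> 'c \<Rightarrow> 'a::euclidean_space" and W :: "nat \<Rightarrow> 'c \<Rightarrow> 'b::euclidean_space"
  assumes "\<And>k. \<theta> k \<in> borel_measurable M" "\<And>k. W k \<in> borel_measurable M"
  shows "subalgebra M (history M \<theta> W k)"
  unfolding subalgebra_def
proof
  show "sets (history M \<theta> W k) \<subseteq> sets M"
    unfolding history_def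
  proof (subst sets_measure_of, blast, rule sets.sigma_sets_subset, safe)
    fix i and Y :: "('a \<times> 'b) set" assume "Y \<in> sets borel"
    then show "(\<lambda>\<omega>. (\<theta> i \<omega>, W i \<omega>)) -` Y \<inter> space M \<in> sets M"
      using borel_measurable_Pair[OF assms(1)[of i] assms(2)[of i]] by (rule measurable_sets[rotated])
  qed
qed simp

section \<open>The Poisson equation of the projected recursion\<close>

text \<open>
  The root of \<open>U 2\<close> is equivalent to \<open>U 1\<close>, the scale of the growth and continuity conditions, while its
  square is exactly the function of the drift condition.
\<close>

definition weight :: "'b::real_normed_vector \<Rightarrow> real" where
  "weight w = sqrt (U 2 w)"

lemma weight_sq: "(weight w)\<^sup>2 = U 2 w" by (simp add: weight_def U_def)
lemma weight_ge1: "1 \<le> weight w" by (simp add: weight_def U_def)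
lemma weight_le_U1: "weight w \<le> U 1 w"
  unfolding weight_def U_def by (rule real_le_lsqrt) (auto simp: power2_eq_square algebra_simps)
lemma U1_le_weight: "U 1 w \<le> sqrt 2 * weight w"
proof -
  have "0 \<le> (1 - norm w)\<^sup>2" by simp
  then have "(1 + norm w)\<^sup>2 \<le> 2 * (1 + (norm w)\<^sup>2)"
    by (simp add: power2_eq_square algebra_simps)
  then have "1 + norm w \<le> sqrt (2 * (1 + (norm w)\<^sup>2))" by (rule real_le_rsqrt)
  then show ?thesis unfolding weight_def U_def by (simp only: real_sqrt_mult power_one_right)
qed
lemma weight_measurable[measurable]: "weight \<in> borel_measurable (borel_on (Z :: 'b::euclidean_space set))"
  unfolding weight_def U_def by (intro measurable_restrict_space1) measurable

lemma (in prob_space) expectation_le_sqrt: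
  assumes "integrable M X" "integrable M (\<lambda>x. (X x)\<^sup>2)"
  shows "expectation X \<le> sqrt (expectation (\<lambda>x. (X x)\<^sup>2))"
  using variance_eq[OF assms] variance_positive[of X] by (intro real_le_rsqrt) simp

text \<open>
  Jensen's inequality and subadditivity of the root pass from \<open>U 2\<close> to the weight.
\<close>

lemma sqrt_drift:
  fixes Z :: "'b::euclidean_space set"
  assumes Q: "prob_space Q" "sets Q = sets (borel_on Z)"
    and dr: "(\<integral>\<^sup>+y. ennreal (U 2 y) \<partial>Q) \<le> ennreal (\<rho> * U 2 w + b * indicator Z0 w)"
    and "0 \<le> \<rho>" "0 \<le> b"
  shows "(\<integral>\<^sup>+y. ennreal (weight y) \<partial>Q) \<le> ennreal (sqrt \<rho> * weight w + sqrt b * indicator Z0 w)"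
proof -
  interpret prob_space Q by (rule Q)
  have m: "weight \<in> borel_measurable Q" using Q(2) by (simp cong: measurable_cong_sets)
  have 2: "integrable Q (\<lambda>y. (weight y)\<^sup>2)"
  proof (rule integrableI_nonneg)
    show "(\<lambda>y. (weight y)\<^sup>2) \<in> borel_measurable Q" using m by measurable
    show "(\<integral>\<^sup>+y. ennreal ((weight y)\<^sup>2) \<partial>Q) < \<infinity>"
      unfolding weight_sq by (rule le_less_trans[OF dr]) simp
  qed simp
  have le2: "weight y \<le> (weight y)\<^sup>2" for y
    using weight_ge1[of y] by (simp add: power2_eq_square)
  have 1: "integrable Q weight"
  proof (rule Bochner_Integration.integrable_bound[OF 2 m], rule AE_I2)
    show "norm (weight y) \<le> norm ((weight y)\<^sup>2)" for y
      using le2[of y] weight_ge1[of y] by simp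
  qed
  have nn: "0 \<le> U 2 w" by (simp add: U_def)
  have "expectation (\<lambda>y. (weight y)\<^sup>2) \<le> \<rho> * U 2 w + b * indicator Z0 w"
  proof -
    have "ennreal (expectation (\<lambda>y. (weight y)\<^sup>2)) \<le> ennreal (\<rho> * U 2 w + b * indicator Z0 w)"
    proof -
      have "(\<integral>\<^sup>+y. ennreal ((weight y)\<^sup>2) \<partial>Q) = ennreal (expectation (\<lambda>y. (weight y)\<^sup>2))"
        by (rule nn_integral_eq_integral[OF 2]) simp
      then show ?thesis using dr by (simp add: weight_sq)
    qed
    then show ?thesis using \<open>0 \<le> \<rho>\<close> \<open>0 \<le> b\<close> nn
      by (subst (asm) ennreal_le_iff) (auto intro!: add_nonneg_nonneg mult_nonneg_nonneg)
  qed
  then have "expectation weight \<le> sqrt (\<rho> * U 2 w + b * indicator Z0 w)"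
    using expectation_le_sqrt[OF 1 2] by (meson order_trans real_sqrt_le_iff)
  also have "\<dots> \<le> sqrt (\<rho> * U 2 w) + sqrt (b * indicator Z0 w)"
    using \<open>0 \<le> \<rho>\<close> \<open>0 \<le> b\<close> nn by (intro sqrt_add_le_add_sqrt) auto
  also have "\<dots> = sqrt \<rho> * weight w + sqrt b * indicator Z0 w"
    by (simp add: real_sqrt_mult weight_def indicator_def)
  finally have "ennreal (expectation weight) \<le> ennreal (sqrt \<rho> * weight w + sqrt b * indicator Z0 w)"
    by (rule ennreal_leI)
  moreover have "(\<integral>\<^sup>+y. ennreal (weight y) \<partial>Q) = ennreal (expectation weight)"
    using 1 weight_ge1 by (intro nn_integral_eq_integral AE_I2) (auto intro: order_trans[OF zero_le_one])
  ultimately show ?thesis by simp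
qed

lemma space_borel_on[simp]: "space (borel_on Z) = Z" by (simp add: space_restrict_space)

lemma sa_model_kernel:
  assumes "sa_model \<Theta> Z F P" "t \<in> \<Theta>"
    shows "P t \<in> borel_on Z \<rightarrow>\<^sub>M prob_algebra (borel_on Z)"
proof -
  have "(\<lambda>(\<theta>, w). P \<theta> w) \<in> borel_on \<Theta> \<Otimes>\<^sub>M borel_on Z \<rightarrow>\<^sub>M prob_algebra (borel_on Z)"
    using assms(1) by (simp add: sa_model_def)
  from measurable_compose_Pair1[OF _ this, of t] assms(2) show ?thesis by simp
qed

lemma sa_model_kernel_prob:
  assumes "sa_model \<Theta> Z F P" "t \<in> \<Theta>" "w \<in> Z"
  shows "prob_space (P t w)" "sets (P t w) = sets (borel_on Z)" "space (P t w) = Z"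
proof -
  show 1: "prob_space (P t w)" "sets (P t w) = sets (borel_on Z)"
    using measurable_space[OF sa_model_kernel[OF assms(1,2)], of w] assms(3)
    by (auto simp: space_prob_algebra)
  show "space (P t w) = Z" using sets_eq_imp_space_eq[OF 1(2)] by simp
qed

lemma growth_weight_bound:
  fixes F :: "'a::euclidean_space \<Rightarrow> 'b::euclidean_space \<Rightarrow> 'a"
  assumes "growth_condition \<Theta> Z F"
  obtains CV LV where "0 \<le> CV" "0 \<le> LV"
    "\<And>t w. t \<in> \<Theta> \<Longrightarrow> w \<in> Z \<Longrightarrow> norm (F t w) \<le> CV * weight w"
    "\<And>t t' w. t \<in> \<Theta> \<Longrightarrow> t' \<in> \<Theta> \<Longrightarrow> w \<in> Z \<Longrightarrow>
        norm (F t w - F t' w) \<le> LV * norm (t - t') * weight w"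
proof -
  obtain L C where L: "L > 0" and C: "C > 0"
    and FL: "\<forall>t\<in>\<Theta>. \<forall>t'\<in>\<Theta>. \<forall>w\<in>Z. norm (F t w - F t' w) \<le> L * (1 + norm w) * norm (t - t')"
    and FC: "\<forall>w\<in>Z. \<forall>t\<in>\<Theta>. norm (F t w) \<le> C * (1 + norm w)"
    using assms unfolding growth_condition_def by (elim exE conjE) (rule that; assumption)
  have le: "c * (1 + norm w) \<le> c * (sqrt 2 * weight w)" if "0 \<le> c" for c :: real and w :: 'b
    using U1_le_weight[of w] that by (intro mult_left_mono) (auto simp: U_def)
  show thesis
  proof (rule that[of "C * sqrt 2" "L * sqrt 2"])
    fix t w assume "t \<in> \<Theta>" "w \<in> Z"
    then show "norm (F t w) \<le> C * sqrt 2 * weight w"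
      using FC[rule_format, of w t] le[OF less_imp_le[OF C], of w] by (simp add: mult.assoc)
  next
    show "norm (F t w - F t' w) \<le> L * sqrt 2 * norm (t - t') * weight w"
      if *: "t \<in> \<Theta>" "t' \<in> \<Theta>" "w \<in> Z" for t t' w
    proof -
      have "(L * norm (t - t')) * (1 + norm w) \<le> (L * norm (t - t')) * (sqrt 2 * weight w)"
        using L by (intro le) simp
      then show ?thesis using FL[rule_format, OF *] by (simp add: mult_ac)
    qed
  qed (use C L in auto)
qed

lemma compact_dist_bound:
  fixes s :: "'a::real_normed_vector"
  assumes "compact \<Theta>" and s: "s \<in> \<Theta>"
  obtains d where "0 \<le> d" "\<And>t. t \<in> \<Theta> \<Longrightarrow> norm (t - s) \<le> d"
proof -
  obtain r where r: "\<And>t. t \<in> \<Theta> \<Longrightarrow> norm t \<le> r"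
    using compact_imp_bounded[OF assms(1)] by (auto simp: bounded_iff)
  show thesis
  proof (rule that[of "r + r"])
    show "0 \<le> r + r" using r[OF s] norm_ge_zero[of s] by linarith
    show "norm (t - s) \<le> r + r" if "t \<in> \<Theta>" for t
      using norm_triangle_ineq4[of t s] r[OF s] r[OF that] by linarith
  qed
qed

text \<open>
  The Poisson equation is solved for the scalar family \<open>f\<^sub>t(w) = \<langle>t - s, F t w\<rangle>\<close> instead of the
  vector field.  Its weighted norm is at most a multiple of \<open>\<parallel>t - s\<parallel>\<close>, and linearity of the
  solution operator hands this factor on to \<open>u\<close>.
\<close>

theorem poisson_solution:
  fixes \<Theta> :: "'a::euclidean_space set" and Z :: "'b::euclidean_space set"
  assumes model: "sa_model \<Theta> Z F P" and "compact \<Theta>" and s: "s \<in> \<Theta>"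
    and erg: "ergodic_kernels \<Theta> Z P" and kc: "kernel_continuity \<Theta> Z P"
    and growth: "growth_condition \<Theta> Z F"
  obtains u Cu Lu where
    "(\<lambda>(t, w). u t w) \<in> borel_measurable (borel_on \<Theta> \<Otimes>\<^sub>M borel_on Z)"
    "0 \<le> Cu" "\<And>t w. t \<in> \<Theta> \<Longrightarrow> w \<in> Z \<Longrightarrow> \<bar>u t w\<bar> \<le> Cu * norm (t - s) * weight w"
    "0 \<le> Lu" "\<And>t t' w. t \<in> \<Theta> \<Longrightarrow> t' \<in> \<Theta> \<Longrightarrow> w \<in> Z \<Longrightarrow>
        \<bar>u t w - u t' w\<bar> \<le> Lu * norm (t - t') * weight w"
    "\<And>t w. t \<in> \<Theta> \<Longrightarrow> w \<in> Z \<Longrightarrow>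
        u t w - (\<integral>y. u t y \<partial>P t w) = (t - s) \<bullet> F t w - (t - s) \<bullet> mean_field Z P F t"
proof -
  obtain N W0 \<epsilon> \<phi> \<rho> b where N: "N \<ge> 1" and W0: "W0 \<in> sets (borel_on Z)" "W0 \<noteq> {}" and eps: "\<epsilon> > 0"
    and phi: "\<phi> \<in> space (prob_algebra (borel_on Z))" and rho: "0 \<le> \<rho>" "\<rho> < 1" and b: "0 \<le> b"
    and mi0: "\<forall>t\<in>\<Theta>. \<forall>w\<in>W0. \<forall>E\<in>sets (borel_on Z).
        measure (kernel_pow (borel_on Z) (P t) N w) E \<ge> \<epsilon> * measure \<phi> E"
    and dr0: "\<forall>t\<in>\<Theta>. \<forall>w\<in>Z.
        (\<integral>\<^sup>+y. ennreal (U 2 y) \<partial>P t w) \<le> ennreal (\<rho> * U 2 w + b * indicator W0 w)"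
    using erg unfolding ergodic_kernels_def by (elim conjE exE) (rule that; assumption)
  note mi = mi0[rule_format] and dr = dr0[rule_format]
  obtain LP where LP: "LP > 0" and kc0: "\<forall>t\<in>\<Theta>. \<forall>t'\<in>\<Theta>. \<forall>w\<in>Z. \<forall>f\<in>borel_measurable (borel_on Z).
      (\<forall>y\<in>Z. \<bar>f y\<bar> \<le> U 1 y) \<longrightarrow>
      \<bar>(\<integral>y. f y \<partial>P t w) - (\<integral>y. f y \<partial>P t' w)\<bar> \<le> LP * U 1 w * norm (t - t')"
    using kc unfolding kernel_continuity_def by (elim exE conjE) (rule that; assumption)
  have kcL: "\<bar>(\<integral>y. f y \<partial>P t w) - (\<integral>y. f y \<partial>P t' w)\<bar> \<le> LP * U 1 w * norm (t - t')"
    if "t \<in> \<Theta>" "t' \<in> \<Theta>" "w \<in> Z" "f \<in> borel_measurable (borel_on Z)"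
      "\<And>y. y \<in> Z \<Longrightarrow> \<bar>f y\<bar> \<le> U 1 y" for t t' w f
    using kc0 that by simp
  obtain CV LV where CV: "0 \<le> CV" and LV: "0 \<le> LV"
    and FV: "\<And>t w. t \<in> \<Theta> \<Longrightarrow> w \<in> Z \<Longrightarrow> norm (F t w) \<le> CV * weight w"
    and FLV: "\<And>t t' w. t \<in> \<Theta> \<Longrightarrow> t' \<in> \<Theta> \<Longrightarrow> w \<in> Z \<Longrightarrow>
        norm (F t w - F t' w) \<le> LV * norm (t - t') * weight w"
    by (rule growth_weight_bound[OF growth]) (rule that)
  obtain d where d: "0 \<le> d" "\<And>t. t \<in> \<Theta> \<Longrightarrow> norm (t - s) \<le> d"
    by (rule compact_dist_bound[OF \<open>compact \<Theta>\<close> s]) (rule that)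
  let ?S = "borel_on Z"
  have base: "drift_setup ?S weight W0 \<phi> \<epsilon> (sqrt \<rho>) (sqrt b)"
    using W0 eps phi rho b weight_ge1 by (intro drift_setup.intro weight_measurable) auto
  have kern: "drift_kernel ?S weight W0 \<phi> \<epsilon> (sqrt \<rho>) (sqrt b) N (P t)"
    if t: "t \<in> \<Theta>" for t
  proof (intro drift_kernel.intro base drift_kernel_axioms.intro N sa_model_kernel[OF model t] mi[OF t])
    fix w assume "w \<in> space ?S"
    then have w: "w \<in> Z" by simp
    show "(\<integral>\<^sup>+y. ennreal (weight y) \<partial>P t w) \<le> ennreal (sqrt \<rho> * weight w + sqrt b * indicator W0 w)"
      by (rule sqrt_drift[OF sa_model_kernel_prob(1,2)[OF model t w] dr[OF t w] rho(1) b])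
  qed
  interpret fam: drift_family ?S weight W0 \<phi> \<epsilon> "sqrt \<rho>" "sqrt b" N "borel_on \<Theta>" P
  proof (intro drift_family.intro base drift_family_axioms.intro)
    show "(\<lambda>(t, w). P t w) \<in> borel_on \<Theta> \<Otimes>\<^sub>M borel_on Z \<rightarrow>\<^sub>M prob_algebra (borel_on Z)"
      using model by (simp add: sa_model_def)
  qed (simp add: kern)
  have Fm: "(\<lambda>(t, w). F t w) \<in> borel_measurable (borel_on \<Theta> \<Otimes>\<^sub>M ?S)"
    using model by (simp add: sa_model_def)
  have Ftm: "F t \<in> borel_measurable ?S" if "t \<in> \<Theta>" for t
    using measurable_compose_Pair1[OF _ Fm, of t] that by simp
  define f where "f t w = (t - s) \<bullet> F t w" for t w
  have f_bd: "fam.V_bounded (CV * norm (t - s)) (f t)" if t: "t \<in> \<Theta>" for t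
    unfolding fam.V_bounded_def
  proof (intro conjI ballI)
    show "f t \<in> borel_measurable ?S" unfolding f_def[abs_def] using Ftm[OF t] by measurable
    fix w assume "w \<in> space ?S"
    then have "\<bar>f t w\<bar> \<le> norm (t - s) * (CV * weight w)"
      unfolding f_def using FV[OF t] by (intro order_trans[OF Cauchy_Schwarz_ineq2] mult_left_mono) auto
    then show "\<bar>f t w\<bar> \<le> CV * norm (t - s) * weight w" by (simp add: mult_ac)
  qed
  have f_diff: "fam.V_bounded ((CV + d * LV) * norm (t - t')) (\<lambda>w. f t w - f t' w)"
    if t: "t \<in> \<Theta>" "t' \<in> \<Theta>" for t t'
    unfolding fam.V_bounded_def
  proof (intro conjI ballI)
    show "(\<lambda>w. f t w - f t' w) \<in> borel_measurable ?S"
      using fam.V_bounded_measurable[OF f_bd[OF t(1)]] fam.V_bounded_measurable[OF f_bd[OF t(2)]]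
      by measurable
    fix w assume "w \<in> space ?S"
    then have w: "w \<in> Z" by simp
    have "f t w - f t' w = (t - t') \<bullet> F t w + (t' - s) \<bullet> (F t w - F t' w)"
      by (simp add: f_def algebra_simps)
    then have "\<bar>f t w - f t' w\<bar> \<le> \<bar>(t - t') \<bullet> F t w\<bar> + \<bar>(t' - s) \<bullet> (F t w - F t' w)\<bar>"
      by linarith
    also have "\<dots> \<le> norm (t - t') * (CV * weight w) + d * (LV * norm (t - t') * weight w)"
      using FV[OF t(1) w] FLV[OF t w] d(1) d(2)[OF t(2)]
      by (intro add_mono order_trans[OF Cauchy_Schwarz_ineq2] mult_mono) auto
    finally show "\<bar>f t w - f t' w\<bar> \<le> (CV + d * LV) * norm (t - t') * weight w"
      by (simp add: algebra_simps)
  qed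
  define u where "u t = fam.fpoisson_sol t (f t)" for t
  define poisson_const where "poisson_const = fam.poisson_const N"
  define poisson_lip where "poisson_lip = fam.poisson_lip N"
  have C0: "0 \<le> poisson_const" "0 \<le> poisson_lip"
    using drift_kernel.poisson_const_nonneg[OF kern[OF s]] drift_kernel.poisson_lip_nonneg[OF kern[OF s]]
    by (auto simp: poisson_const_def poisson_lip_def)
  show thesis
  proof (rule that[of u "CV * poisson_const" "poisson_lip * (CV + d * LV + CV * d * (LP * sqrt 2))"])
    have "fam.jointly_meas f" unfolding fam.jointly_meas_def f_def
    proof -
      have 1: "(\<lambda>x. F (fst x) (snd x)) \<in> borel_measurable (borel_on \<Theta> \<Otimes>\<^sub>M ?S)"
        using Fm by (simp add: case_prod_beta')
      have 2: "fst \<in> borel_measurable (borel_on \<Theta> \<Otimes>\<^sub>M ?S)"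
        using measurable_compose[OF measurable_fst measurable_restrict_space1[OF measurable_ident]]
        by (simp add: comp_def)
      show "(\<lambda>(t, w). (t - s) \<bullet> F t w) \<in> borel_measurable (borel_on \<Theta> \<Otimes>\<^sub>M ?S)"
        unfolding case_prod_beta'
        by (intro borel_measurable_inner borel_measurable_diff borel_measurable_const 1 2)
    qed
    from fam.jointly_meas_poisson_sol[OF this] show "(\<lambda>(t, w). u t w) \<in> borel_measurable (borel_on \<Theta> \<Otimes>\<^sub>M ?S)"
      by (simp add: fam.jointly_meas_def u_def)
    show "0 \<le> CV * poisson_const" using CV C0 by simp
    show "0 \<le> poisson_lip * (CV + d * LV + CV * d * (LP * sqrt 2))" using CV LV C0 d LP by simp
  next
    fix t w assume t: "t \<in> \<Theta>" and w: "w \<in> Z"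
    have "\<bar>u t w\<bar> \<le> CV * norm (t - s) * poisson_const * weight w"
      using fam.V_boundedD[OF drift_kernel.V_bounded_poisson_sol[OF kern[OF t] f_bd[OF t]]] w
      by (simp add: u_def poisson_const_def)
    then show "\<bar>u t w\<bar> \<le> CV * poisson_const * norm (t - s) * weight w" by (simp add: mult_ac)
    have fL: "fam.in_LV (f t)" using f_bd[OF t] by (rule fam.in_LVI)
    have mf: "mean_field Z P F t = (\<integral>w. F t w \<partial>drift_kernel.stat ?S W0 \<phi> \<epsilon> (sqrt \<rho>) (sqrt b) N (P t))"
      unfolding mean_field_def drift_kernel.the_stationary[OF kern[OF t]] ..
    let ?stat = "drift_kernel.stat ?S W0 \<phi> \<epsilon> (sqrt \<rho>) (sqrt b) N (P t)"
    have "integrable ?stat (F t)"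
    proof (rule Bochner_Integration.integrable_bound)
      show "integrable ?stat (\<lambda>w. CV * weight w)"
        using drift_kernel.stat_integrable[OF kern[OF t] fam.in_LV_V] by simp
      show "F t \<in> borel_measurable ?stat"
        using Ftm[OF t] drift_kernel.sets_stat[OF kern[OF t]] by (simp cong: measurable_cong_sets)
      show "AE w in ?stat. norm (F t w) \<le> norm (CV * weight w)"
        using FV[OF t] drift_kernel.space_stat[OF kern[OF t]]
        by (intro AE_I2) (auto intro: order_trans[OF _ abs_ge_self])
    qed
    then have "(t - s) \<bullet> mean_field Z P F t = (\<integral>w. f t w \<partial>?stat)"
      unfolding mf f_def by simp
    also have "\<dots> = fam.fstat_mean t (f t)" by (rule drift_kernel.stat_integral[OF kern[OF t] fL])
    finally show "u t w - (\<integral>y. u t y \<partial>P t w) = (t - s) \<bullet> F t w - (t - s) \<bullet> mean_field Z P F t"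
      using drift_kernel.poisson_sol_eq[OF kern[OF t] fL, of w] w
      by (simp add: u_def f_def drift_kernel.A_def[OF kern[OF t]])
  next
    fix t t' w assume t: "t \<in> \<Theta>" and t': "t' \<in> \<Theta>" and w: "w \<in> Z"
    define D where "D = LP * sqrt 2 * norm (t - t')"
    have D0: "0 \<le> D" using LP by (simp add: D_def)
    have "drift_kernel_pair ?S weight W0 \<phi> \<epsilon> (sqrt \<rho>) (sqrt b) N (P t) (P t') D"
    proof (intro drift_kernel_pair.intro drift_kernel_pair_axioms.intro kern t t' D0 fam.drift_setup_axioms)
      fix g y assume g: "fam.V_bounded 1 g" and y: "y \<in> space ?S"
      have "\<bar>g v\<bar> \<le> U 1 v" if "v \<in> Z" for v
        using fam.V_boundedD[OF g, of v] that weight_le_U1[of v] by simp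
      then have "\<bar>(\<integral>v. g v \<partial>P t y) - (\<integral>v. g v \<partial>P t' y)\<bar> \<le> LP * U 1 y * norm (t - t')"
        using y by (intro kcL t t' fam.V_bounded_measurable[OF g]) auto
      also have "\<dots> = LP * norm (t - t') * U 1 y" by simp
      also have "\<dots> \<le> LP * norm (t - t') * (sqrt 2 * weight y)"
        using LP by (intro mult_left_mono U1_le_weight) auto
      finally show "\<bar>drift_kernel.A (P t) g y - drift_kernel.A (P t') g y\<bar> \<le> D * weight y"
        by (simp add: D_def mult_ac drift_kernel.A_def[OF kern[OF t]] drift_kernel.A_def[OF kern[OF t']])
    qed
    from drift_kernel_pair.V_bounded_poisson_sol_diff[OF this fam.in_LVI[OF f_bd[OF t]] f_bd[OF t'] f_diff[OF t t']]
    have "\<bar>u t w - u t' w\<bar> \<le> poisson_lip * ((CV + d * LV) * norm (t - t') + CV * norm (t' - s) * D) * weight w"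
      using w by (auto simp: u_def poisson_lip_def dest!: fam.V_boundedD)
    also have "\<dots> \<le> poisson_lip * ((CV + d * LV) * norm (t - t') + CV * d * D) * weight w"
      using C0 CV D0 d(2)[OF t'] weight_ge1[of w]
      by (intro mult_right_mono mult_left_mono add_left_mono) auto
    also have "\<dots> = poisson_lip * (CV + d * LV + CV * d * (LP * sqrt 2)) * norm (t - t') * weight w"
      by (simp add: D_def algebra_simps)
    finally show "\<bar>u t w - u t' w\<bar> \<le> poisson_lip * (CV + d * LV + CV * d * (LP * sqrt 2)) * norm (t - t') * weight w" .
  qed
qed

section \<open>A Lyapunov function corrected by the Poisson solution\<close>

lemma powr_Suc_le:
  fixes \<kappa> :: real assumes "0 \<le> \<kappa>" "\<kappa> \<le> 1" "1 \<le> k"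
  shows "real (Suc k) powr \<kappa> \<le> real k powr \<kappa> * (1 + \<kappa> / real k)"
proof -
  have k: "0 < real k" using assms by simp
  have "real (Suc k) = real k * (1 + 1 / real k)"
    using k by (simp add: distrib_left)
  then have "real (Suc k) powr \<kappa> = (real k * (1 + 1 / real k)) powr \<kappa>" by (rule arg_cong)
  also have "\<dots> = real k powr \<kappa> * (1 + 1 / real k) powr \<kappa>"
    by (rule powr_mult)
  also have "(1 + 1 / real k) powr \<kappa> \<le> 1 + \<kappa> / real k"
  proof -
    have "(1 + 1 / real k) powr \<kappa> * 1 powr (1 - \<kappa>) \<le> \<kappa> * (1 + 1 / real k) + (1 - \<kappa>) * 1"
      using assms k by (intro Youngs_inequality_0) (auto simp: add_pos_pos)
    then show ?thesis by (simp add: algebra_simps)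
  qed
  finally show ?thesis by (simp add: mult_left_mono)
qed

lemma powr_neg_Suc:
  fixes p :: real assumes "0 \<le> p" "p \<le> 1" "1 \<le> k"
  shows "real k powr (- p) - real (Suc k) powr (- p) \<le> real k powr (- p) / real k"
proof -
  have k: "0 < real k" using assms by simp
  have "real k / real (Suc k) = (real k / real (Suc k)) powr 1" using k by simp
  also have "\<dots> \<le> (real k / real (Suc k)) powr p"
    using assms k by (intro powr_mono') auto
  also have "\<dots> = real (Suc k) powr (- p) / real k powr (- p)"
    using k by (simp add: powr_divide powr_minus field_simps)
  finally have "real k / real (Suc k) * real k powr (- p) \<le> real (Suc k) powr (- p)"
    using k by (simp add: field_simps)
  then have "real k powr (- p) - real (Suc k) powr (- p) \<le> real k powr (- p) * (1 - real k / real (Suc k))"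
    by (simp add: algebra_simps)
  also have "\<dots> \<le> real k powr (- p) * (1 / real k)"
    using k by (intro mult_left_mono) (auto simp: field_simps)
  finally show ?thesis by simp
qed

text \<open>
  What the analysis of one step uses: the Poisson solution \<open>u\<close> with its bounds, the drift of the
  squared weight, and a slack \<open>\<sigma>\<close> by which the contraction \<open>2 \<zeta> \<alpha>\<^sub>k\<close> beats the relative growth
  \<open>\<kappa> / k\<close> of the weights \<open>k\<^sup>\<kappa>\<close>.
\<close>

locale lyapunov =
  fixes \<Theta> :: "'a::euclidean_space set" and Z :: "'b::euclidean_space set" and F :: "'a \<Rightarrow> 'b \<Rightarrow> 'a"
    and P :: "'a \<Rightarrow> 'b \<Rightarrow> 'b measure" and s :: 'a and Fbar :: "'a \<Rightarrow> 'a" and u :: "'a \<Rightarrow> 'b \<Rightarrow> real"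
    and Cu Lu CV \<zeta> \<rho> b \<alpha>0 \<delta> \<kappa> \<sigma> :: real and K :: nat
  assumes conv: "convex \<Theta>" and clos: "closed \<Theta>" and s: "s \<in> \<Theta>"
    and P_prob: "\<And>t w. t \<in> \<Theta> \<Longrightarrow> w \<in> Z \<Longrightarrow> prob_space (P t w)"
    and P_sets: "\<And>t w. t \<in> \<Theta> \<Longrightarrow> w \<in> Z \<Longrightarrow> sets (P t w) = sets (borel_on Z)"
    and u_meas: "\<And>t. t \<in> \<Theta> \<Longrightarrow> u t \<in> borel_measurable (borel_on Z)"
    and Cu: "0 \<le> Cu" and u_bound: "\<And>t w. t \<in> \<Theta> \<Longrightarrow> w \<in> Z \<Longrightarrow> \<bar>u t w\<bar> \<le> Cu * norm (t - s) * weight w"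
    and Lu: "0 \<le> Lu" and u_lip: "\<And>t t' w. t \<in> \<Theta> \<Longrightarrow> t' \<in> \<Theta> \<Longrightarrow> w \<in> Z \<Longrightarrow>
        \<bar>u t w - u t' w\<bar> \<le> Lu * norm (t - t') * weight w"
    and poisson_sol: "\<And>t w. t \<in> \<Theta> \<Longrightarrow> w \<in> Z \<Longrightarrow>
        u t w - (\<integral>y. u t y \<partial>P t w) = (t - s) \<bullet> F t w - (t - s) \<bullet> Fbar t"
    and mono: "\<And>t. t \<in> \<Theta> \<Longrightarrow> (t - s) \<bullet> Fbar t \<le> - \<zeta> * (norm (t - s))\<^sup>2" and zeta: "0 < \<zeta>"
    and CV: "0 \<le> CV" and F_bound: "\<And>t w. t \<in> \<Theta> \<Longrightarrow> w \<in> Z \<Longrightarrow> norm (F t w) \<le> CV * weight w"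
    and rho: "0 \<le> \<rho>" "\<rho> < 1" and b: "0 \<le> b"
    and drift2: "\<And>t w. t \<in> \<Theta> \<Longrightarrow> w \<in> Z \<Longrightarrow>
        (\<integral>\<^sup>+y. ennreal ((weight y)\<^sup>2) \<partial>P t w) \<le> ennreal (\<rho> * (weight w)\<^sup>2 + b)"
    and alpha0: "0 < \<alpha>0" and delta: "\<delta> \<le> 1" and kappa: "0 \<le> \<kappa>" "\<kappa> \<le> 2 * \<delta> - 1"
    and sigma: "0 < \<sigma>" and K: "1 \<le> K"
    and slack: "\<And>k. K \<le> k \<Longrightarrow> \<kappa> + \<sigma> \<le> 2 * \<zeta> * step_size \<alpha>0 \<delta> k * real k"
begin

text \<open>
  In \<open>lyap\<close> the coefficient \<open>a k\<close> makes \<open>u\<close> cancel the noise; \<open>C1\<close> collects the errors of second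
  order, and \<open>Bz\<close> is large enough for the drift to absorb them and for \<open>lyap\<close> to stay nonnegative.
\<close>

definition gain :: "nat \<Rightarrow> real" where "gain k = step_size \<alpha>0 \<delta> k"
definition wt :: "nat \<Rightarrow> real" where "wt k = real k powr \<kappa>"
definition r :: "nat \<Rightarrow> real" where "r k = (gain k)\<^sup>2 * wt k"
definition a :: "nat \<Rightarrow> real" where "a k = 2 * gain k * wt k"
definition Mv :: real where "Mv = sqrt (\<rho> + b)"
definition C1 :: real where
  "C1 = 2 * CV\<^sup>2 + 2 * Lu * CV * Mv + (Cu * (1 + 2 * Mv))\<^sup>2 / \<sigma>"
definition Bz :: real where "Bz = C1 / (1 - \<rho>) + 2 * Cu\<^sup>2"
definition lyap :: "nat \<Rightarrow> 'a \<Rightarrow> 'b \<Rightarrow> real" where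
  "lyap k t w = wt k * (norm (t - s))\<^sup>2 + a k * u t w + Bz * r k * (weight w)\<^sup>2"

lemma gain_eq: "1 \<le> k \<Longrightarrow> gain k = \<alpha>0 * real k powr (- \<delta>)"
  by (simp add: gain_def step_size_def)
lemma gain_pos: "0 < gain k" using alpha0 by (simp add: gain_def step_size_def)
lemma wt_pos: "1 \<le> k \<Longrightarrow> 0 < wt k" by (simp add: wt_def)
lemma r_pos: "1 \<le> k \<Longrightarrow> 0 < r k" using gain_pos[of k] wt_pos[of k] by (simp add: r_def)
lemma a_pos: "1 \<le> k \<Longrightarrow> 0 < a k" using gain_pos[of k] wt_pos[of k] by (simp add: a_def)
lemma r_eq: "1 \<le> k \<Longrightarrow> r k = \<alpha>0\<^sup>2 * real k powr (\<kappa> - 2 * \<delta>)"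
  by (simp add: r_def gain_eq wt_def power_mult_distrib powr_add[symmetric] powr_power mult.assoc algebra_simps)
lemma a_eq: "1 \<le> k \<Longrightarrow> a k = 2 * \<alpha>0 * real k powr (- (\<delta> - \<kappa>))"
  by (simp add: a_def gain_eq wt_def mult.assoc powr_add[symmetric])
lemma kappa1: "\<kappa> \<le> 1" and kd: "0 \<le> \<delta> - \<kappa>" "\<delta> - \<kappa> \<le> 1"
  using kappa delta by linarith+

lemma wt_Suc: "1 \<le> k \<Longrightarrow> wt (Suc k) \<le> wt k * (1 + \<kappa> / real k)"
  unfolding wt_def using powr_Suc_le[of \<kappa> k] kappa kappa1 by simp
lemma wt_mono: "wt k \<le> wt (Suc k)" unfolding wt_def using kappa by (intro powr_mono2) auto
lemma wt_Suc_diff: assumes "1 \<le> k" shows "wt (Suc k) - wt k \<le> wt k / real k"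
proof -
  have "wt k * \<kappa> / real k \<le> wt k * 1 / real k"
    using kappa1 wt_pos[OF assms] by (intro divide_right_mono mult_left_mono) auto
  then show ?thesis using wt_Suc[OF assms] by (simp add: algebra_simps)
qed
lemma wt_Suc2: assumes "1 \<le> k" shows "wt (Suc k) \<le> 2 * wt k"
proof -
  have "wt k / real k \<le> wt k / 1" using assms wt_pos[OF assms] by (intro divide_left_mono) auto
  then show ?thesis using wt_Suc_diff[OF assms] by simp
qed
lemma a_mono: "1 \<le> k \<Longrightarrow> a (Suc k) \<le> a k"
  using alpha0 kd by (simp add: a_eq) (intro powr_mono2', auto)
lemma a_Suc_diff: "1 \<le> k \<Longrightarrow> \<bar>a (Suc k) - a k\<bar> \<le> a k / real k"
  using a_mono[of k] mult_left_mono[OF powr_neg_Suc[OF kd, of k], of "2 * \<alpha>0"] alpha0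
  by (simp add: a_eq algebra_simps del: of_nat_Suc)
lemma r_mono: "1 \<le> k \<Longrightarrow> r (Suc k) \<le> r k"
  using kappa delta by (simp add: r_eq del: of_nat_Suc) (intro mult_left_mono powr_mono2', auto)

lemma Mv_nonneg: "0 \<le> Mv" using rho b by (simp add: Mv_def)
lemma C1_nonneg: "0 \<le> C1" using Lu CV Mv_nonneg sigma by (simp add: C1_def)
lemma Bz_nonneg: "0 \<le> Bz" and Bz_ge: "2 * Cu\<^sup>2 \<le> Bz" and Bz_C1: "C1 + Bz * \<rho> \<le> Bz"
proof -
  have q: "0 \<le> C1 / (1 - \<rho>)" using C1_nonneg rho by simp
  then show "2 * Cu\<^sup>2 \<le> Bz" by (simp add: Bz_def)
  then show "0 \<le> Bz" using zero_le_power2[of Cu] by linarith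
  have "C1 = (1 - \<rho>) * (C1 / (1 - \<rho>))" using rho by simp
  also have "\<dots> \<le> (1 - \<rho>) * Bz" using rho by (intro mult_left_mono) (auto simp: Bz_def)
  finally show "C1 + Bz * \<rho> \<le> Bz" by (simp add: algebra_simps)
qed

text \<open>
  The correction term is dominated by the other two: \<open>\<bar>u\<bar>\<close> carries a factor \<open>\<parallel>t - s\<parallel>\<close>, and
  \<open>2 p q \<le> p\<^sup>2 / 2 + 2 q\<^sup>2\<close>.
\<close>

lemma cross_bound:
  assumes "1 \<le> k" "t \<in> \<Theta>" "w \<in> Z"
  shows "\<bar>a k * u t w\<bar> \<le> wt k * (norm (t - s))\<^sup>2 / 2 + 2 * Cu\<^sup>2 * r k * (weight w)\<^sup>2"
proof -
  let ?x = "norm (t - s)" and ?v = "gain k * Cu * weight w"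
  have "\<bar>a k * u t w\<bar> \<le> a k * (Cu * ?x * weight w)"
    using a_pos[OF assms(1)] u_bound[OF assms(2,3)] by (simp add: abs_mult)
  also have "\<dots> = wt k * (2 * ?x * ?v)" by (simp add: a_def)
  also have "2 * ?x * ?v \<le> ?x\<^sup>2 / 2 + 2 * ?v\<^sup>2"
    using zero_le_power2[of "?x - 2 * ?v"] by (simp add: power2_diff power_mult_distrib field_simps)
  finally show ?thesis
    using wt_pos[OF assms(1)] by (simp add: r_def power_mult_distrib algebra_simps mult_left_mono)
qed

lemma lyap_lower: assumes "1 \<le> k" "t \<in> \<Theta>" "w \<in> Z"
  shows "wt k * (norm (t - s))\<^sup>2 / 2 \<le> lyap k t w"
proof -
  have "2 * Cu\<^sup>2 * (r k * (weight w)\<^sup>2) \<le> Bz * (r k * (weight w)\<^sup>2)"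
    using Bz_ge r_pos[OF assms(1)] by (intro mult_right_mono) auto
  then show ?thesis using cross_bound[OF assms] by (simp add: lyap_def mult.assoc abs_le_iff)
qed
lemma lyap_upper: assumes "1 \<le> k" "t \<in> \<Theta>" "w \<in> Z"
  shows "lyap k t w \<le> 2 * wt k * (norm (t - s))\<^sup>2 + 2 * Bz * r k * (weight w)\<^sup>2"
proof -
  have "2 * Cu\<^sup>2 * (r k * (weight w)\<^sup>2) \<le> Bz * (r k * (weight w)\<^sup>2)"
    using Bz_ge r_pos[OF assms(1)] by (intro mult_right_mono) auto
  moreover have "0 \<le> wt k * (norm (t - s))\<^sup>2" using wt_pos[OF assms(1)] by simp
  ultimately show ?thesis
    using abs_le_D1[OF cross_bound[OF assms]] unfolding lyap_def mult.assoc by linarith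
qed
lemma lyap_nonneg: assumes "1 \<le> k" "t \<in> \<Theta>" "w \<in> Z" shows "0 \<le> lyap k t w"
  using lyap_lower[OF assms] wt_pos[OF assms(1)]
  by (smt (verit) zero_le_mult_iff zero_le_power2 field_sum_of_halves)

lemma V2_int: assumes "t \<in> \<Theta>" "w \<in> Z"
  shows "integrable (P t w) (\<lambda>y. (weight y)\<^sup>2)" "(\<integral>y. (weight y)\<^sup>2 \<partial>P t w) \<le> \<rho> * (weight w)\<^sup>2 + b"
proof -
  have m: "(\<lambda>y. (weight y)\<^sup>2) \<in> borel_measurable (P t w)"
    using P_sets[OF assms] by (simp cong: measurable_cong_sets)
  show i: "integrable (P t w) (\<lambda>y. (weight y)\<^sup>2)"
    using drift2[OF assms] by (intro integrableI_nonneg m) (auto intro: le_less_trans)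
  have "(\<integral>\<^sup>+y. ennreal ((weight y)\<^sup>2) \<partial>P t w) = ennreal (\<integral>y. (weight y)\<^sup>2 \<partial>P t w)"
    by (rule nn_integral_eq_integral[OF i]) simp
  then show "(\<integral>y. (weight y)\<^sup>2 \<partial>P t w) \<le> \<rho> * (weight w)\<^sup>2 + b"
    using drift2[OF assms] rho b by (simp add: ennreal_le_iff del: ennreal_plus)
qed

lemma V_int: assumes "t \<in> \<Theta>" "w \<in> Z"
  shows "integrable (P t w) weight" "(\<integral>y. weight y \<partial>P t w) \<le> Mv * weight w"
proof -
  interpret prob_space "P t w" by (rule P_prob[OF assms])
  have m: "weight \<in> borel_measurable (P t w)"
    using P_sets[OF assms] by (simp cong: measurable_cong_sets)
  show i: "integrable (P t w) weight"
  proof (rule Bochner_Integration.integrable_bound[OF V2_int(1)[OF assms] m], rule AE_I2)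
    show "norm (weight y) \<le> norm ((weight y)\<^sup>2)" for y
      using weight_ge1[of y] by (simp add: power2_eq_square)
  qed
  have "(\<integral>y. weight y \<partial>P t w) \<le> sqrt (\<integral>y. (weight y)\<^sup>2 \<partial>P t w)"
    by (rule expectation_le_sqrt[OF i V2_int(1)[OF assms]])
  also have "\<dots> \<le> sqrt ((\<rho> + b) * (weight w)\<^sup>2)"
  proof (rule real_sqrt_le_mono)
    have "b * 1 \<le> b * (weight w)\<^sup>2" using b weight_ge1[of w] by (intro mult_left_mono one_le_power)
    then show "(\<integral>y. (weight y)\<^sup>2 \<partial>P t w) \<le> (\<rho> + b) * (weight w)\<^sup>2"
      using V2_int(2)[OF assms] by (simp add: distrib_right)
  qed
  also have "\<dots> = Mv * weight w" using weight_ge1[of w] by (simp add: real_sqrt_mult Mv_def)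
  finally show "(\<integral>y. weight y \<partial>P t w) \<le> Mv * weight w" .
qed

lemma bounded_by_weight_int:
  assumes t: "t \<in> \<Theta>" "w \<in> Z" and g: "g \<in> borel_measurable (borel_on Z)" "\<And>y. y \<in> Z \<Longrightarrow> \<bar>g y\<bar> \<le> c * weight y"
  shows "integrable (P t w) g" "\<bar>\<integral>y. g y \<partial>P t w\<bar> \<le> c * (\<integral>y. weight y \<partial>P t w)"
proof -
  have sp: "space (P t w) = Z" using sets_eq_imp_space_eq[OF P_sets[OF t]] by simp
  have ci: "integrable (P t w) (\<lambda>y. c * weight y)" using V_int(1)[OF t] by simp
  show i: "integrable (P t w) g"
  proof (rule Bochner_Integration.integrable_bound[OF ci])
    show "g \<in> borel_measurable (P t w)" using g(1) P_sets[OF t] by (simp cong: measurable_cong_sets)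
    show "AE y in P t w. norm (g y) \<le> norm (c * weight y)"
      using g(2) by (intro AE_I2) (simp add: sp, meson abs_ge_self order_trans)
  qed
  have "\<bar>\<integral>y. g y \<partial>P t w\<bar> \<le> (\<integral>y. \<bar>g y\<bar> \<partial>P t w)"
    by (rule integral_abs_bound)
  also have "\<dots> \<le> (\<integral>y. c * weight y \<partial>P t w)"
    using i ci g(2) by (intro integral_mono) (auto simp: sp)
  finally show "\<bar>\<integral>y. g y \<partial>P t w\<bar> \<le> c * (\<integral>y. weight y \<partial>P t w)"
    by simp
qed

definition next_param :: "nat \<Rightarrow> 'a \<Rightarrow> 'b \<Rightarrow> 'a" where
  "next_param k t w = closest_point \<Theta> (t + gain k *\<^sub>R F t w)"

lemma next_param_in: "next_param k t w \<in> \<Theta>"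
  unfolding next_param_def using clos s by (intro closest_point_in_set) auto

lemma next_param_dist: assumes "p \<in> \<Theta>"
  shows "norm (next_param k t w - p) \<le> norm (t + gain k *\<^sub>R F t w - p)"
  using closest_point_lipschitz[OF conv clos, of "t + gain k *\<^sub>R F t w" p] closest_point_self[OF assms] s
  by (auto simp: next_param_def dist_norm)

text \<open>
  Projection onto \<open>\<Theta>\<close> does not increase the distance to \<open>s\<close>; the inner product with \<open>F\<close> is split by
  the Poisson equation into noise and mean field.
\<close>

lemma next_param_sq:
  assumes t: "t \<in> \<Theta>" and w: "w \<in> Z"
  shows "(norm (next_param k t w - s))\<^sup>2 \<le> (1 - 2 * \<zeta> * gain k) * (norm (t - s))\<^sup>2
      + 2 * gain k * (u t w - (\<integral>y. u t y \<partial>P t w)) + (gain k)\<^sup>2 * CV\<^sup>2 * (weight w)\<^sup>2"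
proof -
  have "(norm (next_param k t w - s))\<^sup>2 \<le> (norm ((t - s) + gain k *\<^sub>R F t w))\<^sup>2"
    using next_param_dist[OF s, of k t w] by (intro power_mono) (auto simp: algebra_simps)
  also have "\<dots> = (norm (t - s))\<^sup>2 + 2 * gain k * ((t - s) \<bullet> F t w) + (gain k)\<^sup>2 * (norm (F t w))\<^sup>2"
    unfolding power2_norm_eq_inner by (simp add: inner_add inner_commute power2_eq_square algebra_simps)
  also have "(t - s) \<bullet> F t w = (u t w - (\<integral>y. u t y \<partial>P t w)) + (t - s) \<bullet> Fbar t"
    using poisson_sol[OF t w] by simp
  finally have *: "(norm (next_param k t w - s))\<^sup>2 \<le> (norm (t - s))\<^sup>2
      + 2 * gain k * ((u t w - (\<integral>y. u t y \<partial>P t w)) + (t - s) \<bullet> Fbar t) + (gain k)\<^sup>2 * (norm (F t w))\<^sup>2" .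
  have "(norm (F t w))\<^sup>2 \<le> (CV * weight w)\<^sup>2" using F_bound[OF t w] by (intro power_mono) auto
  then have 1: "(gain k)\<^sup>2 * (norm (F t w))\<^sup>2 \<le> (gain k)\<^sup>2 * (CV * weight w)\<^sup>2"
    by (intro mult_left_mono) auto
  have 2: "2 * gain k * ((t - s) \<bullet> Fbar t) \<le> 2 * gain k * (- \<zeta> * (norm (t - s))\<^sup>2)"
    using mono[OF t] gain_pos[of k] by (intro mult_left_mono) auto
  show ?thesis using * 1 2 by (simp add: algebra_simps power_mult_distrib)
qed

text \<open>
  The noise \<open>u - P u\<close> of the current step is cancelled against the term \<open>a u\<close>, up to three errors:
  the change of the coefficients, of order \<open>a\<^sub>k / k\<close>, the change of the parameter inside \<open>u\<close>, and the square
  of the update.  The last two are of order \<open>\<alpha>\<^sub>k\<^sup>2 k\<^sup>\<kappa> V\<^sup>2\<close>; the first is split between the contraction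
  slack and such a term.
\<close>

lemma step_bound:
  assumes k: "K \<le> k" and t: "t \<in> \<Theta>" and w: "w \<in> Z"
  shows "(\<integral>y. lyap (Suc k) (next_param k t w) y \<partial>P t w) \<le> lyap k t w + Bz * b * r k"
    and "integrable (P t w) (lyap (Suc k) (next_param k t w))"
proof -
  interpret prob_space "P t w" by (rule P_prob[OF t w])
  have k1: "1 \<le> k" using k K by simp
  then have kp: "0 < real k" by simp
  let ?t = "next_param k t w" and ?x = "norm (t - s)" and ?v = "weight w"
  have t': "?t \<in> \<Theta>" by (rule next_param_in)
  have v1: "1 \<le> ?v" by (rule weight_ge1)
  define EV where "EV = (\<integral>y. weight y \<partial>P t w)"
  have EV: "EV \<le> Mv * ?v" unfolding EV_def by (rule V_int(2)[OF t w])
  define U0 where "U0 = u t w"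
  define PU where "PU = (\<integral>y. u t y \<partial>P t w)"
  define PU' where "PU' = (\<integral>y. u ?t y \<partial>P t w)"
  have iu: "integrable (P t w) (u p)" if "p \<in> \<Theta>" for p
    using bounded_by_weight_int(1)[OF t w u_meas[OF that] u_bound[OF that]] by simp
  have U0: "\<bar>U0\<bar> \<le> Cu * ?x * ?v" unfolding U0_def by (rule u_bound[OF t w])
  have PU: "\<bar>PU\<bar> \<le> Cu * ?x * (Mv * ?v)"
    using bounded_by_weight_int(2)[OF t w u_meas[OF t] u_bound[OF t]] mult_left_mono[OF EV, of "Cu * ?x"] Cu
    unfolding PU_def EV_def by auto
  have move: "norm (?t - t) \<le> gain k * (CV * ?v)"
  proof -
    have "norm (?t - t) \<le> gain k * norm (F t w)"
      using next_param_dist[OF t, of k t w] gain_pos[of k] by simp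
    also have "\<dots> \<le> gain k * (CV * ?v)"
      using F_bound[OF t w] gain_pos[of k] by (intro mult_left_mono) auto
    finally show ?thesis .
  qed
  have D: "\<bar>PU' - PU\<bar> \<le> 2 * Lu * CV * Mv * (gain k * ?v\<^sup>2) / 2"
  proof -
    have "PU' - PU = (\<integral>y. u ?t y - u t y \<partial>P t w)"
      unfolding PU_def PU'_def using iu t t' by simp
    also have "\<bar>\<dots>\<bar> \<le> Lu * norm (?t - t) * (\<integral>y. weight y \<partial>P t w)"
      using u_meas[OF t] u_meas[OF t'] by (intro bounded_by_weight_int(2)[OF t w] u_lip t t') measurable
    also have "\<dots> \<le> Lu * (gain k * (CV * ?v)) * (Mv * ?v)"
      using move EV Lu gain_pos[of k] CV v1 unfolding EV_def
      by (intro mult_mono) (auto intro!: integral_nonneg_AE AE_I2 mult_nonneg_nonneg order_trans[OF zero_le_one weight_ge1])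
    finally show ?thesis by (simp add: power2_eq_square mult_ac)
  qed
  show i: "integrable (P t w) (lyap (Suc k) ?t)"
    unfolding lyap_def[abs_def] using iu[OF t'] V2_int(1)[OF t w] by simp
  have "(\<integral>y. lyap (Suc k) ?t y \<partial>P t w)
      = wt (Suc k) * (norm (?t - s))\<^sup>2 + a (Suc k) * PU' + Bz * r (Suc k) * (\<integral>y. (weight y)\<^sup>2 \<partial>P t w)"
    unfolding lyap_def[abs_def] PU'_def using iu[OF t'] V2_int(1)[OF t w] by (simp add: prob_space)
  also have "\<dots> \<le> wt (Suc k) * ((1 - 2 * \<zeta> * gain k) * ?x\<^sup>2 + 2 * gain k * (U0 - PU) + (gain k)\<^sup>2 * CV\<^sup>2 * ?v\<^sup>2)
      + a (Suc k) * PU' + Bz * r k * (\<rho> * ?v\<^sup>2 + b)"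
  proof (intro add_mono order_refl mult_left_mono mult_mono)
    show "(norm (?t - s))\<^sup>2 \<le> (1 - 2 * \<zeta> * gain k) * ?x\<^sup>2 + 2 * gain k * (U0 - PU) + (gain k)\<^sup>2 * CV\<^sup>2 * ?v\<^sup>2"
      unfolding U0_def PU_def by (rule next_param_sq[OF t w])
    show "(\<integral>y. (weight y)\<^sup>2 \<partial>P t w) \<le> \<rho> * ?v\<^sup>2 + b"
      by (rule V2_int(2)[OF t w])
    show "r (Suc k) \<le> r k" by (rule r_mono[OF k1])
  qed (use Bz_nonneg wt_pos[of "Suc k"] r_pos[OF k1] in \<open>auto intro: less_imp_le\<close>)
  also have "\<dots> = wt (Suc k) * (1 - 2 * \<zeta> * gain k) * ?x\<^sup>2 + a k * U0
      + (2 * gain k * (wt (Suc k) - wt k) * (U0 - PU) + (a (Suc k) - a k) * PU)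
      + wt (Suc k) * (gain k)\<^sup>2 * CV\<^sup>2 * ?v\<^sup>2 + a (Suc k) * (PU' - PU) + Bz * r k * (\<rho> * ?v\<^sup>2 + b)"
    by (simp add: a_def algebra_simps)
  also have "\<dots> \<le> (wt k - wt k * \<sigma> / real k) * ?x\<^sup>2 + a k * U0
      + (wt k * \<sigma> / real k * ?x\<^sup>2 + (Cu * (1 + 2 * Mv))\<^sup>2 / \<sigma> * (r k * ?v\<^sup>2))
      + 2 * CV\<^sup>2 * (r k * ?v\<^sup>2) + 2 * Lu * CV * Mv * (r k * ?v\<^sup>2) + Bz * r k * (\<rho> * ?v\<^sup>2 + b)"
  proof -
    have s1: "wt (Suc k) * (1 - 2 * \<zeta> * gain k) * ?x\<^sup>2 \<le> (wt k - wt k * \<sigma> / real k) * ?x\<^sup>2"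
    proof (intro mult_right_mono zero_le_power2)
      have "wt k * (2 * \<zeta> * gain k) \<le> wt (Suc k) * (2 * \<zeta> * gain k)"
        using wt_mono[of k] zeta gain_pos[of k] by (intro mult_right_mono) auto
      moreover have "wt k * ((\<kappa> + \<sigma>) / real k) \<le> wt k * (2 * \<zeta> * gain k)"
        using slack[OF k] kp wt_pos[OF k1] by (intro mult_left_mono) (auto simp: gain_def field_simps)
      ultimately show "wt (Suc k) * (1 - 2 * \<zeta> * gain k) \<le> wt k - wt k * \<sigma> / real k"
        using wt_Suc[OF k1] by (simp add: algebra_simps add_divide_distrib)
    qed
    have s3: "wt (Suc k) * (gain k)\<^sup>2 * CV\<^sup>2 * ?v\<^sup>2 \<le> 2 * CV\<^sup>2 * (r k * ?v\<^sup>2)"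
      using mult_right_mono[OF wt_Suc2[OF k1], of "(gain k)\<^sup>2 * CV\<^sup>2 * ?v\<^sup>2"]
      by (simp add: r_def mult_ac)
    have s4: "a (Suc k) * (PU' - PU) \<le> 2 * Lu * CV * Mv * (r k * ?v\<^sup>2)"
    proof -
      have "a (Suc k) * (PU' - PU) \<le> a k * \<bar>PU' - PU\<bar>"
        using a_mono[OF k1] a_pos[of "Suc k"]
        by (intro order_trans[OF mult_left_mono[OF abs_ge_self] mult_right_mono]) auto
      also have "\<dots> \<le> a k * (2 * Lu * CV * Mv * (gain k * ?v\<^sup>2) / 2)"
        using D a_pos[OF k1] by (intro mult_left_mono) auto
      also have "\<dots> = 2 * Lu * CV * Mv * (r k * ?v\<^sup>2)"
        by (simp add: a_def r_def power2_eq_square)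
      finally show ?thesis .
    qed
    have s2: "2 * gain k * (wt (Suc k) - wt k) * (U0 - PU) + (a (Suc k) - a k) * PU
        \<le> wt k * \<sigma> / real k * ?x\<^sup>2 + (Cu * (1 + 2 * Mv))\<^sup>2 / \<sigma> * (r k * ?v\<^sup>2)"
    proof -
      have "2 * gain k * (wt (Suc k) - wt k) \<le> a k / real k"
        using mult_left_mono[OF wt_Suc_diff[OF k1], of "2 * gain k"] gain_pos[of k] by (simp add: a_def)
      then have 1: "2 * gain k * (wt (Suc k) - wt k) * (U0 - PU) \<le> a k / real k * (\<bar>U0\<bar> + \<bar>PU\<bar>)"
        using wt_mono[of k] gain_pos[of k]
        by (intro order_trans[OF mult_left_mono[of "U0 - PU" "\<bar>U0\<bar> + \<bar>PU\<bar>"] mult_right_mono]) auto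
      have 2: "(a (Suc k) - a k) * PU \<le> a k / real k * \<bar>PU\<bar>"
        using mult_right_mono[OF a_Suc_diff[OF k1], of "\<bar>PU\<bar>"] abs_ge_self[of "(a (Suc k) - a k) * PU"]
        by (simp add: abs_mult)
      (* Split by 2 x y <= sigma x^2 + y^2 / sigma, so that the first part fits into the contraction slack. *)
      define q where "q = Cu * (1 + 2 * Mv)"
      have "a k / real k * (\<bar>U0\<bar> + 2 * \<bar>PU\<bar>) \<le> a k / real k * (Cu * ?x * ?v + 2 * (Cu * ?x * (Mv * ?v)))"
        using U0 PU a_pos[OF k1] kp by (intro mult_left_mono add_mono) auto
      also have "\<dots> = wt k / real k * (2 * ?x * (q * (gain k * ?v)))"
        by (simp add: a_def q_def algebra_simps)
      also have "\<dots> \<le> wt k / real k * (\<sigma> * ?x\<^sup>2 + q\<^sup>2 / \<sigma> * (gain k * ?v)\<^sup>2)"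
      proof (intro mult_left_mono)
        have "0 \<le> (\<sigma> * ?x - q * (gain k * ?v))\<^sup>2 / \<sigma>" using sigma by simp
        then show "2 * ?x * (q * (gain k * ?v)) \<le> \<sigma> * ?x\<^sup>2 + q\<^sup>2 / \<sigma> * (gain k * ?v)\<^sup>2"
          using sigma by (simp add: power2_diff power_mult_distrib field_simps power2_eq_square)
      qed (use wt_pos[OF k1] kp in auto)
      also have "\<dots> = wt k * \<sigma> / real k * ?x\<^sup>2 + q\<^sup>2 / \<sigma> * (r k * ?v\<^sup>2) / real k"
        by (simp add: r_def power_mult_distrib algebra_simps)
      also have "\<dots> \<le> wt k * \<sigma> / real k * ?x\<^sup>2 + q\<^sup>2 / \<sigma> * (r k * ?v\<^sup>2) / 1"
        using k1 sigma r_pos[OF k1] by (intro add_left_mono divide_left_mono) auto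
      finally have 3: "a k / real k * (\<bar>U0\<bar> + 2 * \<bar>PU\<bar>)
          \<le> wt k * \<sigma> / real k * ?x\<^sup>2 + q\<^sup>2 / \<sigma> * (r k * ?v\<^sup>2)" by simp
      have "a k / real k * (\<bar>U0\<bar> + 2 * \<bar>PU\<bar>) = a k / real k * (\<bar>U0\<bar> + \<bar>PU\<bar>) + a k / real k * \<bar>PU\<bar>"
        by (simp only: distrib_left mult_2 add.assoc)
      with 1 2 3 show ?thesis unfolding q_def by linarith
    qed
    show ?thesis
      by (rule add_mono[OF add_mono[OF add_mono[OF add_mono[OF add_mono[OF s1 order_refl] s2] s3] s4] order_refl])
  qed
  also have "\<dots> = wt k * ?x\<^sup>2 + a k * U0 + (C1 + Bz * \<rho>) * (r k * ?v\<^sup>2) + Bz * b * r k"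
    by (simp add: C1_def algebra_simps)
  also have "\<dots> \<le> wt k * ?x\<^sup>2 + a k * U0 + Bz * (r k * ?v\<^sup>2) + Bz * b * r k"
    using Bz_C1 r_pos[OF k1] by (intro add_right_mono add_left_mono mult_right_mono) auto
  finally show "(\<integral>y. lyap (Suc k) ?t y \<partial>P t w) \<le> lyap k t w + Bz * b * r k"
    by (simp add: lyap_def U0_def mult.assoc)
qed

lemma nn_step_bound:
  assumes k: "K \<le> k" and t: "t \<in> \<Theta>" and w: "w \<in> Z"
  shows "(\<integral>\<^sup>+y. ennreal (lyap (Suc k) (next_param k t w) y) \<partial>P t w) \<le> ennreal (lyap k t w + Bz * b * r k)"
proof -
  have sp: "space (P t w) = Z" using sets_eq_imp_space_eq[OF P_sets[OF t w]] by simp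
  have "(\<integral>\<^sup>+y. ennreal (lyap (Suc k) (next_param k t w) y) \<partial>P t w) = ennreal (\<integral>y. lyap (Suc k) (next_param k t w) y \<partial>P t w)"
    using lyap_nonneg[OF _ next_param_in]
    by (intro nn_integral_eq_integral step_bound(2)[OF k t w] AE_I2) (auto simp: sp)
  also have "\<dots> \<le> ennreal (lyap k t w + Bz * b * r k)" by (intro ennreal_leI step_bound(1)[OF k t w])
  finally show ?thesis .
qed

end

section \<open>Supermartingale estimates along the process\<close>

text \<open>
  Ville's inequality.  By induction on \<open>n\<close>, the mass that has crossed the level \<open>h\<close> up to time \<open>n\<close>,
  multiplied by \<open>h\<close>, plus the integral of \<open>Y n\<close> over the part that has not crossed, stays below the initial
  integral.
\<close>

lemma nonneg_supermartingale_maximal: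
  fixes Y :: "nat \<Rightarrow> 'c \<Rightarrow> ennreal"
  assumes sub: "\<And>n. subalgebra M (F n)" and filt: "\<And>i j. i \<le> j \<Longrightarrow> sets (F i) \<subseteq> sets (F j)"
    and Y: "\<And>n. Y n \<in> borel_measurable (F n)"
    and super: "\<And>n C. k0 \<le> n \<Longrightarrow> C \<in> sets (F n) \<Longrightarrow>
        (\<integral>\<^sup>+\<omega>\<in>C. Y (Suc n) \<omega> \<partial>M) \<le> (\<integral>\<^sup>+\<omega>\<in>C. Y n \<omega> \<partial>M)"
    and A: "A \<in> sets (F k0)"
  shows "h * emeasure M {\<omega>\<in>A. \<exists>n\<ge>k0. h < Y n \<omega>} \<le> (\<integral>\<^sup>+\<omega>\<in>A. Y k0 \<omega> \<partial>M)"
proof -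
  have inM: "C \<in> sets M" if "C \<in> sets (F n)" for C n using sub[of n] that
    by (auto simp: subalgebra_def)
  have sp: "space (F n) = space M" for n using sub[of n] by (simp add: subalgebra_def)
  have YM: "Y n \<in> borel_measurable M" for n using measurable_from_subalg[OF sub Y] .
  define Gd where "Gd n = {\<omega>\<in>A. \<forall>k\<in>{k0..n}. Y k \<omega> \<le> h}" for n
  define Bd where "Bd n = {\<omega>\<in>A. \<exists>k\<in>{k0..n}. h < Y k \<omega>}" for n
  have AF: "A \<in> sets (F n)" if "k0 \<le> n" for n using filt[OF that] A by auto
  have Ykn: "Y k \<in> borel_measurable (F n)" if "k \<le> n" for k n
    by (rule measurable_from_subalg[OF _ Y[of k]]) (use filt[OF that] in \<open>simp add: subalgebra_def sp\<close>)
  have Gd: "Gd n \<in> sets (F n)" if n: "k0 \<le> n" for n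
  proof -
    have "Gd n = A \<inter> (\<Inter>k\<in>{k0..n}. {\<omega>\<in>space (F n). Y k \<omega> \<le> h})"
      using sets.sets_into_space[OF AF[OF n]] n unfolding Gd_def by auto
    moreover have "{\<omega>\<in>space (F n). Y k \<omega> \<le> h} \<in> sets (F n)"
      if "k \<in> {k0..n}" for k
    proof -
      have [measurable]: "Y k \<in> borel_measurable (F n)" using that by (intro Ykn) simp
      show ?thesis by measurable
    qed
    ultimately show ?thesis using AF[OF n] n by (auto intro!: sets.Int sets.finite_INT)
  qed
  have BdG: "Bd n = A - Gd n" for n unfolding Bd_def Gd_def by (auto simp: not_le)
  have BdM: "Bd n \<in> sets M" if "k0 \<le> n" for n
    using inM[OF AF[OF that]] inM[OF Gd[OF that]] by (auto simp: BdG)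
  have main: "h * emeasure M (Bd n) + (\<integral>\<^sup>+\<omega>\<in>Gd n. Y n \<omega> \<partial>M) \<le> (\<integral>\<^sup>+\<omega>\<in>A. Y k0 \<omega> \<partial>M)"
    if "k0 \<le> n" for n
    using that
  proof (induction n rule: dec_induct)
    case base
    have "h * emeasure M (Bd k0) = (\<integral>\<^sup>+\<omega>\<in>Bd k0. h \<partial>M)"
      using BdM[of k0] by (simp add: nn_integral_cmult_indicator)
    also have "\<dots> \<le> (\<integral>\<^sup>+\<omega>\<in>Bd k0. Y k0 \<omega> \<partial>M)"
      by (intro nn_integral_mono) (auto simp: Bd_def indicator_def)
    finally have "h * emeasure M (Bd k0) + (\<integral>\<^sup>+\<omega>\<in>Gd k0. Y k0 \<omega> \<partial>M)
        \<le> (\<integral>\<^sup>+\<omega>\<in>Bd k0. Y k0 \<omega> \<partial>M) + (\<integral>\<^sup>+\<omega>\<in>Gd k0. Y k0 \<omega> \<partial>M)" by (rule add_right_mono)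
    also have "\<dots> = (\<integral>\<^sup>+\<omega>. Y k0 \<omega> * indicator (Bd k0) \<omega> + Y k0 \<omega> * indicator (Gd k0) \<omega> \<partial>M)"
      using YM BdM[of k0] inM[OF Gd[of k0]] by (intro nn_integral_add[symmetric]) auto
    also have "\<dots> = (\<integral>\<^sup>+\<omega>\<in>A. Y k0 \<omega> \<partial>M)"
      by (intro nn_integral_cong) (auto simp: BdG Gd_def indicator_def)
    finally show ?case .
  next
    case (step n)
    let ?N = "Gd n - Gd (Suc n)"
    have N: "?N \<in> sets M" using inM[OF Gd[of n]] inM[OF Gd[of "Suc n"]] step by auto
    have sub': "Gd (Suc n) \<subseteq> Gd n" unfolding Gd_def by auto
    have NY: "h \<le> Y (Suc n) \<omega>" if om: "\<omega> \<in> ?N" for \<omega>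
    proof -
      obtain k where k: "k0 \<le> k" "k \<le> Suc n" "h < Y k \<omega>" and le: "\<forall>j\<in>{k0..n}. Y j \<omega> \<le> h"
        using om by (auto simp: Gd_def not_le)
      have "\<not> k \<le> n" using k le by (auto simp: not_le[symmetric])
      then have "k = Suc n" using k by simp
      then show ?thesis using k by simp
    qed
    have "Bd (Suc n) = Bd n \<union> ?N" "Bd n \<inter> ?N = {}"
      using sub' unfolding BdG Gd_def by auto
    then have "emeasure M (Bd (Suc n)) = emeasure M (Bd n) + emeasure M ?N"
      using plus_emeasure[OF BdM[of n] N] step by simp
    then have "h * emeasure M (Bd (Suc n)) + (\<integral>\<^sup>+\<omega>\<in>Gd (Suc n). Y (Suc n) \<omega> \<partial>M)
        = h * emeasure M (Bd n) + (h * emeasure M ?N + (\<integral>\<^sup>+\<omega>\<in>Gd (Suc n). Y (Suc n) \<omega> \<partial>M))"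
      by (simp add: distrib_left add.assoc)
    also have "h * emeasure M ?N = (\<integral>\<^sup>+\<omega>\<in>?N. h \<partial>M)"
      using N by (simp add: nn_integral_cmult_indicator)
    also have "\<dots> \<le> (\<integral>\<^sup>+\<omega>\<in>?N. Y (Suc n) \<omega> \<partial>M)"
      using NY by (intro nn_integral_mono) (auto simp: indicator_def)
    also have "(\<integral>\<^sup>+\<omega>\<in>?N. Y (Suc n) \<omega> \<partial>M) + (\<integral>\<^sup>+\<omega>\<in>Gd (Suc n). Y (Suc n) \<omega> \<partial>M)
        = (\<integral>\<^sup>+\<omega>. Y (Suc n) \<omega> * indicator ?N \<omega> + Y (Suc n) \<omega> * indicator (Gd (Suc n)) \<omega> \<partial>M)"
      using YM N inM[OF Gd[of "Suc n"]] step by (intro nn_integral_add[symmetric]) auto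
    also have "\<dots> = (\<integral>\<^sup>+\<omega>\<in>Gd n. Y (Suc n) \<omega> \<partial>M)"
      using sub' by (intro nn_integral_cong) (auto simp: indicator_def)
    also have "\<dots> \<le> (\<integral>\<^sup>+\<omega>\<in>Gd n. Y n \<omega> \<partial>M)"
      using step(1) by (intro super Gd)
    also have "h * emeasure M (Bd n) + \<dots> \<le> (\<integral>\<^sup>+\<omega>\<in>A. Y k0 \<omega> \<partial>M)"
      by (rule step.IH)
    finally show ?case by (simp add: add_left_mono)
  qed
  have "{\<omega>\<in>A. \<exists>n\<ge>k0. h < Y n \<omega>} = (\<Union>j. Bd (k0 + j))"
  proof (intro set_eqI iffI)
    fix \<omega> assume "\<omega> \<in> {\<omega>\<in>A. \<exists>n\<ge>k0. h < Y n \<omega>}"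
    then obtain n where "\<omega> \<in> A" "k0 \<le> n" "h < Y n \<omega>" by auto
    then have "\<omega> \<in> Bd (k0 + (n - k0))" unfolding Bd_def by auto
    then show "\<omega> \<in> (\<Union>j. Bd (k0 + j))" by blast
  qed (auto simp: Bd_def)
  moreover have "incseq (\<lambda>j. Bd (k0 + j))" unfolding Bd_def incseq_def by force
  ultimately have "emeasure M {\<omega>\<in>A. \<exists>n\<ge>k0. h < Y n \<omega>} = (SUP j. emeasure M (Bd (k0 + j)))"
    using BdM by (subst SUP_emeasure_incseq) auto
  then have "h * emeasure M {\<omega>\<in>A. \<exists>n\<ge>k0. h < Y n \<omega>} = (SUP j. h * emeasure M (Bd (k0 + j)))"
    by (simp add: SUP_mult_left_ennreal)
  also have "\<dots> \<le> (\<integral>\<^sup>+\<omega>\<in>A. Y k0 \<omega> \<partial>M)"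
  proof (rule SUP_least)
    fix j
    have "h * emeasure M (Bd (k0 + j)) \<le> h * emeasure M (Bd (k0 + j)) + (\<integral>\<^sup>+\<omega>\<in>Gd (k0 + j). Y (k0 + j) \<omega> \<partial>M)"
      by simp
    also have "\<dots> \<le> (\<integral>\<^sup>+\<omega>\<in>A. Y k0 \<omega> \<partial>M)"
      by (rule main) simp
    finally show "h * emeasure M (Bd (k0 + j)) \<le> (\<integral>\<^sup>+\<omega>\<in>A. Y k0 \<omega> \<partial>M)" .
  qed
  finally show ?thesis .
qed

locale sa_chain =
  fixes M :: "'c measure" and \<Theta> :: "'a::euclidean_space set" and Z :: "'b::euclidean_space set"
    and F :: "'a \<Rightarrow> 'b \<Rightarrow> 'a" and P :: "'a \<Rightarrow> 'b \<Rightarrow> 'b measure" and \<alpha> :: "nat \<Rightarrow> real"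
    and \<theta> :: "nat \<Rightarrow> 'c \<Rightarrow> 'a" and W :: "nat \<Rightarrow> 'c \<Rightarrow> 'b"
  assumes model: "sa_model \<Theta> Z F P" and process: "sa_process M \<Theta> Z F P \<alpha> \<theta> W"
begin

abbreviation "hist k \<equiv> history M \<theta> W k"

lemma prob_M: "prob_space M" using process by (simp add: sa_process_def)
lemma theta_meas: "\<theta> k \<in> M \<rightarrow>\<^sub>M borel_on \<Theta>" and W_meas: "W k \<in> M \<rightarrow>\<^sub>M borel_on Z"
  using process by (auto simp: sa_process_def)
lemma theta_borel: "\<theta> k \<in> borel_measurable M" and W_borel: "W k \<in> borel_measurable M"
  using theta_meas[of k] W_meas[of k] by (auto simp: measurable_restrict_space2_iff)
lemma theta_in: "\<omega> \<in> space M \<Longrightarrow> \<theta> k \<omega> \<in> \<Theta>" and W_in: "\<omega> \<in> space M \<Longrightarrow> W k \<omega> \<in> Z"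
  using measurable_space[OF theta_meas] measurable_space[OF W_meas] by auto
lemma hist_sub: "subalgebra M (hist k)"
  by (intro subalgebra_history theta_borel W_borel)
lemma hist_in_M: "C \<in> sets (hist k) \<Longrightarrow> C \<in> sets M"
  using hist_sub[of k] by (auto simp: subalgebra_def)
lemma theta_hist: "i \<le> k \<Longrightarrow> \<theta> i \<in> hist k \<rightarrow>\<^sub>M borel_on \<Theta>"
  and W_hist: "i \<le> k \<Longrightarrow> W i \<in> hist k \<rightarrow>\<^sub>M borel_on Z"
  using theta_in W_in by (auto simp: measurable_restrict_space2_iff history_measurable)

text \<open>
  The Markov property in the form used below: given the history, integrate out the next state.
\<close>

lemma markov_step:
  assumes H: "H \<in> borel_measurable (hist k \<Otimes>\<^sub>M borel_on Z)"
  shows "(\<integral>\<^sup>+\<omega>. H (\<omega>, W (Suc k) \<omega>) \<partial>M) = (\<integral>\<^sup>+\<omega>. \<integral>\<^sup>+y. H (\<omega>, y) \<partial>P (\<theta> k \<omega>) (W k \<omega>) \<partial>M)"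
proof (rule nn_integral_conditional_law[OF prob_M hist_sub W_meas _ _ H])
  have "(\<lambda>(\<theta>, w). P \<theta> w) \<in> borel_on \<Theta> \<Otimes>\<^sub>M borel_on Z \<rightarrow>\<^sub>M prob_algebra (borel_on Z)"
    using model by (simp add: sa_model_def)
  from measurable_compose[OF measurable_Pair[OF theta_hist[OF order_refl] W_hist[OF order_refl]] this]
  show "(\<lambda>\<omega>. P (\<theta> k \<omega>) (W k \<omega>)) \<in> hist k \<rightarrow>\<^sub>M prob_algebra (borel_on Z)"
    by simp
  show "AE \<omega> in M. real_cond_exp M (hist k) (indicator (W (Suc k) -` E \<inter> space M)) \<omega>
      = measure (P (\<theta> k \<omega>) (W k \<omega>)) E" if "E \<in> sets (borel_on Z)" for E
    using process that unfolding sa_process_def cond_prob_given_def by blast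
qed

lemma indicator_fst_meas:
  "C \<in> sets (hist k) \<Longrightarrow> (\<lambda>x. indicator C (fst x) :: ennreal) \<in> borel_measurable (hist k \<Otimes>\<^sub>M borel_on Z)"
  by (rule measurable_compose[OF measurable_fst]) simp

text \<open>
  Bounds for \<open>E A X\<close> by a multiple of \<open>E A (V2 0)\<close> that hold for all events \<open>A\<close> of time \<open>0\<close> amount to
  bounds for the conditional expectation of \<open>X\<close> given \<open>F\<^sub>0\<close> by a multiple of \<open>U 2 (W 0)\<close>.
\<close>

definition E :: "'c set \<Rightarrow> ('c \<Rightarrow> real) \<Rightarrow> ennreal" where
  "E A X = (\<integral>\<^sup>+\<omega>\<in>A. ennreal (X \<omega>) \<partial>M)"

definition V2 :: "nat \<Rightarrow> 'c \<Rightarrow> real" where "V2 k \<omega> = (weight (W k \<omega>))\<^sup>2"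

definition dominated :: "'c set \<Rightarrow> real \<Rightarrow> ennreal \<Rightarrow> bool" where
  "dominated A c x \<longleftrightarrow> 0 \<le> c \<and> x \<le> ennreal c * E A (V2 0)"

lemma V2_meas[measurable]: "V2 k \<in> borel_measurable M"
  unfolding V2_def using measurable_compose[OF W_meas weight_measurable] by measurable
lemma V2_ge1: "1 \<le> V2 k \<omega>" unfolding V2_def using weight_ge1 by (rule one_le_power)

lemma E_le_linear:
  assumes [measurable]: "A \<in> sets M" "Y1 \<in> borel_measurable M" "Y2 \<in> borel_measurable M"
    and c: "0 \<le> c1" "0 \<le> c2" and Y: "\<And>\<omega>. \<omega> \<in> A \<Longrightarrow> 0 \<le> Y1 \<omega>" "\<And>\<omega>. \<omega> \<in> A \<Longrightarrow> 0 \<le> Y2 \<omega>"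
    and le: "\<And>\<omega>. \<omega> \<in> A \<Longrightarrow> X \<omega> \<le> c1 * Y1 \<omega> + c2 * Y2 \<omega>"
  shows "E A X \<le> ennreal c1 * E A Y1 + ennreal c2 * E A Y2"
proof -
  have "E A X \<le> (\<integral>\<^sup>+\<omega>. ennreal c1 * (ennreal (Y1 \<omega>) * indicator A \<omega>)
      + ennreal c2 * (ennreal (Y2 \<omega>) * indicator A \<omega>) \<partial>M)"
    unfolding E_def
  proof (rule nn_integral_mono)
    fix \<omega>
    show "ennreal (X \<omega>) * indicator A \<omega> \<le> ennreal c1 * (ennreal (Y1 \<omega>) * indicator A \<omega>)
        + ennreal c2 * (ennreal (Y2 \<omega>) * indicator A \<omega>)"
      using c Y[of \<omega>] ennreal_leI[OF le[of \<omega>]]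
      by (cases "\<omega> \<in> A") (auto simp: ennreal_mult ennreal_plus)
  qed
  also have "\<dots> = ennreal c1 * E A Y1 + ennreal c2 * E A Y2"
    unfolding E_def by (subst nn_integral_add) (measurable, simp add: nn_integral_cmult)
  finally show ?thesis .
qed

lemma E_add_const:
  assumes [measurable]: "A \<in> sets M" "X \<in> borel_measurable M"
    and "\<And>\<omega>. \<omega> \<in> A \<Longrightarrow> 0 \<le> X \<omega>" "0 \<le> c"
  shows "E A (\<lambda>\<omega>. X \<omega> + c) = E A X + ennreal c * emeasure M A"
proof -
  have "E A (\<lambda>\<omega>. X \<omega> + c) = (\<integral>\<^sup>+\<omega>. ennreal (X \<omega>) * indicator A \<omega> + ennreal c * indicator A \<omega> \<partial>M)"
    unfolding E_def using assms by (intro nn_integral_cong) (auto simp: indicator_def ennreal_plus)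
  also have "\<dots> = E A X + ennreal c * emeasure M A"
    unfolding E_def by (subst nn_integral_add) (measurable, simp add: nn_integral_cmult_indicator)
  finally show ?thesis .
qed

lemma dominated_add: "dominated A c x \<Longrightarrow> dominated A e y \<Longrightarrow> dominated A (c + e) (x + y)"
  unfolding dominated_def by (auto simp: ennreal_plus distrib_right intro: add_mono)
lemma dominated_scale: assumes "dominated A c x" "0 \<le> e" shows "dominated A (e * c) (ennreal e * x)"
  using assms mult_left_mono[of x "ennreal c * E A (V2 0)" "ennreal e"]
  unfolding dominated_def by (auto simp: ennreal_mult mult.assoc)
lemma dominated_mono: assumes "dominated A c x" "c \<le> e" "y \<le> x" shows "dominated A e y"
  using assms mult_right_mono[OF ennreal_leI[OF assms(2)], of "E A (V2 0)"]
  unfolding dominated_def by (auto intro: order_trans)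
lemma dominated_V2_0: "dominated A 1 (E A (V2 0))" by (simp add: dominated_def)
lemma dominated_emeasure: assumes A: "A \<in> sets M" shows "dominated A 1 (emeasure M A)"
proof -
  have "emeasure M A = E A (\<lambda>_. 1)" using A by (simp add: E_def)
  also have "\<dots> \<le> E A (V2 0)"
    unfolding E_def by (intro nn_integral_mono mult_right_mono ennreal_leI V2_ge1) auto
  finally show ?thesis by (simp add: dominated_def)
qed

lemma second_moment_step:
  assumes dr: "\<And>t w. t \<in> \<Theta> \<Longrightarrow> w \<in> Z \<Longrightarrow>
        (\<integral>\<^sup>+y. ennreal ((weight y)\<^sup>2) \<partial>P t w) \<le> ennreal (\<rho> * (weight w)\<^sup>2 + b)"
    and C: "C \<in> sets (hist k)"
  shows "E C (V2 (Suc k)) \<le> E C (\<lambda>\<omega>. \<rho> * V2 k \<omega> + b)"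
proof -
  let ?H = "\<lambda>x. ennreal ((weight (snd x))\<^sup>2) * indicator C (fst x)"
  have m: "?H \<in> borel_measurable (hist k \<Otimes>\<^sub>M borel_on Z)"
    by (intro borel_measurable_times_ennreal indicator_fst_meas C measurable_compose[OF measurable_snd]) measurable
  have "E C (V2 (Suc k)) = (\<integral>\<^sup>+\<omega>. \<integral>\<^sup>+y. ennreal ((weight y)\<^sup>2) * indicator C \<omega> \<partial>P (\<theta> k \<omega>) (W k \<omega>) \<partial>M)"
    using markov_step[OF m] by (simp add: E_def V2_def)
  also have "\<dots> \<le> E C (\<lambda>\<omega>. \<rho> * V2 k \<omega> + b)"
    unfolding E_def V2_def
  proof (rule nn_integral_mono)
    fix \<omega> assume "\<omega> \<in> space M"
    then have "\<theta> k \<omega> \<in> \<Theta>" "W k \<omega> \<in> Z" by (auto intro: theta_in W_in)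
    then show "(\<integral>\<^sup>+y. ennreal ((weight y)\<^sup>2) * indicator C \<omega> \<partial>P (\<theta> k \<omega>) (W k \<omega>))
        \<le> ennreal (\<rho> * (weight (W k \<omega>))\<^sup>2 + b) * indicator C \<omega>"
      using dr[of "\<theta> k \<omega>" "W k \<omega>"] by (cases "\<omega> \<in> C") simp_all
  qed
  finally show ?thesis .
qed

lemma second_moment:
  assumes dr: "\<And>t w. t \<in> \<Theta> \<Longrightarrow> w \<in> Z \<Longrightarrow>
        (\<integral>\<^sup>+y. ennreal ((weight y)\<^sup>2) \<partial>P t w) \<le> ennreal (\<rho> * (weight w)\<^sup>2 + b)"
    and rho: "0 \<le> \<rho>" "\<rho> < 1" and b: "0 \<le> b" and A: "A \<in> sets (hist 0)"
  shows "dominated A (1 + b / (1 - \<rho>)) (E A (V2 k))"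
proof (induction k)
  case 0
  show ?case using rho b by (intro dominated_mono[OF dominated_V2_0]) auto
next
  case (Suc k)
  have AM: "A \<in> sets M" using A by (rule hist_in_M)
  have "E A (V2 (Suc k)) \<le> E A (\<lambda>\<omega>. \<rho> * V2 k \<omega> + b)"
    using A history_mono[of 0 k] by (intro second_moment_step dr) auto
  also have "\<dots> \<le> ennreal \<rho> * E A (V2 k) + ennreal b * E A (V2 0)"
    using b mult_left_mono[OF V2_ge1, of b] rho
    by (intro E_le_linear AM V2_meas order_trans[OF zero_le_one V2_ge1]) auto
  finally have "E A (V2 (Suc k)) \<le> ennreal \<rho> * E A (V2 k) + ennreal b * E A (V2 0)" .
  moreover have "\<rho> * (1 + b / (1 - \<rho>)) + b * 1 \<le> 1 + b / (1 - \<rho>)"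
  proof -
    have "\<rho> * (1 + b / (1 - \<rho>)) + b = \<rho> + b / (1 - \<rho>)"
      using rho by (simp add: field_simps)
    then show ?thesis using rho by simp
  qed
  ultimately show ?case
    by (intro dominated_mono[OF dominated_add[OF dominated_scale[OF Suc rho(1)] dominated_scale[OF dominated_V2_0 b]]])
qed

end

locale lyapunov_chain =
  lyapunov \<Theta> Z F P s Fbar u Cu Lu CV \<zeta> \<rho> b \<alpha>0 \<delta> \<kappa> \<sigma> K + sa_chain M \<Theta> Z F P "step_size \<alpha>0 \<delta>" \<theta> W
  for \<Theta> :: "'a::euclidean_space set" and Z :: "'b::euclidean_space set" and F :: "'a \<Rightarrow> 'b \<Rightarrow> 'a"
    and P :: "'a \<Rightarrow> 'b \<Rightarrow> 'b measure" and s :: 'a and Fbar :: "'a \<Rightarrow> 'a" and u :: "'a \<Rightarrow> 'b \<Rightarrow> real"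
    and Cu Lu CV \<zeta> \<rho> b \<alpha>0 \<delta> \<kappa> \<sigma> :: real and K :: nat
    and M :: "'c measure" and \<theta> :: "nat \<Rightarrow> 'c \<Rightarrow> 'a" and W :: "nat \<Rightarrow> 'c \<Rightarrow> 'b" +
  fixes d :: real
  assumes u_joint: "(\<lambda>(t, w). u t w) \<in> borel_measurable (borel_on \<Theta> \<Otimes>\<^sub>M borel_on Z)"
    and d: "\<And>t. t \<in> \<Theta> \<Longrightarrow> norm (t - s) \<le> d"
begin

definition lyap_at :: "nat \<Rightarrow> 'c \<Rightarrow> real" where "lyap_at k \<omega> = lyap k (\<theta> k \<omega>) (W k \<omega>)"
lemma lyap_joint: "(\<lambda>x. lyap k (fst x) (snd x)) \<in> borel_measurable (borel_on \<Theta> \<Otimes>\<^sub>M borel_on Z)"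
proof -
  have [measurable]: "(\<lambda>x. u (fst x) (snd x)) \<in> borel_measurable (borel_on \<Theta> \<Otimes>\<^sub>M borel_on Z)"
    using u_joint by (simp add: case_prod_beta')
  have 1: "(\<lambda>t. norm (t - s)) \<in> borel_measurable (borel_on \<Theta>)"
    by (intro measurable_restrict_space1) measurable
  have [measurable]: "(\<lambda>x. norm (fst x - s)) \<in> borel_measurable (borel_on \<Theta> \<Otimes>\<^sub>M borel_on Z)"
    by (rule measurable_compose[OF measurable_fst 1])
  show ?thesis unfolding lyap_def by measurable
qed

lemma lyap_at_hist: "lyap_at k \<in> borel_measurable (hist k)"
  using measurable_compose[OF measurable_Pair[OF theta_hist[OF order_refl] W_hist[OF order_refl]] lyap_joint, of k k]
  by (simp add: lyap_at_def[abs_def])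
lemma lyap_at_meas[measurable]: "lyap_at k \<in> borel_measurable M"
  by (rule measurable_from_subalg[OF hist_sub lyap_at_hist])

lemma next_param_hist: "(\<lambda>\<omega>. next_param k (\<theta> k \<omega>) (W k \<omega>)) \<in> hist k \<rightarrow>\<^sub>M borel_on \<Theta>"
proof -
  have cp: "closest_point \<Theta> \<in> borel_measurable borel"
    using s by (intro borel_measurable_continuous_onI continuous_on_closest_point conv clos) auto
  have Fm: "(\<lambda>(t, w). F t w) \<in> borel_measurable (borel_on \<Theta> \<Otimes>\<^sub>M borel_on Z)"
    using model by (simp add: sa_model_def)
  have [measurable]: "(\<lambda>\<omega>. F (\<theta> k \<omega>) (W k \<omega>)) \<in> borel_measurable (hist k)"
    using measurable_compose[OF measurable_Pair[OF theta_hist[OF order_refl] W_hist[OF order_refl]] Fm]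
    by simp
  have [measurable]: "\<theta> k \<in> borel_measurable (hist k)" by (rule history_measurable) simp
  have "(\<lambda>\<omega>. \<theta> k \<omega> + gain k *\<^sub>R F (\<theta> k \<omega>) (W k \<omega>)) \<in> borel_measurable (hist k)"
    by measurable
  from measurable_compose[OF this cp] show ?thesis
    using next_param_in by (auto simp: measurable_restrict_space2_iff next_param_def[abs_def])
qed


text \<open>
  The Lyapunov function is a supermartingale up to the increments \<open>Bz * b * r k\<close>.
\<close>

lemma lyap_at_step:
  assumes k: "K \<le> k" and C: "C \<in> sets (hist k)"
  shows "E C (lyap_at (Suc k)) \<le> E C (\<lambda>\<omega>. lyap_at k \<omega> + Bz * b * r k)"
proof -
  let ?n = "\<lambda>\<omega>. next_param k (\<theta> k \<omega>) (W k \<omega>)"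
  let ?H = "\<lambda>x. ennreal (lyap (Suc k) (?n (fst x)) (snd x)) * indicator C (fst x)"
  have "(\<lambda>x. lyap (Suc k) (?n (fst x)) (snd x)) \<in> borel_measurable (hist k \<Otimes>\<^sub>M borel_on Z)"
    using measurable_compose[OF measurable_Pair[OF measurable_compose[OF measurable_fst next_param_hist] measurable_snd] lyap_joint]
    by simp
  then have m: "?H \<in> borel_measurable (hist k \<Otimes>\<^sub>M borel_on Z)"
    by (intro borel_measurable_times_ennreal indicator_fst_meas C measurable_compose[OF _ measurable_ennreal])
  have "AE \<omega> in M. \<theta> (Suc k) \<omega> = ?n \<omega>"
    using process by (simp add: sa_process_def next_param_def gain_def)
  then have "E C (lyap_at (Suc k)) = (\<integral>\<^sup>+\<omega>. ?H (\<omega>, W (Suc k) \<omega>) \<partial>M)"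
    unfolding E_def by (intro nn_integral_cong_AE) (auto simp: lyap_at_def)
  also have "\<dots> = (\<integral>\<^sup>+\<omega>. \<integral>\<^sup>+y. ennreal (lyap (Suc k) (?n \<omega>) y) * indicator C \<omega> \<partial>P (\<theta> k \<omega>) (W k \<omega>) \<partial>M)"
    using markov_step[OF m] by simp
  also have "\<dots> \<le> E C (\<lambda>\<omega>. lyap_at k \<omega> + Bz * b * r k)"
    unfolding E_def
  proof (rule nn_integral_mono)
    fix \<omega> assume "\<omega> \<in> space M"
    then have "\<theta> k \<omega> \<in> \<Theta>" "W k \<omega> \<in> Z" by (auto intro: theta_in W_in)
    then show "(\<integral>\<^sup>+y. ennreal (lyap (Suc k) (?n \<omega>) y) * indicator C \<omega> \<partial>P (\<theta> k \<omega>) (W k \<omega>))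
        \<le> ennreal (lyap_at k \<omega> + Bz * b * r k) * indicator C \<omega>"
      using nn_step_bound[OF k, of "\<theta> k \<omega>" "W k \<omega>"]
      by (cases "\<omega> \<in> C") (simp_all add: lyap_at_def)
  qed
  finally show ?thesis .
qed

lemma lyap_at_nonneg: "1 \<le> k \<Longrightarrow> \<omega> \<in> space M \<Longrightarrow> 0 \<le> lyap_at k \<omega>"
  unfolding lyap_at_def by (intro lyap_nonneg theta_in W_in)

definition sq_dist :: "nat \<Rightarrow> 'c \<Rightarrow> real" where "sq_dist k \<omega> = (norm (\<theta> k \<omega> - s))\<^sup>2"
definition Cm :: real where "Cm = 1 + b / (1 - \<rho>)"

lemma sq_dist_meas[measurable]: "sq_dist k \<in> borel_measurable M"
  unfolding sq_dist_def using theta_borel[of k] by measurable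
lemma Cm_nonneg: "0 \<le> Cm" using rho b by (simp add: Cm_def)
lemma dominated_V2: "A \<in> sets (hist 0) \<Longrightarrow> dominated A Cm (E A (V2 k))"
  unfolding Cm_def by (rule second_moment[OF drift2 rho b])
lemma lyap_at_increment_nonneg: "1 \<le> k \<Longrightarrow> 0 \<le> Bz * b * r k"
  using Bz_nonneg b r_pos[of k] by simp

lemma in_hist0: assumes "A \<in> sets (hist 0)"
  shows "A \<in> sets M" "A \<subseteq> space M" "A \<in> sets (hist k)"
  using hist_in_M[OF assms] sets.sets_into_space[OF hist_in_M[OF assms]]
    subsetD[OF history_mono[OF le0] assms] by auto

lemma lyap_at_le:
  assumes k: "1 \<le> k" and A: "A \<in> sets (hist 0)" and e: "dominated A e (E A (sq_dist k))"
  shows "dominated A (2 * wt k * e + 2 * Bz * r k * Cm) (E A (lyap_at k))"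
proof -
  have c: "0 \<le> 2 * wt k" "0 \<le> 2 * Bz * r k" using wt_pos[OF k] r_pos[OF k] Bz_nonneg by auto
  have "E A (lyap_at k) \<le> ennreal (2 * wt k) * E A (sq_dist k) + ennreal (2 * Bz * r k) * E A (V2 k)"
  proof (intro E_le_linear in_hist0[OF A] sq_dist_meas V2_meas c)
    fix \<omega> assume "\<omega> \<in> A"
    then have "\<theta> k \<omega> \<in> \<Theta>" "W k \<omega> \<in> Z"
      using in_hist0(2)[OF A] by (auto intro: theta_in W_in)
    then show "lyap_at k \<omega> \<le> 2 * wt k * sq_dist k \<omega> + 2 * Bz * r k * V2 k \<omega>"
      unfolding lyap_at_def sq_dist_def V2_def by (rule lyap_upper[OF k])
  qed (auto simp: sq_dist_def V2_def)
  then show ?thesis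
    by (rule dominated_mono[OF dominated_add[OF dominated_scale[OF e c(1)] dominated_scale[OF dominated_V2[OF A] c(2)]] order_refl])
qed

lemma lyap_at_moment:
  assumes n: "K \<le> n" and A: "A \<in> sets (hist 0)"
  shows "dominated A (2 * wt K * d\<^sup>2 + 2 * Bz * r K * Cm + Bz * b * (\<Sum>k=K..<n. r k)) (E A (lyap_at n))"
  using n
proof (induction n rule: dec_induct)
  case base
  have "E A (sq_dist K) \<le> E A (\<lambda>_. d\<^sup>2)"
    unfolding E_def sq_dist_def using d[OF theta_in]
      by (intro nn_integral_mono mult_right_mono ennreal_leI power_mono) auto
  also have "\<dots> = ennreal (d\<^sup>2) * emeasure M A"
    unfolding E_def using in_hist0[OF A] by (simp add: nn_integral_cmult_indicator)
  finally have "dominated A (d\<^sup>2 * 1) (E A (sq_dist K))"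
    by (rule dominated_mono[OF dominated_scale[OF dominated_emeasure[OF in_hist0(1)[OF A]] zero_le_power2] order_refl])
  from lyap_at_le[OF K A this] show ?case by simp
next
  case (step n)
  have n1: "1 \<le> n" using step K by simp
  have "E A (lyap_at (Suc n)) \<le> E A (\<lambda>\<omega>. lyap_at n \<omega> + Bz * b * r n)"
    using step by (intro lyap_at_step in_hist0[OF A]) auto
  also have "\<dots> = E A (lyap_at n) + ennreal (Bz * b * r n) * emeasure M A"
    using lyap_at_nonneg[OF n1] in_hist0(2)[OF A]
    by (intro E_add_const in_hist0[OF A] lyap_at_meas lyap_at_increment_nonneg n1) auto
  finally have *: "E A (lyap_at (Suc n)) \<le> E A (lyap_at n) + ennreal (Bz * b * r n) * emeasure M A" .
  show ?case
    by (rule dominated_mono[OF dominated_add[OF step.IH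
          dominated_scale[OF dominated_emeasure[OF in_hist0(1)[OF A]] lyap_at_increment_nonneg[OF n1]]] _ *])
       (use step(1) in \<open>simp add: algebra_simps\<close>)
qed

text \<open>
  Adding a deterministic sequence \<open>t\<close> that decreases by at least the increments makes a true
  supermartingale, to which the maximal inequality applies.
\<close>

lemma exceedance_bound:
  assumes k0: "K \<le> k0" and A: "A \<in> sets (hist 0)" and h: "0 \<le> h"
    and t: "\<And>k. k0 \<le> k \<Longrightarrow> 0 \<le> t k" "\<And>k. k0 \<le> k \<Longrightarrow> t (Suc k) + Bz * b * r k \<le> t k"
    and q: "dominated A q (E A (lyap_at k0))"
  shows "dominated A (q + t k0) (ennreal h * emeasure M {\<omega>\<in>A. \<exists>k\<ge>k0. h < lyap_at k \<omega>})"
proof -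
  have k01: "1 \<le> k0" using k0 K by simp
  note [measurable] = in_hist0(1)[OF A]
  let ?Y = "\<lambda>k \<omega>. lyap_at k \<omega> + t k"
  have meas: "{\<omega>\<in>A. \<exists>n\<ge>k0. ennreal h < ennreal (?Y n \<omega>)} \<in> sets M"
  proof -
    have "{\<omega>\<in>A. \<exists>n\<ge>k0. ennreal h < ennreal (?Y n \<omega>)} = A \<inter> {\<omega>\<in>space M. \<exists>n\<ge>k0. ennreal h < ennreal (?Y n \<omega>)}"
      using in_hist0(2)[OF A] by auto
    then show ?thesis by simp
  qed
  have "ennreal h * emeasure M {\<omega>\<in>A. \<exists>k\<ge>k0. h < lyap_at k \<omega>}
      \<le> ennreal h * emeasure M {\<omega>\<in>A. \<exists>n\<ge>k0. ennreal h < ennreal (?Y n \<omega>)}"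
  proof (intro mult_left_mono emeasure_mono meas Collect_mono impI, elim conjE exE, intro conjI exI)
    fix \<omega> k assume "k0 \<le> k" "h < lyap_at k \<omega>"
    then show "ennreal h < ennreal (?Y k \<omega>)" using t(1)[of k] h by (subst ennreal_less_iff) auto
  qed auto
  also have "\<dots> \<le> E A (?Y k0)"
    unfolding E_def
  proof (rule nonneg_supermartingale_maximal[where F = hist])
    show "(\<lambda>\<omega>. ennreal (?Y n \<omega>)) \<in> borel_measurable (hist n)" for n using lyap_at_hist[of n]
      by measurable
    show "A \<in> sets (hist k0)" using in_hist0(3)[OF A] .
    show "(\<integral>\<^sup>+\<omega>\<in>C. ennreal (?Y (Suc n) \<omega>) \<partial>M) \<le> (\<integral>\<^sup>+\<omega>\<in>C. ennreal (?Y n \<omega>) \<partial>M)"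
      if n: "k0 \<le> n" and C: "C \<in> sets (hist n)" for n C
    proof -
      have n1: "1 \<le> n" using n k01 by simp
      have CM: "C \<in> sets M" "C \<subseteq> space M" using hist_in_M[OF C] sets.sets_into_space by auto
      have t0: "0 \<le> t (Suc n)" using t(1) n by simp
      have pos: "0 \<le> lyap_at n \<omega>" "0 \<le> lyap_at (Suc n) \<omega>"
        if "\<omega> \<in> C" for \<omega>
        using lyap_at_nonneg[OF n1] lyap_at_nonneg[of "Suc n"] CM that by auto
      have "E C (?Y (Suc n)) = E C (lyap_at (Suc n)) + ennreal (t (Suc n)) * emeasure M C"
        using pos by (intro E_add_const CM lyap_at_meas t0)
      also have "\<dots> \<le> E C (\<lambda>\<omega>. lyap_at n \<omega> + Bz * b * r n) + ennreal (t (Suc n)) * emeasure M C"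
        using k0 n by (intro add_right_mono lyap_at_step C) auto
      also have "\<dots> = E C (\<lambda>\<omega>. lyap_at n \<omega> + Bz * b * r n + t (Suc n))"
        using pos lyap_at_increment_nonneg[OF n1] by (intro E_add_const[symmetric] CM t0) auto
      also have "\<dots> \<le> E C (?Y n)"
        unfolding E_def using t(2)[OF n] by (intro nn_integral_mono mult_right_mono ennreal_leI) auto
      finally show ?thesis unfolding E_def .
    qed
    show "subalgebra M (hist n)" for n by (rule hist_sub)
    show "sets (hist i) \<subseteq> sets (hist j)" if "i \<le> j" for i j using that by (rule history_mono)
  qed
  also have "\<dots> = E A (lyap_at k0) + ennreal (t k0) * emeasure M A"
    using lyap_at_nonneg[OF k01] in_hist0(2)[OF A] by (intro E_add_const in_hist0[OF A] lyap_at_meas t) auto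
  finally have *: "ennreal h * emeasure M {\<omega>\<in>A. \<exists>k\<ge>k0. h < lyap_at k \<omega>} \<le> E A (lyap_at k0) + ennreal (t k0) * emeasure M A" .
  show ?thesis
    by (rule dominated_mono[OF dominated_add[OF q dominated_scale[OF dominated_emeasure[OF in_hist0(1)[OF A]] t(1)[OF order_refl]]] _ *]) simp
qed

lemma dist_moment:
  assumes k: "1 \<le> k" and A: "A \<in> sets (hist 0)" and q: "dominated A q (E A (lyap_at k))"
  shows "dominated A (2 / wt k * q) (E A (sq_dist k))"
proof -
  have w: "0 < wt k" using k by (rule wt_pos)
  have "E A (sq_dist k) \<le> ennreal (2 / wt k) * E A (lyap_at k) + ennreal 0 * E A (lyap_at k)"
  proof (intro E_le_linear in_hist0[OF A] lyap_at_meas)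
    fix \<omega> assume "\<omega> \<in> A"
    then have in_sp: "\<omega> \<in> space M" using in_hist0(2)[OF A] by auto
    then show "0 \<le> lyap_at k \<omega>" "0 \<le> lyap_at k \<omega>" by (rule lyap_at_nonneg[OF k])+
    have "wt k * sq_dist k \<omega> / 2 \<le> lyap_at k \<omega>"
      unfolding lyap_at_def sq_dist_def using in_sp by (intro lyap_lower k theta_in W_in)
    then show "sq_dist k \<omega> \<le> 2 / wt k * lyap_at k \<omega> + 0 * lyap_at k \<omega>"
      using w by (simp add: field_simps)
  qed (use w in auto)
  then have "E A (sq_dist k) \<le> ennreal (2 / wt k) * E A (lyap_at k)" by simp
  then show ?thesis using w by (intro dominated_mono[OF dominated_scale[OF q]]) auto
qed

end

section \<open>The exceedance probability\<close>

text \<open>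
  Test the hypothesis on the event where the claimed bound fails.
\<close>

lemma real_cond_exp_indicator_lower_bound:
  assumes M: "prob_space M" and sub: "subalgebra M F" and S: "S \<in> sets M"
    and g: "g \<in> borel_measurable F" "integrable M g"
    and le: "\<And>A. A \<in> sets F \<Longrightarrow> measure M (A - S) \<le> (\<integral>\<omega>\<in>A. g \<omega> \<partial>M)"
  shows "AE \<omega> in M. 1 - g \<omega> \<le> real_cond_exp M F (indicator S) \<omega>"
proof -
  interpret prob_space M by (rule M)
  interpret finite_measure_subalgebra M F by standard (rule sub)
  let ?e = "real_cond_exp M F (indicator S)"
  have Si: "integrable M (indicator S :: _ \<Rightarrow> real)"
    using S by (rule integrable_real_indicator) (simp add: less_top[symmetric])
  have ei: "integrable M ?e" using Si by (rule real_cond_exp_int)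
  have spF: "space F = space M" using sub by (simp add: subalgebra_def)
  define A where "A = {\<omega>\<in>space F. ?e \<omega> < 1 - g \<omega>}"
  have AF: "A \<in> sets F" unfolding A_def using g(1) by measurable
  then have AM: "A \<in> sets M" using sub by (auto simp: subalgebra_def)
  have si: "integrable M (\<lambda>\<omega>. indicator A \<omega> * f \<omega>)"
    if "integrable M f" for f :: "_ \<Rightarrow> real"
    using integrable_mult_indicator[OF AM that] by simp
  have "(\<integral>\<omega>. indicator A \<omega> * ?e \<omega> \<partial>M) = (\<integral>\<omega>. indicator A \<omega> * indicator S \<omega> \<partial>M)"
    using real_cond_exp_intA[OF Si AF] by (simp add: set_lebesgue_integral_def)
  also have "\<dots> = measure M (A \<inter> S)" using AM S by (simp flip: indicator_inter_arith)
  also have "\<dots> = measure M A - measure M (A - S)"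
    using finite_measure_Diff'[OF AM S] by simp
  finally have e: "(\<integral>\<omega>. indicator A \<omega> * ?e \<omega> \<partial>M) \<ge> measure M A - (\<integral>\<omega>. indicator A \<omega> * g \<omega> \<partial>M)"
    using le[OF AF] by (simp add: set_lebesgue_integral_def)
  let ?f = "\<lambda>\<omega>. indicator A \<omega> * (1 - g \<omega> - ?e \<omega>)"
  have fi: "integrable M ?f" using ei g(2) by (intro si) auto
  have nn: "0 \<le> ?f \<omega>" for \<omega> by (simp add: indicator_def A_def)
  have iA: "integrable M (indicator A :: _ \<Rightarrow> real)"
    using AM by (rule integrable_real_indicator) (simp add: less_top[symmetric])
  have "(\<integral>\<omega>. ?f \<omega> \<partial>M) = (\<integral>\<omega>. indicator A \<omega> - indicator A \<omega> * g \<omega> - indicator A \<omega> * ?e \<omega> \<partial>M)"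
    by (simp add: algebra_simps)
  also have "\<dots> = measure M A - (\<integral>\<omega>. indicator A \<omega> * g \<omega> \<partial>M) - (\<integral>\<omega>. indicator A \<omega> * ?e \<omega> \<partial>M)"
    using si[OF g(2)] si[OF ei] iA AM by simp
  finally have "(\<integral>\<omega>. ?f \<omega> \<partial>M) \<le> 0" using e by simp
  moreover have "0 \<le> (\<integral>\<omega>. ?f \<omega> \<partial>M)"
    using nn by (intro integral_nonneg_AE) auto
  ultimately have "(\<integral>\<omega>. ?f \<omega> \<partial>M) = 0" by simp
  then have "AE \<omega> in M. ?f \<omega> = 0" using integral_nonneg_eq_0_iff_AE[OF fi] nn by simp
  with AE_space show ?thesis
    by eventually_elim (auto simp: indicator_def A_def spF split: if_splits)
qed

text \<open>
  The sequence \<open>k\<^bsup>-p\<^esup>\<close> serves as an explicit substitute for the tail sums of \<open>k\<^bsup>-p-1\<^esup>\<close>.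
\<close>

lemma powr_neg_increment:
  fixes p :: real assumes p: "0 < p" "p \<le> 1" and k: "1 \<le> k"
  shows "real (Suc k) powr (- p) + p / 2 * real k powr (- p - 1) \<le> real k powr (- p)"
proof -
  have k0: "0 < real k" using k by simp
  let ?x = "real k / real (Suc k)"
  have "?x powr p * 1 powr (1 - p) \<le> p * ?x + (1 - p) * 1"
    using p k0 by (intro Youngs_inequality_0) auto
  then have "?x powr p \<le> 1 - p / real (Suc k)" by (simp add: field_simps)
  also have "\<dots> \<le> 1 - p / (2 * real k)"
    using p k by (intro diff_left_mono divide_left_mono) auto
  finally have x: "?x powr p \<le> 1 - p / (2 * real k)" .
  have "real (Suc k) powr (- p) = real k powr (- p) * ?x powr p"
    using k0 by (simp add: powr_divide powr_minus field_simps)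
  also have "\<dots> \<le> real k powr (- p) * (1 - p / (2 * real k))" using x by (intro mult_left_mono) auto
  also have "\<dots> = real k powr (- p) - p / 2 * (real k powr (- p) / real k)" by (simp add: algebra_simps)
  also have "real k powr (- p) / real k = real k powr (- p - 1)" using k0 by (simp add: powr_diff)
  finally show ?thesis by simp
qed

lemma sum_inverse_le_ln:
  assumes "1 \<le> K" "K \<le> n" shows "(\<Sum>k=K..<n. 1 / real k) \<le> 2 * ln (real n)"
  using assms(2)
proof (induction n rule: dec_induct)
  case base then show ?case using assms(1) by simp
next
  case (step n)
  have n: "0 < real n" using step assms(1) by simp
  have "ln (real n / real (Suc n)) \<le> real n / real (Suc n) - 1" using n by (intro ln_le_minus_one) auto
  also have "\<dots> = - 1 / real (Suc n)" by (simp add: field_simps)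
  also have "\<dots> \<le> - 1 / (2 * real n)" using n step assms(1) by (simp add: field_simps)
  finally have "1 / real n \<le> 2 * (ln (real (Suc n)) - ln (real n))"
    using n by (simp add: ln_div field_simps del: of_nat_Suc)
  then show ?case using step by (simp del: of_nat_Suc)
qed

text \<open>
  For \<open>\<delta> < 1\<close> the product \<open>\<alpha>\<^sub>k k\<close> tends to infinity; for \<open>\<delta> = 1\<close> it is \<open>\<alpha>\<^sub>0\<close>, and the slack is
  \<open>2 \<zeta> \<alpha>\<^sub>0 - 1\<close>.
\<close>

lemma slack_exists:
  assumes "0 < \<alpha>0" "0 < \<zeta>" "\<delta> \<le> 1" "\<delta> = 1 \<Longrightarrow> 2 * \<zeta> * \<alpha>0 > 1" and kappa: "\<kappa> \<le> 2 * \<delta> - 1"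
  obtains \<sigma> K where "0 < \<sigma>" "1 \<le> K"
    "\<And>k. K \<le> k \<Longrightarrow> \<kappa> + \<sigma> \<le> 2 * \<zeta> * step_size \<alpha>0 \<delta> k * real k"
proof (cases "\<delta> = 1")
  case True
  show thesis
  proof (rule that[of "2 * \<zeta> * \<alpha>0 - 1" 1])
    fix k :: nat assume "1 \<le> k"
    then have "step_size \<alpha>0 \<delta> k * real k = \<alpha>0"
      using True by (simp add: step_size_def powr_minus)
    then have eq: "2 * \<zeta> * step_size \<alpha>0 \<delta> k * real k = 2 * \<zeta> * \<alpha>0"
      by (simp only: mult.assoc)
    show "\<kappa> + (2 * \<zeta> * \<alpha>0 - 1) \<le> 2 * \<zeta> * step_size \<alpha>0 \<delta> k * real k"
      unfolding eq using kappa True by simp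
  qed (use assms True in auto)
next
  case False
  then have d: "0 < 1 - \<delta>" using assms by simp
  define B where "B = (1 / (\<zeta> * \<alpha>0)) powr (1 / (1 - \<delta>))"
  obtain K0 :: nat where K0: "B \<le> real K0" using real_arch_simple by blast
  show thesis
  proof (rule that[of 1 "max 1 K0"])
    fix k assume k: "max 1 K0 \<le> k"
    then have kp: "0 < real k" by simp
    have "1 / (\<zeta> * \<alpha>0) = B powr (1 - \<delta>)" using d assms by (simp add: B_def powr_powr)
    also have "\<dots> \<le> real k powr (1 - \<delta>)" using K0 k d by (intro powr_mono2) (auto simp: B_def)
    finally have "1 \<le> \<zeta> * \<alpha>0 * real k powr (1 - \<delta>)"
      using assms by (simp add: field_simps)
    also have "real k powr (1 - \<delta>) = real k powr (- \<delta>) * real k"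
      using kp by (simp add: powr_diff powr_minus field_simps)
    finally have "2 \<le> 2 * \<zeta> * step_size \<alpha>0 \<delta> k * real k"
      using kp by (simp add: step_size_def mult_ac)
    then show "\<kappa> + 1 \<le> 2 * \<zeta> * step_size \<alpha>0 \<delta> k * real k"
      using kappa assms(3) by linarith
  qed auto
qed

text \<open>
  The exponent \<open>2 \<delta> - 1\<close> yields the moment bound at time \<open>n\<close>, which starts the maximal inequality
  for the exponent \<open>2 \<beta>\<close>.
\<close>

lemma exceedance_estimate:
  fixes M :: "'c measure" and \<Theta> :: "'a::euclidean_space set" and Z :: "'b::euclidean_space set"
    and F :: "'a \<Rightarrow> 'b \<Rightarrow> 'a" and P :: "'a \<Rightarrow> 'b \<Rightarrow> 'b measure"
    and \<theta> :: "nat \<Rightarrow> 'c \<Rightarrow> 'a" and W :: "nat \<Rightarrow> 'c \<Rightarrow> 'b" and s :: 'a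
  assumes model: "sa_model \<Theta> Z F P" and process: "sa_process M \<Theta> Z F P (step_size \<alpha>0 \<delta>) \<theta> W"
    and a0: "0 < \<alpha>0" and delta: "1/2 < \<delta>" "\<delta> \<le> 1"
    and comp: "compact \<Theta>" "convex \<Theta>" and s: "s \<in> \<Theta>"
    and erg: "ergodic_kernels \<Theta> Z P" and kc: "kernel_continuity \<Theta> Z P"
    and growth: "growth_condition \<Theta> Z F"
    and monotone: "quasi_strongly_monotone \<Theta> (mean_field Z P F) s \<zeta>"
    and critical: "\<delta> = 1 \<Longrightarrow> 2 * \<zeta> * \<alpha>0 > 1"
    and beta: "0 \<le> \<beta>" "\<beta> < \<delta> - 1/2" and c: "0 < c"
  obtains C K where "0 < C" "1 \<le> K"
    "\<And>n A. K \<le> n \<Longrightarrow> A \<in> sets (history M \<theta> W 0) \<Longrightarrow>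
      emeasure M {\<omega>\<in>A. \<exists>k\<ge>n. c * real k powr (- \<beta>) < norm (\<theta> k \<omega> - s)}
      \<le> ennreal (C * (1 + ln (real n))\<^sup>2 * real n powr (- (2 * (\<delta> - \<beta>) - 1)))
         * (\<integral>\<^sup>+\<omega>\<in>A. ennreal (U 2 (W 0 \<omega>)) \<partial>M)"
proof -
  obtain u Cu Lu where
    u_joint: "(\<lambda>(t, w). u t w) \<in> borel_measurable (borel_on \<Theta> \<Otimes>\<^sub>M borel_on Z)"
    and Cu: "0 \<le> Cu" "\<And>t w. t \<in> \<Theta> \<Longrightarrow> w \<in> Z \<Longrightarrow> \<bar>u t w\<bar> \<le> Cu * norm (t - s) * weight w"
    and Lu: "0 \<le> Lu" "\<And>t t' w. t \<in> \<Theta> \<Longrightarrow> t' \<in> \<Theta> \<Longrightarrow> w \<in> Z \<Longrightarrow>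
        \<bar>u t w - u t' w\<bar> \<le> Lu * norm (t - t') * weight w"
    and poisson_sol: "\<And>t w. t \<in> \<Theta> \<Longrightarrow> w \<in> Z \<Longrightarrow>
        u t w - (\<integral>y. u t y \<partial>P t w) = (t - s) \<bullet> F t w - (t - s) \<bullet> mean_field Z P F t"
    using poisson_solution[OF model comp(1) s erg kc growth] by blast
  obtain W0 \<rho> b where rho: "0 \<le> \<rho>" "\<rho> < 1" and b: "0 \<le> b"
    and dr0: "\<forall>t\<in>\<Theta>. \<forall>w\<in>Z. (\<integral>\<^sup>+y. ennreal (U 2 y) \<partial>P t w) \<le> ennreal (\<rho> * U 2 w + b * indicator W0 w)"
    using erg unfolding ergodic_kernels_def by (elim conjE exE) (rule that; assumption)
  have drift2: "(\<integral>\<^sup>+y. ennreal ((weight y)\<^sup>2) \<partial>P t w) \<le> ennreal (\<rho> * (weight w)\<^sup>2 + b)"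
    if "t \<in> \<Theta>" "w \<in> Z" for t w
  proof -
    have "(\<integral>\<^sup>+y. ennreal (U 2 y) \<partial>P t w) \<le> ennreal (\<rho> * U 2 w + b * indicator W0 w)"
      using dr0 that by blast
    also have "\<dots> \<le> ennreal (\<rho> * U 2 w + b)"
      using b by (intro ennreal_leI) (simp add: indicator_def)
    finally show ?thesis by (simp only: weight_sq)
  qed
  obtain CV where CV: "0 \<le> CV" and FV: "\<And>t w. t \<in> \<Theta> \<Longrightarrow> w \<in> Z \<Longrightarrow> norm (F t w) \<le> CV * weight w"
    by (rule growth_weight_bound[OF growth]) (rule that)
  obtain d where d: "\<And>t. t \<in> \<Theta> \<Longrightarrow> norm (t - s) \<le> d"
    by (rule compact_dist_bound[OF comp(1) s]) (rule that)
  have zeta: "0 < \<zeta>" and mono: "\<And>t. t \<in> \<Theta> \<Longrightarrow> (t - s) \<bullet> mean_field Z P F t \<le> - \<zeta> * (norm (t - s))\<^sup>2"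
    using monotone by (auto simp: quasi_strongly_monotone_def)
  have um: "u t \<in> borel_measurable (borel_on Z)" if "t \<in> \<Theta>" for t
    using measurable_compose_Pair1[OF _ u_joint, of t] that by simp
  have inst: "\<exists>\<sigma> K. lyapunov_chain \<Theta> Z F P s (mean_field Z P F) u Cu Lu CV \<zeta> \<rho> b \<alpha>0 \<delta> \<kappa> \<sigma> K M \<theta> W d"
    if kappa: "0 \<le> \<kappa>" "\<kappa> \<le> 2 * \<delta> - 1" for \<kappa>
  proof -
    obtain \<sigma> K where sK: "0 < \<sigma>" "1 \<le> K"
      "\<And>k. K \<le> k \<Longrightarrow> \<kappa> + \<sigma> \<le> 2 * \<zeta> * step_size \<alpha>0 \<delta> k * real k"
      using slack_exists[OF a0 zeta delta(2) critical kappa(2)] by blast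
    have "lyapunov \<Theta> Z F P s (mean_field Z P F) u Cu Lu CV \<zeta> \<rho> b \<alpha>0 \<delta> \<kappa> \<sigma> K"
      by (rule lyapunov.intro[OF comp(2) compact_imp_closed[OF comp(1)] s
            sa_model_kernel_prob(1)[OF model] sa_model_kernel_prob(2)[OF model] um Cu Lu poisson_sol mono zeta
            CV FV rho b drift2 a0 delta(2) kappa sK])
    then show ?thesis
      by (intro exI lyapunov_chain.intro sa_chain.intro lyapunov_chain_axioms.intro model process u_joint d)
  qed
  define p where "p = 2 * (\<delta> - \<beta>) - 1"
  have p: "0 < p" "p \<le> 1" using beta delta by (auto simp: p_def)
  obtain \<sigma>1 K1 where L1: "lyapunov_chain \<Theta> Z F P s (mean_field Z P F) u Cu Lu CV \<zeta> \<rho> b \<alpha>0 \<delta> (2 * \<delta> - 1) \<sigma>1 K1 M \<theta> W d"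
    using inst[of "2 * \<delta> - 1"] delta by auto
  obtain \<sigma>2 K2 where L2: "lyapunov_chain \<Theta> Z F P s (mean_field Z P F) u Cu Lu CV \<zeta> \<rho> b \<alpha>0 \<delta> (2 * \<beta>) \<sigma>2 K2 M \<theta> W d"
    using inst[of "2 * \<beta>"] beta by auto
  interpret L1: lyapunov_chain \<Theta> Z F P s "mean_field Z P F" u Cu Lu CV \<zeta> \<rho> b \<alpha>0 \<delta> "2 * \<delta> - 1" \<sigma>1 K1 M \<theta> W d
    by (rule L1)
  interpret L2: lyapunov_chain \<Theta> Z F P s "mean_field Z P F" u Cu Lu CV \<zeta> \<rho> b \<alpha>0 \<delta> "2 * \<beta>" \<sigma>2 K2 M \<theta> W d
    by (rule L2)
  define Q where "Q = 2 * L1.wt K1 * d\<^sup>2 + 2 * L1.Bz * L1.r K1 * L1.Cm + 2 * (L1.Bz * b * \<alpha>0\<^sup>2)"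
  (* Chosen so that Dt k^(-p) decreases by at least the increment of the supermartingale at k. *)
  define Dt where "Dt = 2 * (L2.Bz * b * \<alpha>0\<^sup>2) / p"
  define C0 where "C0 = 4 * Q + 2 * L2.Bz * \<alpha>0\<^sup>2 * L2.Cm + Dt"
  have base0: "0 \<le> 2 * L1.wt K1 * d\<^sup>2 + 2 * L1.Bz * L1.r K1 * L1.Cm"
    using L1.wt_pos[OF L1.K] L1.r_pos[OF L1.K] L1.Bz_nonneg L1.Cm_nonneg by simp
  have q0: "0 \<le> L1.Bz * b * \<alpha>0\<^sup>2" using L1.Bz_nonneg b by simp
  have Q0: "0 \<le> Q" unfolding Q_def using base0 q0 by linarith
  have Dt0: "0 \<le> Dt" using L2.Bz_nonneg b p by (simp add: Dt_def)
  have C00: "0 \<le> C0" using Q0 Dt0 L2.Bz_nonneg L2.Cm_nonneg by (simp add: C0_def)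
  (* On exceedance, lyap >= k^(2 beta) x_k / 2 > c^2 / 2. *)
  define h where "h = c\<^sup>2 / 2"
  have h: "0 < h" using c by (simp add: h_def)
  show thesis
  proof (rule that[of "C0 / h + 1" "max K1 K2"])
    show "0 < C0 / h + 1" using C00 h by (simp add: add_nonneg_pos)
    show "1 \<le> max K1 K2" using L1.K by simp
  next
    fix n A assume n: "max K1 K2 \<le> n" and A: "A \<in> sets (history M \<theta> W 0)"
    have n1: "1 \<le> n" using n L1.K by simp
    then have np: "0 < real n" by simp
    have ln0: "0 \<le> ln (real n)" using n1 by simp
    let ?l = "1 + ln (real n)"
    have "(\<Sum>k=K1..<n. L1.r k) = \<alpha>0\<^sup>2 * (\<Sum>k=K1..<n. 1 / real k)"
      unfolding sum_distrib_left
    proof (rule sum.cong)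
      fix k assume "k \<in> {K1..<n}"
      then have k: "1 \<le> k" using L1.K by simp
      show "L1.r k = \<alpha>0\<^sup>2 * (1 / real k)"
        using L1.r_eq[OF k] k by (simp add: powr_minus field_simps)
    qed simp
    also have "\<dots> \<le> \<alpha>0\<^sup>2 * (2 * ln (real n))"
      using n L1.K by (intro mult_left_mono sum_inverse_le_ln) auto
    finally have sr: "(\<Sum>k=K1..<n. L1.r k) \<le> \<alpha>0\<^sup>2 * (2 * ln (real n))" .
    have "L1.Bz * b * (\<Sum>k=K1..<n. L1.r k) \<le> 2 * (L1.Bz * b * \<alpha>0\<^sup>2) * ln (real n)"
      using mult_left_mono[OF sr, of "L1.Bz * b"] L1.Bz_nonneg b by (simp add: mult_ac)
    moreover have "0 \<le> (2 * L1.wt K1 * d\<^sup>2 + 2 * L1.Bz * L1.r K1 * L1.Cm) * ln (real n)"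
      using base0 ln0 by simp
    ultimately have "2 * L1.wt K1 * d\<^sup>2 + 2 * L1.Bz * L1.r K1 * L1.Cm + L1.Bz * b * (\<Sum>k=K1..<n. L1.r k) \<le> Q * ?l"
      using q0 unfolding Q_def distrib_left distrib_right by linarith
    from L1.dist_moment[OF n1 A L1.dominated_mono[OF L1.lyap_at_moment[OF _ A] this order_refl]] n
    have "L1.dominated A (2 / L1.wt n * (Q * ?l)) (L1.E A (L2.sq_dist n))"
      by (simp add: L1.sq_dist_def[abs_def] L2.sq_dist_def[abs_def])
    note dm = L2.lyap_at_le[OF n1 A this]
    let ?np = "real n powr (- p)"
    have Z2: "L1.dominated A ((4 * Q * ?l + 2 * L2.Bz * \<alpha>0\<^sup>2 * L2.Cm) * ?np) (L1.E A (L2.lyap_at n))"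
    proof (rule L1.dominated_mono[OF dm _ order_refl])
      have "L2.wt n / L1.wt n = ?np"
        unfolding L1.wt_def L2.wt_def by (simp add: powr_diff[symmetric] p_def algebra_simps)
      moreover have "2 * L2.wt n * (2 / L1.wt n * (Q * ?l)) = 4 * Q * ?l * (L2.wt n / L1.wt n)" by simp
      ultimately have 1: "2 * L2.wt n * (2 / L1.wt n * (Q * ?l)) = 4 * Q * ?l * ?np" by (simp only:)
      have "real n powr (2 * \<beta> - 2 * \<delta>) \<le> ?np"
        using n1 by (intro powr_mono) (auto simp: p_def)
      then have "L2.r n \<le> \<alpha>0\<^sup>2 * ?np" unfolding L2.r_eq[OF n1] by (intro mult_left_mono) auto
      then have "2 * L2.Bz * L2.Cm * L2.r n \<le> 2 * L2.Bz * L2.Cm * (\<alpha>0\<^sup>2 * ?np)"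
        using L2.Bz_nonneg L2.Cm_nonneg by (intro mult_left_mono) auto
      with 1 show "2 * L2.wt n * (2 / L1.wt n * (Q * ?l)) + 2 * L2.Bz * L2.r n * L2.Cm
          \<le> (4 * Q * ?l + 2 * L2.Bz * \<alpha>0\<^sup>2 * L2.Cm) * ?np"
        by (simp add: algebra_simps)
    qed
    have Dstep: "Dt * real (Suc k) powr (- p) + L2.Bz * b * L2.r k \<le> Dt * real k powr (- p)"
      if "n \<le> k" for k
    proof -
      have k: "1 \<le> k" using that n1 by simp
      have "L2.r k = \<alpha>0\<^sup>2 * real k powr (- p - 1)"
        unfolding L2.r_eq[OF k] by (simp add: p_def algebra_simps)
      then have "L2.Bz * b * L2.r k = Dt * (p / 2 * real k powr (- p - 1))" using p by (simp add: Dt_def)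
      then have "Dt * real (Suc k) powr (- p) + L2.Bz * b * L2.r k
          = Dt * (real (Suc k) powr (- p) + p / 2 * real k powr (- p - 1))" by (simp only: distrib_left)
      also have "\<dots> \<le> Dt * real k powr (- p)"
        using Dt0 by (intro mult_left_mono powr_neg_increment p k)
      finally show ?thesis .
    qed
    have "L1.dominated A ((4 * Q * ?l + 2 * L2.Bz * \<alpha>0\<^sup>2 * L2.Cm) * ?np + Dt * ?np)
        (ennreal h * emeasure M {\<omega>\<in>A. \<exists>k\<ge>n. h < L2.lyap_at k \<omega>})"
      using n h Dt0 Dstep
      by (intro L2.exceedance_bound[OF _ A _ _ _ Z2, where t = "\<lambda>k. Dt * real k powr (- p)"]) auto
    moreover have "(4 * Q * ?l + 2 * L2.Bz * \<alpha>0\<^sup>2 * L2.Cm) * ?np + Dt * ?np \<le> C0 * ?l\<^sup>2 * ?np"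
    proof -
      have l2: "?l \<le> ?l\<^sup>2" "1 \<le> ?l\<^sup>2"
        using ln0 by (auto simp: power2_eq_square algebra_simps)
      have "4 * Q * ?l + 2 * L2.Bz * \<alpha>0\<^sup>2 * L2.Cm + Dt \<le> 4 * Q * ?l\<^sup>2 + 2 * L2.Bz * \<alpha>0\<^sup>2 * L2.Cm * ?l\<^sup>2 + Dt * ?l\<^sup>2"
        using l2 Q0 Dt0 L2.Bz_nonneg L2.Cm_nonneg mult_left_mono[OF l2(2), of Dt]
          mult_left_mono[OF l2(2), of "2 * L2.Bz * \<alpha>0\<^sup>2 * L2.Cm"]
        by (intro add_mono mult_left_mono) auto
      also have "\<dots> = C0 * ?l\<^sup>2" by (simp add: C0_def distrib_right)
      finally have "(4 * Q * ?l + 2 * L2.Bz * \<alpha>0\<^sup>2 * L2.Cm + Dt) * ?np \<le> C0 * ?l\<^sup>2 * ?np"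
        by (intro mult_right_mono) auto
      then show ?thesis by (simp only: distrib_right)
    qed
    ultimately have hb: "L1.dominated A (C0 * ?l\<^sup>2 * ?np) (ennreal h * emeasure M {\<omega>\<in>A. \<exists>k\<ge>n. h < L2.lyap_at k \<omega>})"
      by (rule L1.dominated_mono[OF _ _ order_refl])
    have AM[measurable]: "A \<in> sets M" using A by (rule L1.hist_in_M)
    have Asp: "A \<subseteq> space M" using sets.sets_into_space[OF AM] .
    have sm: "{\<omega>\<in>A. \<exists>k\<ge>n. h < L2.lyap_at k \<omega>} \<in> sets M"
    proof -
      have "{\<omega>\<in>A. \<exists>k\<ge>n. h < L2.lyap_at k \<omega>} = A \<inter> {\<omega>\<in>space M. \<exists>k\<ge>n. h < L2.lyap_at k \<omega>}"
        using Asp by auto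
      then show ?thesis by simp
    qed
    have "emeasure M {\<omega>\<in>A. \<exists>k\<ge>n. c * real k powr (- \<beta>) < norm (\<theta> k \<omega> - s)}
        \<le> emeasure M {\<omega>\<in>A. \<exists>k\<ge>n. h < L2.lyap_at k \<omega>}"
    proof (intro emeasure_mono sm subsetI, clarsimp, intro exI conjI)
      fix \<omega> k assume w: "\<omega> \<in> A" and k: "n \<le> k" and far: "c * real k powr (- \<beta>) < norm (\<theta> k \<omega> - s)"
      have k1: "1 \<le> k" using k n1 by simp
      have wk: "0 < L2.wt k" by (rule L2.wt_pos[OF k1])
      have "(c * real k powr (- \<beta>))\<^sup>2 < (norm (\<theta> k \<omega> - s))\<^sup>2"
        using far c by (intro power_strict_mono) auto
      moreover have "L2.wt k * (c * real k powr (- \<beta>))\<^sup>2 = c\<^sup>2"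
        unfolding L2.wt_def using k1 by (simp add: power_mult_distrib powr_power powr_minus field_simps)
      ultimately have "c\<^sup>2 < L2.wt k * (norm (\<theta> k \<omega> - s))\<^sup>2"
        using wk by (metis mult_less_cancel_left_pos)
      moreover have "L2.wt k * (norm (\<theta> k \<omega> - s))\<^sup>2 / 2 \<le> L2.lyap_at k \<omega>"
        unfolding L2.lyap_at_def using w Asp by (intro L2.lyap_lower k1 L1.theta_in L1.W_in) auto
      ultimately show "h < L2.lyap_at k \<omega>" by (simp add: h_def)
    qed
    also have "\<dots> = ennreal (1 / h) * (ennreal h * emeasure M {\<omega>\<in>A. \<exists>k\<ge>n. h < L2.lyap_at k \<omega>})"
      using h by (simp add: mult.assoc[symmetric] ennreal_mult[symmetric])
    finally have bad: "emeasure M {\<omega>\<in>A. \<exists>k\<ge>n. c * real k powr (- \<beta>) < norm (\<theta> k \<omega> - s)}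
        \<le> ennreal (1 / h) * (ennreal h * emeasure M {\<omega>\<in>A. \<exists>k\<ge>n. h < L2.lyap_at k \<omega>})" .
    have le: "1 / h * (C0 * ?l\<^sup>2 * ?np) \<le> (C0 / h + 1) * ?l\<^sup>2 * ?np"
      by (simp add: algebra_simps)
    have "L1.dominated A ((C0 / h + 1) * ?l\<^sup>2 * ?np)
        (emeasure M {\<omega>\<in>A. \<exists>k\<ge>n. c * real k powr (- \<beta>) < norm (\<theta> k \<omega> - s)})"
      by (rule L1.dominated_mono[OF L1.dominated_scale[OF hb] le bad]) (use h in simp)
    then show "emeasure M {\<omega>\<in>A. \<exists>k\<ge>n. c * real k powr (- \<beta>) < norm (\<theta> k \<omega> - s)}
      \<le> ennreal ((C0 / h + 1) * ?l\<^sup>2 * real n powr (- (2 * (\<delta> - \<beta>) - 1)))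
         * (\<integral>\<^sup>+\<omega>\<in>A. ennreal (U 2 (W 0 \<omega>)) \<partial>M)"
      by (simp add: L1.dominated_def L1.E_def L1.V2_def weight_sq p_def)
  qed
qed

theorem theorem1:
  fixes M :: "'c measure"
    and \<Theta> :: "'a::euclidean_space set"
    and \<W> :: "'b::euclidean_space set"
    and F :: "'a \<Rightarrow> 'b \<Rightarrow> 'a"
    and P :: "'a \<Rightarrow> 'b \<Rightarrow> 'b measure"
    and \<theta> :: "nat \<Rightarrow> 'c \<Rightarrow> 'a"
    and W :: "nat \<Rightarrow> 'c \<Rightarrow> 'b"
    and \<theta>\<^sub>s :: 'a
    and \<alpha>\<^sub>0 \<delta> \<zeta> \<beta> c :: real
  assumes model: "sa_model \<Theta> \<W> F P"
    and process: "sa_process M \<Theta> \<W> F P (step_size \<alpha>\<^sub>0 \<delta>) \<theta> W"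
    and step: "\<alpha>\<^sub>0 > 0" "1/2 < \<delta>" "\<delta> \<le> 1"
    and compactness: "\<Theta> \<noteq> {}" "compact \<Theta>" "convex \<Theta>"
    and ergodicity: "ergodic_kernels \<Theta> \<W> P" "integrable M (\<lambda>\<omega>. U 2 (W 0 \<omega>))"
    and kernel_cont: "kernel_continuity \<Theta> \<W> P"
    and growth: "growth_condition \<Theta> \<W> F"
    and target: "\<theta>\<^sub>s \<in> interior \<Theta>" "mean_field \<W> P F \<theta>\<^sub>s = 0"
    and monotone: "quasi_strongly_monotone \<Theta> (mean_field \<W> P F) \<theta>\<^sub>s \<zeta>"
    and critical: "\<delta> = 1 \<Longrightarrow> 2 * \<zeta> * \<alpha>\<^sub>0 > 1"
    and beta: "0 \<le> \<beta>" "\<beta> < \<delta> - 1/2"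
    and c: "c > 0"
  shows "\<exists>C>0. \<exists>K>0. \<forall>k\<^sub>0::nat. real k\<^sub>0 \<ge> K \<longrightarrow>
    (AE \<omega> in M.
       cond_prob_given M (history M \<theta> W 0)
         {\<omega>' \<in> space M. \<forall>k\<ge>k\<^sub>0. norm (\<theta> k \<omega>' - \<theta>\<^sub>s) \<le> c * real k powr (- \<beta>)} \<omega>
       \<ge> 1 - C * U 2 (W 0 \<omega>) * (1 + ln (real k\<^sub>0))\<^sup>2 * real k\<^sub>0 powr (- (2 * (\<delta> - \<beta>) - 1)))"
proof -
  have s: "\<theta>\<^sub>s \<in> \<Theta>" using target(1) interior_subset by auto
  obtain C K where C: "0 < C" and K: "1 \<le> K"
    and est: "\<And>n A. K \<le> n \<Longrightarrow> A \<in> sets (history M \<theta> W 0) \<Longrightarrow>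
      emeasure M {\<omega>\<in>A. \<exists>k\<ge>n. c * real k powr (- \<beta>) < norm (\<theta> k \<omega> - \<theta>\<^sub>s)}
      \<le> ennreal (C * (1 + ln (real n))\<^sup>2 * real n powr (- (2 * (\<delta> - \<beta>) - 1)))
         * (\<integral>\<^sup>+\<omega>\<in>A. ennreal (U 2 (W 0 \<omega>)) \<partial>M)"
    using exceedance_estimate[OF model process step compactness(2,3) s ergodicity(1) kernel_cont growth
        monotone critical beta c] by blast
  interpret ch: sa_chain M \<Theta> \<W> F P "step_size \<alpha>\<^sub>0 \<delta>" \<theta> W
    by (rule sa_chain.intro[OF model process])
  interpret prob_space M by (rule ch.prob_M)
  show ?thesis
  proof (rule exI[of _ C], rule conjI[OF C], rule exI[of _ "real K"], intro conjI allI impI)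
    show "0 < real K" using K by simp
    fix n :: nat assume "real K \<le> real n"
    then have n: "K \<le> n" by simp
    define R where "R = C * (1 + ln (real n))\<^sup>2 * real n powr (- (2 * (\<delta> - \<beta>) - 1))"
    have R0: "0 \<le> R" using C by (simp add: R_def)
    define Gs where "Gs = {\<omega> \<in> space M. \<forall>k\<ge>n. norm (\<theta> k \<omega> - \<theta>\<^sub>s) \<le> c * real k powr (- \<beta>)}"
    have [measurable]: "\<theta> k \<in> borel_measurable M" for k by (rule ch.theta_borel)
    have GsM: "Gs \<in> sets M" unfolding Gs_def by measurable
    have U2: "0 \<le> U 2 w" for w :: 'b by (simp add: U_def)
    have "AE \<omega> in M. 1 - R * U 2 (W 0 \<omega>) \<le> real_cond_exp M (history M \<theta> W 0) (indicator Gs) \<omega>"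
    proof (rule real_cond_exp_indicator_lower_bound[OF ch.prob_M ch.hist_sub GsM])
      have [measurable]: "W 0 \<in> borel_measurable (history M \<theta> W 0)" by (rule history_measurable) simp
      show "(\<lambda>\<omega>. R * U 2 (W 0 \<omega>)) \<in> borel_measurable (history M \<theta> W 0)" unfolding U_def by measurable
      show Ri: "integrable M (\<lambda>\<omega>. R * U 2 (W 0 \<omega>))" using ergodicity(2) by simp
      fix A assume A: "A \<in> sets (history M \<theta> W 0)"
      then have AM: "A \<in> sets M" by (rule ch.hist_in_M)
      have "A - Gs = {\<omega>\<in>A. \<exists>k\<ge>n. c * real k powr (- \<beta>) < norm (\<theta> k \<omega> - \<theta>\<^sub>s)}"
        using sets.sets_into_space[OF AM] by (auto simp: Gs_def not_le)
      then have "ennreal (measure M (A - Gs)) \<le> ennreal R * (\<integral>\<^sup>+\<omega>\<in>A. ennreal (U 2 (W 0 \<omega>)) \<partial>M)"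
        using est[OF n A] by (simp add: emeasure_eq_measure R_def)
      also have "(\<integral>\<^sup>+\<omega>\<in>A. ennreal (U 2 (W 0 \<omega>)) \<partial>M) = (\<integral>\<^sup>+\<omega>. ennreal (indicator A \<omega> * U 2 (W 0 \<omega>)) \<partial>M)"
        by (intro nn_integral_cong) (simp add: indicator_def)
      also have "\<dots> = ennreal (\<integral>\<omega>. indicator A \<omega> * U 2 (W 0 \<omega>) \<partial>M)"
        using integrable_mult_indicator[OF AM ergodicity(2)] U2 by (intro nn_integral_eq_integral) auto
      also have "ennreal R * \<dots> = ennreal (\<integral>\<omega>\<in>A. R * U 2 (W 0 \<omega>) \<partial>M)"
        using R0 by (simp add: set_lebesgue_integral_def ennreal_mult'[symmetric] mult.left_commute)
      finally have "ennreal (measure M (A - Gs)) \<le> ennreal (\<integral>\<omega>\<in>A. R * U 2 (W 0 \<omega>) \<partial>M)" .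
      moreover have "0 \<le> (\<integral>\<omega>\<in>A. R * U 2 (W 0 \<omega>) \<partial>M)"
        unfolding set_lebesgue_integral_def using R0 U2 by (intro integral_nonneg_AE AE_I2) simp
      ultimately show "measure M (A - Gs) \<le> (\<integral>\<omega>\<in>A. R * U 2 (W 0 \<omega>) \<partial>M)"
        by (simp add: ennreal_le_iff)
    qed
    then show "AE \<omega> in M. 1 - C * U 2 (W 0 \<omega>) * (1 + ln (real n))\<^sup>2 * real n powr (- (2 * (\<delta> - \<beta>) - 1))
        \<le> cond_prob_given M (history M \<theta> W 0)
         {\<omega>' \<in> space M. \<forall>k\<ge>n. norm (\<theta> k \<omega>' - \<theta>\<^sub>s) \<le> c * real k powr (- \<beta>)} \<omega>"
      unfolding cond_prob_given_def Gs_def[symmetric] by (simp add: R_def mult_ac)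
  qed
qed

end
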